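(* Suppose that for some fixed $\varepsilon>0$ there is an algorithm that solves \textsc{All-Pairs Max-Flow} on directed graphs with $n$ nodes, $m=O(n)$ edges and integer capacities in $[n]=\{1,\dots,n\}$ in time $O((n^2m)^{1-\varepsilon})$. Then there is $\delta=\delta(\varepsilon)>0$ such that MAX-CNF-SAT on $n'$ variables and $O(n')$ clauses can be solved in time $O(2^{(1-\delta)n'})$; in particular, SETH is false.
   Context: \textsc{All-Pairs Max-Flow}: given a directed edge-capacitated graph $G=(V,E,w)$, output, for every pair of nodes $u,v\in V$, the value of the maximum flow that can be shipped in $G$ from $u$ to $v$. MAX-CNF-SAT: given a CNF formula, output the maximum number of its clauses that can be simultaneously satisfied. SETH: for every fixed $\varepsilon>0$ there is an integer $k\ge3$ such that $k$-SAT on $n$ variables and $m$ clauses cannot be solved in time $2^{(1-\varepsilon)n}\mathrm{poly}(m)$. *)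

theory Defs
  imports
    Complex_Main
    "HOL-Library.Log_Nat"
    "HOL-Computational_Algebra.Polynomial"
    "Graph_Theory.Pair_Digraph"
begin

section \<open>Random access machine with logarithmic cost\<close>

text \<open>
  Programs of a random access machine over the natural numbers, in structured form. The memory
  is a family of unbounded arrays; a program mentions only a fixed finite number of them, so
  interleaving their addresses gives an ordinary RAM with a single memory, and
  a scalar register is cell 0 of an array.

  Running time is charged by the logarithmic cost criterion: every elementary operation costs the
  total bit length of its operands and of the addresses it uses. A word RAM with words of
  logarithmically many bits runs at the same speed up to polylogarithmic factors, which
  change time bounds of the form \<open>N powr (1 - \<epsilon>)\<close> only by an arbitrarily small amount in
  \<open>\<epsilon>\<close>.
\<close>

type_synonym mem = "nat \<Rightarrow> nat \<Rightarrow> nat"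

datatype binop = Plus | Monus | Times | Quot | Rem

datatype expr = Const nat | Read nat expr | Bin binop expr expr

datatype com =
    Skip
  | Write nat expr expr
  | Seq com com
  | Cond expr com com
  | Loop expr com

definition bits :: "nat \<Rightarrow> nat" where
  "bits x = max 1 (floorlog 2 x)"

fun apply_op :: "binop \<Rightarrow> nat \<Rightarrow> nat \<Rightarrow> nat" where
  "apply_op Plus x y = x + y"
| "apply_op Monus x y = x - y"
| "apply_op Times x y = x * y"
| "apply_op Quot x y = x div y"
| "apply_op Rem x y = x mod y"

primrec val :: "expr \<Rightarrow> mem \<Rightarrow> nat" where
  "val (Const k) M = k"
| "val (Read a e) M = M a (val e M)"
| "val (Bin f e1 e2) M = apply_op f (val e1 M) (val e2 M)"

primrec cost :: "expr \<Rightarrow> mem \<Rightarrow> nat" where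
  "cost (Const k) M = bits k"
| "cost (Read a e) M = cost e M + bits (val e M) + bits (M a (val e M))"
| "cost (Bin f e1 e2) M = cost e1 M + cost e2 M + bits (val e1 M) + bits (val e2 M)"

text \<open>\<open>exec c M t M'\<close>: started in memory \<open>M\<close>, program \<open>c\<close> halts in memory \<open>M'\<close> after
  time \<open>t\<close>. A guard is true iff its value is nonzero.\<close>

inductive exec :: "com \<Rightarrow> mem \<Rightarrow> nat \<Rightarrow> mem \<Rightarrow> bool" where
  Skip: "exec Skip M 1 M"
| Write: "exec (Write a i e) M
    (cost i M + cost e M + bits (val i M) + bits (val e M))
    (M(a := (M a)(val i M := val e M)))"
| Seq: "exec c1 M t1 M1 \<Longrightarrow> exec c2 M1 t2 M2 \<Longrightarrow> exec (Seq c1 c2) M (t1 + t2) M2"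
| CondT: "val b M \<noteq> 0 \<Longrightarrow> exec c1 M t M' \<Longrightarrow>
    exec (Cond b c1 c2) M (cost b M + bits (val b M) + t) M'"
| CondF: "val b M = 0 \<Longrightarrow> exec c2 M t M' \<Longrightarrow>
    exec (Cond b c1 c2) M (cost b M + bits (val b M) + t) M'"
| LoopF: "val b M = 0 \<Longrightarrow> exec (Loop b c) M (cost b M + bits (val b M)) M"
| LoopT: "val b M \<noteq> 0 \<Longrightarrow> exec c M t1 M1 \<Longrightarrow> exec (Loop b c) M1 t2 M2 \<Longrightarrow>
    exec (Loop b c) M (cost b M + bits (val b M) + t1 + t2) M2"

lemma exec_deterministic:
  "exec c M t1 M1 \<Longrightarrow> exec c M t2 M2 \<Longrightarrow> t1 = t2 \<and> M1 = M2"
proof (induction arbitrary: t2 M2 rule: exec.induct)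
  case (Skip M)
  from Skip.prems show ?case by cases simp
next
  case (Write a i e M)
  from Write.prems show ?case by cases simp
next
  case (Seq c1 M t1 M1 c2 t2' M2')
  from Seq.prems show ?case
  proof cases
    case inner: (Seq s1 N1 s2)
    with Seq.IH(1) have "t1 = s1 \<and> M1 = N1" by blast
    with inner Seq.IH(2) show ?thesis by blast
  qed
next
  case (CondT b M c1 t M' c2)
  from CondT.prems CondT.hyps show ?case by cases (auto dest: CondT.IH)
next
  case (CondF b M c2 t M' c1)
  from CondF.prems CondF.hyps show ?case by cases (auto dest: CondF.IH)
next
  case (LoopF b M c)
  from LoopF.prems LoopF.hyps show ?case by cases simp_all
next
  case (LoopT b M c t1 M1 t2' M2')
  from LoopT.prems show ?case
  proof cases
    case inner: LoopF
    with LoopT.hyps show ?thesis by simp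
  next
    case inner: (LoopT s1 N1 s2)
    with LoopT.IH(1) have "t1 = s1 \<and> M1 = N1" by blast
    with inner LoopT.IH(2) show ?thesis by blast
  qed
qed

text \<open>The input is placed in array 0, all other cells being 0; the output is read off array 1.\<close>

definition input_mem :: "nat list \<Rightarrow> mem" where
  "input_mem xs a i = (if a = 0 \<and> i < length xs then xs ! i else 0)"

definition computes_within ::
    "com \<Rightarrow> nat list \<Rightarrow> real \<Rightarrow> ((nat \<Rightarrow> nat) \<Rightarrow> bool) \<Rightarrow> bool" where
  "computes_within P xs T correct \<longleftrightarrow>
    (\<exists>t M. exec P (input_mem xs) t M \<and> real t \<le> T \<and> correct (M 1))"


section \<open>All-Pairs Max-Flow\<close>

definition is_flow ::
    "('v, 'e) pre_digraph \<Rightarrow> ('e \<Rightarrow> nat) \<Rightarrow> 'v \<Rightarrow> 'v \<Rightarrow> ('e \<Rightarrow> real) \<Rightarrow> bool" where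
  "is_flow G w s t f \<longleftrightarrow>
    (\<forall>e\<in>arcs G. 0 \<le> f e \<and> f e \<le> real (w e)) \<and>
    (\<forall>x\<in>verts G - {s, t}. (\<Sum>e\<in>in_arcs G x. f e) = (\<Sum>e\<in>out_arcs G x. f e))"

definition flow_value :: "('v, 'e) pre_digraph \<Rightarrow> 'v \<Rightarrow> ('e \<Rightarrow> real) \<Rightarrow> real" where
  "flow_value G s f = (\<Sum>e\<in>out_arcs G s. f e) - (\<Sum>e\<in>in_arcs G s. f e)"

definition max_flow :: "('v, 'e) pre_digraph \<Rightarrow> ('e \<Rightarrow> nat) \<Rightarrow> 'v \<Rightarrow> 'v \<Rightarrow> real" where
  "max_flow G w s t = (SUP f\<in>{f. is_flow G w s t f}. flow_value G s f)"

text \<open>A graph is given by the number of nodes, the number of edges, and the edges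
  with their capacities, listed in an arbitrary order.\<close>

definition encode_network :: "nat \<Rightarrow> (nat \<times> nat) list \<Rightarrow> (nat \<times> nat \<Rightarrow> nat) \<Rightarrow> nat list" where
  "encode_network n es w = n # length es # concat (map (\<lambda>e. [fst e, snd e, w e]) es)"

text \<open>
  \<open>solves_all_pairs_max_flow P C T\<close>: on every simple directed graph with nodes \<open>0, \<dots>, n - 1\<close>,
  \<open>m \<le> C * n\<close> edges and capacities in \<open>{1..n}\<close>, program \<open>P\<close> computes in time \<open>T n m\<close> the
  maximum flow values of all ordered pairs of distinct nodes, as an \<open>n \<times> n\<close> table stored row
  by row (the diagonal is arbitrary).

  The instances satisfy \<open>1 \<le> n \<le> m\<close>. Without a lower bound on \<open>m\<close> a time bound in terms of
  \<open>n\<^sup>2 m\<close> could not be met for trivial reasons: it vanishes for \<open>m = 0\<close>, and for \<open>m = 1\<close>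
  it does not even allow for writing the output.
\<close>

definition solves_all_pairs_max_flow :: "com \<Rightarrow> nat \<Rightarrow> (nat \<Rightarrow> nat \<Rightarrow> real) \<Rightarrow> bool" where
  "solves_all_pairs_max_flow P C T \<longleftrightarrow>
    (\<forall>n m (G :: nat pair_pre_digraph) es w.
      pair_digraph G \<and> pverts G = {..<n} \<and> card (parcs G) = m \<and>
      0 < n \<and> n \<le> m \<and> m \<le> C * n \<and>
      (\<forall>e\<in>parcs G. w e \<in> {1..n}) \<and>
      distinct es \<and> set es = parcs G \<longrightarrow>
      computes_within P (encode_network n es w) (T n m)
        (\<lambda>out. \<forall>u\<in>pverts G. \<forall>v\<in>pverts G. u \<noteq> v \<longrightarrow>
           real (out (u * n + v)) = max_flow (with_proj G) w u v))"


section \<open>CNF formulas, MAX-CNF-SAT and SETH\<close>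

text \<open>The literal \<open>(i, True)\<close> is the variable \<open>i\<close>, and \<open>(i, False)\<close> is its negation. A clause
  lists its literals without repetition; the clauses of a formula are counted with multiplicity.\<close>

type_synonym literal = "nat \<times> bool"
type_synonym clause = "literal list"
type_synonym cnf = "clause list"

definition is_cnf :: "nat \<Rightarrow> cnf \<Rightarrow> bool" where
  "is_cnf n F \<longleftrightarrow> (\<forall>c\<in>set F. distinct c \<and> (\<forall>l\<in>set c. fst l < n))"

definition satisfies_clause :: "(nat \<Rightarrow> bool) \<Rightarrow> clause \<Rightarrow> bool" where
  "satisfies_clause \<sigma> c \<longleftrightarrow> (\<exists>l\<in>set c. \<sigma> (fst l) = snd l)"

definition satisfiable :: "cnf \<Rightarrow> bool" where
  "satisfiable F \<longleftrightarrow> (\<exists>\<sigma>. \<forall>c\<in>set F. satisfies_clause \<sigma> c)"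

definition max_sat :: "cnf \<Rightarrow> nat" where
  "max_sat F = Max (range (\<lambda>\<sigma>. length (filter (satisfies_clause \<sigma>) F)))"

definition encode_cnf :: "nat \<Rightarrow> cnf \<Rightarrow> nat list" where
  "encode_cnf n F =
    n # length F # concat (map (\<lambda>c. length c # map (\<lambda>(i, b). 2 * i + of_bool b) c) F)"

text \<open>\<open>solves_max_cnf_sat P C T\<close>: program \<open>P\<close> solves MAX-CNF-SAT on formulas with \<open>n\<close> variables
  and at most \<open>C * n\<close> clauses in time \<open>T n\<close>.\<close>

definition solves_max_cnf_sat :: "com \<Rightarrow> nat \<Rightarrow> (nat \<Rightarrow> real) \<Rightarrow> bool" where
  "solves_max_cnf_sat P C T \<longleftrightarrow>
    (\<forall>n F. is_cnf n F \<and> length F \<le> C * n \<longrightarrow>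
      computes_within P (encode_cnf n F) (T n) (\<lambda>out. out 0 = max_sat F))"

definition solves_k_sat :: "nat \<Rightarrow> com \<Rightarrow> (nat \<Rightarrow> nat \<Rightarrow> real) \<Rightarrow> bool" where
  "solves_k_sat k P T \<longleftrightarrow>
    (\<forall>n F. is_cnf n F \<and> (\<forall>c\<in>set F. length c \<le> k) \<longrightarrow>
      computes_within P (encode_cnf n F) (T n (length F)) (\<lambda>out. out 0 = of_bool (satisfiable F)))"

definition SETH :: bool where
  "SETH \<longleftrightarrow> (\<forall>\<epsilon>>0. \<exists>k\<ge>3. \<not> (\<exists>P (p :: real poly).
     solves_k_sat k P (\<lambda>n m. 2 powr ((1 - \<epsilon>) * real n) * poly p (real m))))"

end

theory Submission
  imports Defs
begin

text \<open>
  The variables are split into three blocks; \<open>\<alpha>\<close>, \<open>\<beta>\<close>, \<open>\<gamma>\<close> range over the assignments of the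
  blocks, which are the sources, the middle nodes and the sinks of a network. If \<open>\<alpha>\<close> fails
  clause \<open>c\<close>, it feeds a node \<open>C\<^sub>c\<close>, otherwise it feeds a node \<open>D\<^sub>c\<close> directly; \<open>D\<^sub>c\<close> feeds \<open>\<gamma>\<close> if
  \<open>\<gamma>\<close> fails \<open>c\<close>. From \<open>C\<^sub>c\<close> one unit can pass to \<open>D\<^sub>c\<close> through each \<open>\<beta>\<close> that fails \<open>c\<close>, and
  \<open>\<beta>\<close> lets at most \<open>T\<close> units through. The sinks saturate the \<open>D\<^sub>c\<close> that are fed directly, so that
  the units passing through \<open>\<beta>\<close> count only the clauses that all three fail: up to a summand
  depending on \<open>\<alpha>\<close> and \<open>\<gamma>\<close> alone, the maximum flow from \<open>\<alpha>\<close> to \<open>\<gamma>\<close> is the sum over \<open>\<beta>\<close> of the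
  number of unsatisfied clauses truncated at \<open>T\<close>.

  Giving \<open>\<alpha>\<close> a second index \<open>j\<close>, a number of additional clauses that nobody satisfies,
  the difference of the flows for \<open>j\<close> and \<open>j + 1\<close> shows whether some \<open>\<beta>\<close> leaves fewer than
  \<open>T - j\<close> clauses unsatisfied. So one all-pairs computation on a network with \<open>2 powr (n / 3)\<close>
  nodes and edges, up to a polynomial factor in the number of clauses, determines the maximum. As
  the factor is polynomial, no sparsification is needed to refute SETH.
\<close>

section \<open>Time-bounded total correctness for the machine\<close>

section \<open>Reasoning about programs\<close>

text \<open>A flow value sums over all \<beta>, so it reveals an existential statement about \<beta>
  only if the terms cannot cancel. Truncation provides this:
  \<open>min T (u + j + 1) - min T (u + j)\<close> is 1 if \<open>u + j < T\<close> and 0 otherwise,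
  so the sum grows iff some \<beta> lies below the threshold.

  The obstacle is that a unit entering \<beta> from one clause may leave it towards another. Hence
  only exits may be counted. If \<alpha> satisfies \<open>c\<close>, then \<open>D\<^sub>c\<close>
  already receives directly all that its edge to \<gamma> can carry, so an exit is profitable only
  at a clause that \<alpha>, \<beta> and \<gamma> all fail. The capacity of that edge is the number
  of \<beta>, which is the most a clause can get from all \<beta> at one unit each.

  With three blocks, \<open>N ^ 2 * N\<close> is 2^n up to polynomial factors, so a saving in the
  exponent of the flow algorithm carries over. All other work costs about 4^(n/3), which is why the
  saving is cut off at 1/3; half of what remains pays for the polynomial factors.\<close>

definition run :: "com \<Rightarrow> mem \<Rightarrow> nat \<Rightarrow> (mem \<Rightarrow> bool) \<Rightarrow> bool" where
  "run c M T Q \<longleftrightarrow> (\<exists>t M'. exec c M t M' \<and> t \<le> T \<and> Q M')"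

lemma run_mono:
  assumes "run c M T Q" "T \<le> T'" "\<And>M'. Q M' \<Longrightarrow> Q' M'"
  shows "run c M T' Q'"
  using assms unfolding run_def by (meson le_trans)

lemma run_Seq:
  assumes "run c1 M T1 Q1" "\<And>M'. Q1 M' \<Longrightarrow> run c2 M' T2 Q" "T1 + T2 \<le> T"
  shows "run (Seq c1 c2) M T Q"
proof -
  from assms(1) obtain t1 M1 where 1: "exec c1 M t1 M1" "t1 \<le> T1" "Q1 M1"
    unfolding run_def by blast
  from assms(2)[OF 1(3)] obtain t2 M2 where 2: "exec c2 M1 t2 M2" "t2 \<le> T2" "Q M2"
    unfolding run_def by blast
  from exec.Seq[OF 1(1) 2(1)] 1 2 assms(3) show ?thesis
    unfolding run_def by (intro exI[of _ "t1 + t2"] exI[of _ M2]) simp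
qed

text \<open>Sizes in units of a common word length \<open>L\<close>: a value has at most
  \<open>L * esize e\<close> bits, and its evaluation costs at most \<open>L * ecost e\<close>. A
  read has size 1 whatever its address, since \<open>fits\<close> bounds the cell itself.\<close>

primrec esize :: "expr \<Rightarrow> nat" where
  "esize (Const k) = 1"
| "esize (Read a e) = 1"
| "esize (Bin f e1 e2) = esize e1 + esize e2"

primrec ecost :: "expr \<Rightarrow> nat" where
  "ecost (Const k) = 1"
| "ecost (Read a e) = ecost e + esize e + 1"
| "ecost (Bin f e1 e2) = ecost e1 + ecost e2 + esize e1 + esize e2"

text \<open>It suffices to bound the constants and the cells that are read: intermediate results have
  at most \<open>esize e\<close> times as many bits.\<close>

primrec fits :: "nat \<Rightarrow> expr \<Rightarrow> mem \<Rightarrow> bool" where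
  "fits L (Const k) M \<longleftrightarrow> k < 2 ^ L"
| "fits L (Read a e) M \<longleftrightarrow> fits L e M \<and> M a (val e M) < 2 ^ L"
| "fits L (Bin f e1 e2) M \<longleftrightarrow> fits L e1 M \<and> fits L e2 M"

lemma bits_le: "x < 2 ^ k \<Longrightarrow> 1 \<le> k \<Longrightarrow> bits x \<le> k"
proof -
  assume "x < 2 ^ k" "1 \<le> k"
  then have "floorlog 2 x \<le> k" by (intro floorlog_leI) auto
  with \<open>1 \<le> k\<close> show ?thesis by (simp add: bits_def)
qed

lemma esize_pos: "1 \<le> esize e"
  by (induction e) auto

text \<open>For \<open>Plus\<close>, both powers are at least 2 because \<open>a\<close> and
  \<open>b\<close> are positive, and two numbers that are at least 2 have a product no smaller than
  their sum.\<close>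

lemma apply_op_less:
  assumes "x < 2 ^ a" "y < 2 ^ b" "1 \<le> a" "1 \<le> b"
  shows "apply_op f x y < 2 ^ (a + b)"
proof -
  have p: "(2::nat) ^ (a + b) = 2 ^ a * 2 ^ b" by (simp add: power_add)
  have x2: "(2::nat) \<le> 2 ^ a" "(2::nat) \<le> 2 ^ b"
    using assms(3,4) by (metis One_nat_def power_increasing power_one_right one_le_numeral)+
  have le: "(2::nat) ^ a \<le> 2 ^ a * 2 ^ b" "(2::nat) ^ b \<le> 2 ^ a * 2 ^ b" by auto
  have add: "(2::nat) ^ a + 2 ^ b \<le> 2 ^ a * 2 ^ b"
  proof -
    obtain u v where "(2::nat) ^ a = u + 2" "(2::nat) ^ b = v + 2"
      using x2 by (metis le_add_diff_inverse2)
    then show ?thesis by simp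
  qed
  show ?thesis
  proof (cases f)
    case Plus then show ?thesis using add assms p by simp
  next
    case Monus
    then show ?thesis using le assms p by (metis apply_op.simps(2) diff_le_self le_less_trans less_le_trans)
  next
    case Times
    then show ?thesis using assms p by (simp add: mult_strict_mono)
  next
    case Quot
    have "x div y \<le> x" by simp
    then show ?thesis using Quot le assms p by (metis apply_op.simps(4) le_less_trans less_le_trans)
  next
    case Rem
    have "x mod y \<le> x" by simp
    then show ?thesis using Rem le assms p by (metis apply_op.simps(5) le_less_trans less_le_trans)
  qed
qed

lemma fits_val_cost:
  assumes "fits L e M" "1 \<le> L"
  shows "val e M < 2 ^ (L * esize e) \<and> cost e M \<le> L * ecost e"
  using assms(1)
proof (induction e)
  case (Const k)
  then show ?case using assms(2) bits_le by simp
next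
  case (Read a e)
  then have "bits (val e M) \<le> L * esize e" "bits (M a (val e M)) \<le> L"
    using assms(2) esize_pos[of e] by (auto intro!: bits_le simp: Suc_le_eq)
  with Read show ?case by (simp add: algebra_simps)
next
  case (Bin f e1 e2)
  have L: "1 \<le> L * esize e1" "1 \<le> L * esize e2"
    using assms(2) esize_pos[of e1] esize_pos[of e2] by (auto simp: Suc_le_eq)
  then have "bits (val e1 M) \<le> L * esize e1" "bits (val e2 M) \<le> L * esize e2"
    using Bin by (auto intro: bits_le)
  moreover have "apply_op f (val e1 M) (val e2 M) < 2 ^ (L * esize e1 + L * esize e2)"
    using Bin L by (intro apply_op_less) auto
  ultimately show ?case using Bin by (simp add: algebra_simps)
qed

lemma fits_bits:
  assumes "fits L e M" "1 \<le> L"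
  shows "bits (val e M) \<le> L * esize e"
  using fits_val_cost[OF assms] assms(2) esize_pos[of e] by (intro bits_le) (auto simp: Suc_le_eq)

definition wcost :: "expr \<Rightarrow> expr \<Rightarrow> nat" where
  "wcost i e = ecost i + ecost e + esize i + esize e"

definition gcost :: "expr \<Rightarrow> nat" where
  "gcost b = ecost b + esize b"

lemma run_Write:
  assumes "1 \<le> L" "fits L i M" "fits L e M" "Q (M(a := (M a)(val i M := val e M)))"
    and "L * wcost i e \<le> T"
  shows "run (Write a i e) M T Q"
  unfolding run_def
proof (intro exI conjI)
  show "exec (Write a i e) M (cost i M + cost e M + bits (val i M) + bits (val e M))
    (M(a := (M a)(val i M := val e M)))" by (rule exec.Write)
  show "cost i M + cost e M + bits (val i M) + bits (val e M) \<le> T"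
    using assms(5) fits_val_cost[OF assms(2,1)] fits_val_cost[OF assms(3,1)]
      fits_bits[OF assms(2,1)] fits_bits[OF assms(3,1)]
    by (simp add: wcost_def algebra_simps)
qed (rule assms(4))

lemma guard_cost:
  assumes "1 \<le> L" "fits L b M"
  shows "cost b M + bits (val b M) \<le> L * gcost b"
  using fits_val_cost[OF assms(2,1)] fits_bits[OF assms(2,1)] by (simp add: gcost_def algebra_simps)

lemma run_Cond:
  assumes "1 \<le> L" "fits L b M"
    and "val b M \<noteq> 0 \<Longrightarrow> run c1 M T1 Q" "val b M = 0 \<Longrightarrow> run c2 M T1 Q"
    and "L * gcost b + T1 \<le> T"
  shows "run (Cond b c1 c2) M T Q"
proof (cases "val b M = 0")
  case True
  with assms(4) obtain t M' where "exec c2 M t M'" "t \<le> T1" "Q M'" unfolding run_def by blast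
  then show ?thesis unfolding run_def using exec.CondF[OF True] guard_cost[OF assms(1,2)] assms(5)
    by (intro exI[of _ "cost b M + bits (val b M) + t"] exI[of _ M']) auto
next
  case False
  with assms(3) obtain t M' where "exec c1 M t M'" "t \<le> T1" "Q M'" unfolding run_def by blast
  then show ?thesis unfolding run_def using exec.CondT[OF False] guard_cost[OF assms(1,2)] assms(5)
    by (intro exI[of _ "cost b M + bits (val b M) + t"] exI[of _ M']) auto
qed

abbreviation reg :: "nat \<Rightarrow> expr" where
  "reg a \<equiv> Read a (Const 0)"

abbreviation setr :: "nat \<Rightarrow> expr \<Rightarrow> com" where
  "setr a e \<equiv> Write a (Const 0) e"

lemma run_setr:
  assumes "1 \<le> L" "fits L e M" "Q (M(a := (M a)(0 := val e M)))"
    and "L * wcost (Const 0) e \<le> T"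
  shows "run (setr a e) M T Q"
  using assms by (intro run_Write) auto

text \<open>The monus guard is nonzero exactly while the counter is below \<open>b\<close>, which is
  evaluated anew in every round.\<close>

definition For :: "nat \<Rightarrow> expr \<Rightarrow> com \<Rightarrow> com" where
  "For i b c = Seq (setr i (Const 0))
     (Loop (Bin Monus b (reg i)) (Seq c (setr i (Bin Plus (reg i) (Const 1)))))"

definition fcost :: "nat \<Rightarrow> expr \<Rightarrow> nat" where
  "fcost i b = wcost (Const 0) (Const 0) + gcost (Bin Monus b (reg i)) +
     wcost (Const 0) (Bin Plus (reg i) (Const 1))"

text \<open>\<open>I k\<close> describes the memory once the counter has been set to
  \<open>k\<close>; hence a step is judged after the increment. The factor \<open>N + 1\<close> pays
  for the initialisation and for the last, failing test of the guard.\<close>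

lemma run_For:
  assumes L: "1 \<le> L" and N: "N < 2 ^ L"
    and init: "I 0 (M(i := (M i)(0 := 0)))"
    and bound: "\<And>k M. I k M \<Longrightarrow> k \<le> N \<Longrightarrow> M i 0 = k \<Longrightarrow> val b M = N \<and> fits L b M"
    and step: "\<And>k M. I k M \<Longrightarrow> k < N \<Longrightarrow> M i 0 = k \<Longrightarrow>
      run c M T1 (\<lambda>M'. M' i 0 = k \<and> I (Suc k) (M'(i := (M' i)(0 := Suc k))))"
    and final: "\<And>M. I N M \<Longrightarrow> M i 0 = N \<Longrightarrow> Q M"
    and T: "(N + 1) * (T1 + L * fcost i b) \<le> T"
  shows "run (For i b c) M T Q"
proof -
  let ?g = "Bin Monus b (reg i)"
  let ?inc = "Bin Plus (reg i) (Const 1)"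
  let ?body = "Seq c (setr i ?inc)"
  let ?G = "L * gcost ?g"
  let ?W = "L * wcost (Const 0) ?inc"
  have one: "Suc 0 < 2 ^ L" using L one_less_power[of "2::nat" L] by simp
  have loop: "run (Loop ?g ?body) M ((N - k) * (T1 + ?G + ?W) + ?G) Q"
    if "I k M" "k \<le> N" "M i 0 = k" for k M
    using that
  proof (induction "N - k" arbitrary: k M)
    case 0
    then have "k = N" by simp
    have f: "val b M = N" "fits L b M" using bound 0 by auto
    have "fits L ?g M" using f N 0 by simp
    from guard_cost[OF L this] have "cost ?g M + bits (val ?g M) \<le> ?G" .
    moreover have "val ?g M = 0" using f \<open>k = N\<close> 0 by simp
    ultimately show ?case unfolding run_def
      using exec.LoopF[of ?g M ?body] final 0 \<open>k = N\<close>
      by (intro exI[of _ "cost ?g M + bits (val ?g M)"] exI[of _ M]) auto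
  next
    case (Suc d)
    then have "k < N" by simp
    have f: "val b M = N" "fits L b M" using bound Suc by auto
    have "fits L ?g M" using f N Suc by simp
    from guard_cost[OF L this] have c: "cost ?g M + bits (val ?g M) \<le> ?G" .
    have v: "val ?g M \<noteq> 0" using f \<open>k < N\<close> Suc by simp
    have "run ?body M (T1 + ?W) (\<lambda>M'. I (Suc k) M' \<and> M' i 0 = Suc k)"
    proof (rule run_Seq[OF step[OF \<open>I k M\<close> \<open>k < N\<close> \<open>M i 0 = k\<close>]])
      fix M' assume M': "M' i 0 = k \<and> I (Suc k) (M'(i := (M' i)(0 := Suc k)))"
      show "run (setr i ?inc) M' ?W (\<lambda>M'. I (Suc k) M' \<and> M' i 0 = Suc k)"
        by (rule run_setr[OF L]) (use M' \<open>k < N\<close> N one in auto)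
    qed simp
    then obtain t1 M1 where 1: "exec ?body M t1 M1" "t1 \<le> T1 + ?W" "I (Suc k) M1" "M1 i 0 = Suc k"
      unfolding run_def by blast
    have "run (Loop ?g ?body) M1 ((N - Suc k) * (T1 + ?G + ?W) + ?G) Q"
      using Suc.hyps(1)[of "Suc k" M1] Suc.hyps(2) 1 \<open>k < N\<close> by simp
    then obtain t2 M2 where 2: "exec (Loop ?g ?body) M1 t2 M2"
      "t2 \<le> (N - Suc k) * (T1 + ?G + ?W) + ?G" "Q M2"
      unfolding run_def by blast
    have "N - k = Suc (N - Suc k)" using \<open>k < N\<close> by simp
    then have "cost ?g M + bits (val ?g M) + t1 + t2 \<le> (N - k) * (T1 + ?G + ?W) + ?G"
      using c 1 2 by simp
    then show ?case unfolding run_def using exec.LoopT[OF v 1(1) 2(1)] 2 by blast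
  qed
  let ?I = "L * wcost (Const 0) (Const 0)"
  have "run (For i b c) M (?I + (N * (T1 + ?G + ?W) + ?G)) Q"
    unfolding For_def
  proof (rule run_Seq[where ?Q1.0 = "\<lambda>M'. M' = M(i := (M i)(0 := 0))"])
    show "run (setr i (Const 0)) M ?I (\<lambda>M'. M' = M(i := (M i)(0 := 0)))"
      by (rule run_setr[OF L]) auto
  next
    fix M' assume "M' = M(i := (M i)(0 := 0))"
    then show "run (Loop ?g ?body) M' (N * (T1 + ?G + ?W) + ?G) Q"
      using loop[of 0 M'] init by simp
  qed simp
  moreover have "?I + (N * (T1 + ?G + ?W) + ?G) \<le> T"
    by (rule order_trans[OF _ T]) (simp add: fcost_def algebra_simps)
  ultimately show ?thesis by (rule run_mono) auto
qed

section \<open>Running a program on other arrays\<close>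

primrec shift_expr :: "nat \<Rightarrow> expr \<Rightarrow> expr" where
  "shift_expr s (Const k) = Const k"
| "shift_expr s (Read a e) = Read (s + a) (shift_expr s e)"
| "shift_expr s (Bin f e1 e2) = Bin f (shift_expr s e1) (shift_expr s e2)"

primrec shift_com :: "nat \<Rightarrow> com \<Rightarrow> com" where
  "shift_com s Skip = Skip"
| "shift_com s (Write a i e) = Write (s + a) (shift_expr s i) (shift_expr s e)"
| "shift_com s (Seq c1 c2) = Seq (shift_com s c1) (shift_com s c2)"
| "shift_com s (Cond b c1 c2) = Cond (shift_expr s b) (shift_com s c1) (shift_com s c2)"
| "shift_com s (Loop b c) = Loop (shift_expr s b) (shift_com s c)"

definition join_mem :: "nat \<Rightarrow> mem \<Rightarrow> mem \<Rightarrow> mem" where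
  "join_mem s R M a = (if a < s then R a else M (a - s))"

lemma val_shift: "val (shift_expr s e) (join_mem s R M) = val e M"
  and cost_shift: "cost (shift_expr s e) (join_mem s R M) = cost e M"
proof -
  have "val (shift_expr s e) (join_mem s R M) = val e M \<and>
    cost (shift_expr s e) (join_mem s R M) = cost e M"
    by (induction e) (auto simp: join_mem_def)
  then show "val (shift_expr s e) (join_mem s R M) = val e M"
    "cost (shift_expr s e) (join_mem s R M) = cost e M" by auto
qed

lemma join_mem_upd: "(join_mem s R M)(s + a := f) = join_mem s R (M(a := f))"
  by (auto simp: join_mem_def fun_eq_iff)

text \<open>The cost model charges for cell indices but not for the number of an array, so the
  renamed program takes exactly the same time and leaves the lower arrays alone. This embeds the
  given max-flow program as a subroutine.\<close>

lemma exec_shift: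
  "exec c M t M' \<Longrightarrow> exec (shift_com s c) (join_mem s R M) t (join_mem s R M')"
proof (induction rule: exec.induct)
  case (Skip M)
  show ?case by (simp only: shift_com.simps exec.Skip)
next
  case (Write a i e M)
  have "join_mem s R M (s + a) = M a" by (simp add: join_mem_def)
  with exec.Write[of "s + a" "shift_expr s i" "shift_expr s e" "join_mem s R M"]
  show ?case by (simp only: val_shift cost_shift join_mem_upd shift_com.simps)
next
  case (Seq c1 M t1 M1 c2 t2 M2)
  then show ?case by (auto intro: exec.Seq)
next
  case (CondT b M c1 t M' c2)
  then show ?case using exec.CondT[of "shift_expr s b" "join_mem s R M"]
    by (simp add: val_shift cost_shift)
next
  case (CondF b M c2 t M' c1)
  then show ?case using exec.CondF[of "shift_expr s b" "join_mem s R M"]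
    by (simp add: val_shift cost_shift)
next
  case (LoopF b M c)
  then show ?case using exec.LoopF[of "shift_expr s b" "join_mem s R M"]
    by (simp add: val_shift cost_shift)
next
  case (LoopT b M c t1 M1 t2 M2)
  then show ?case using exec.LoopT[of "shift_expr s b" "join_mem s R M"]
    by (simp add: val_shift cost_shift)
qed

section \<open>Weak duality: cuts bound flows\<close>

section \<open>Flows, cuts and paths\<close>

text \<open>Every vertex of \<open>S\<close> other than \<open>s\<close> conserves flow, so the
  value is the net flow out of \<open>S\<close>; edges entering \<open>S\<close> only diminish
  it.\<close>

lemma flow_value_le_cut:
  assumes G: "pair_fin_digraph G" and f: "is_flow (with_proj G) w s t f"
    and s: "s \<in> S" "s \<in> pverts G" and t: "t \<notin> S"
  shows "flow_value (with_proj G) s f \<le>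
    (\<Sum>e\<in>{e \<in> parcs G. fst e \<in> S \<and> snd e \<notin> S}. real (w e))"
proof -
  interpret pair_fin_digraph G by (rule G)
  let ?S = "S \<inter> pverts G"
  have fin: "finite (pverts G)" "finite (parcs G)"
    using pair_finite_verts pair_finite_arcs by auto
  have out: "(\<Sum>x\<in>?S. \<Sum>e\<in>{e \<in> parcs G. fst e = x}. f e) = (\<Sum>e\<in>{e \<in> parcs G. fst e \<in> S}. f e)"
  proof -
    have "(\<Sum>x\<in>?S. \<Sum>e\<in>{e \<in> parcs G. fst e = x}. f e) =
        (\<Sum>x\<in>?S. \<Sum>e\<in>{e \<in> {e \<in> parcs G. fst e \<in> S}. fst e = x}. f e)"
      by (intro sum.cong) auto
    also have "\<dots> = (\<Sum>e\<in>{e \<in> parcs G. fst e \<in> S}. f e)"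
      using fin by (intro sum.group) (auto simp: wellformed')
    finally show ?thesis .
  qed
  have in': "(\<Sum>x\<in>?S. \<Sum>e\<in>{e \<in> parcs G. snd e = x}. f e) = (\<Sum>e\<in>{e \<in> parcs G. snd e \<in> S}. f e)"
  proof -
    have "(\<Sum>x\<in>?S. \<Sum>e\<in>{e \<in> parcs G. snd e = x}. f e) =
        (\<Sum>x\<in>?S. \<Sum>e\<in>{e \<in> {e \<in> parcs G. snd e \<in> S}. snd e = x}. f e)"
      by (intro sum.cong) auto
    also have "\<dots> = (\<Sum>e\<in>{e \<in> parcs G. snd e \<in> S}. f e)"
      using fin by (intro sum.group) (auto simp: wellformed')
    finally show ?thesis .
  qed
  have arcs: "in_arcs (with_proj G) x = {e \<in> parcs G. snd e = x}"
    "out_arcs (with_proj G) x = {e \<in> parcs G. fst e = x}" for x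
    by (auto simp: in_arcs_def out_arcs_def)
  have fl: "0 \<le> f e" "f e \<le> real (w e)" if "e \<in> parcs G" for e
    using f that unfolding is_flow_def by auto
  have cons: "(\<Sum>e\<in>{e \<in> parcs G. snd e = x}. f e) = (\<Sum>e\<in>{e \<in> parcs G. fst e = x}. f e)"
    if "x \<in> pverts G - {s, t}" for x
    using f that unfolding is_flow_def arcs by auto
  let ?net = "\<lambda>x. (\<Sum>e\<in>{e \<in> parcs G. fst e = x}. f e) - (\<Sum>e\<in>{e \<in> parcs G. snd e = x}. f e)"
  have "flow_value (with_proj G) s f = ?net s"
    unfolding flow_value_def arcs ..
  also have "\<dots> = (\<Sum>x\<in>{s}. ?net x)" by simp
  also have "\<dots> = (\<Sum>x\<in>?S. ?net x)"
    proof (rule sum.mono_neutral_left)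
    show "\<forall>x\<in>?S - {s}. ?net x = 0"
    proof
      fix x assume "x \<in> ?S - {s}"
      then have "x \<in> pverts G - {s, t}" using t by auto
      from cons[OF this] show "?net x = 0" by simp
    qed
  qed (use fin s in auto)
  also have "\<dots> = (\<Sum>e\<in>{e \<in> parcs G. fst e \<in> S}. f e) - (\<Sum>e\<in>{e \<in> parcs G. snd e \<in> S}. f e)"
    by (simp add: sum_subtractf out in')
  also have "(\<Sum>e\<in>{e \<in> parcs G. fst e \<in> S}. f e) =
      (\<Sum>e\<in>{e \<in> parcs G. fst e \<in> S \<and> snd e \<notin> S}. f e) +
      (\<Sum>e\<in>{e \<in> parcs G. fst e \<in> S \<and> snd e \<in> S}. f e)"
    using fin by (subst sum.union_disjoint[symmetric]) (auto intro!: sum.cong)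
  also have "(\<Sum>e\<in>{e \<in> parcs G. snd e \<in> S}. f e) =
      (\<Sum>e\<in>{e \<in> parcs G. fst e \<in> S \<and> snd e \<in> S}. f e) +
      (\<Sum>e\<in>{e \<in> parcs G. fst e \<notin> S \<and> snd e \<in> S}. f e)"
    using fin by (subst sum.union_disjoint[symmetric]) (auto intro!: sum.cong)
  finally have "flow_value (with_proj G) s f \<le> (\<Sum>e\<in>{e \<in> parcs G. fst e \<in> S \<and> snd e \<notin> S}. f e)"
    using fl sum_nonneg[of "{e \<in> parcs G. fst e \<notin> S \<and> snd e \<in> S}" f] by auto
  also have "\<dots> \<le> (\<Sum>e\<in>{e \<in> parcs G. fst e \<in> S \<and> snd e \<notin> S}. real (w e))"
    using fl by (intro sum_mono) auto
  finally show ?thesis .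
qed

section \<open>Integral flows from systems of paths\<close>

abbreviation path_edges :: "'a list \<Rightarrow> ('a \<times> 'a) list" where
  "path_edges p \<equiv> zip p (tl p)"

lemma sum_count_list_map:
  assumes "finite A" "set xs \<subseteq> A"
  shows "(\<Sum>e\<in>{e \<in> A. g e = x}. count_list xs e) = count_list (map g xs) x"
  using assms(2)
proof (induction xs)
  case (Cons a xs)
  have "(\<Sum>e\<in>{e \<in> A. g e = x}. count_list (a # xs) e) =
      (\<Sum>e\<in>{e \<in> A. g e = x}. (if a = e then 1 else 0) + count_list xs e)"
    by (intro sum.cong) auto
  also have "\<dots> = (if a \<in> {e \<in> A. g e = x} then 1 else 0) + count_list (map g xs) x"
    using Cons assms(1) by (simp add: sum.distrib)
  finally show ?case using Cons by simp
qed simp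

lemma map_fst_path_edges: "map fst (path_edges p) = butlast p"
  by (induction p rule: induct_list012) auto

lemma map_snd_path_edges: "map snd (path_edges p) = tl p"
  by (simp add: map_snd_zip_take)

text \<open>Both sides count the occurrences of \<open>x\<close> in \<open>p\<close>, once by
  splitting off the last vertex and once by splitting off the first.\<close>

lemma path_net:
  assumes "finite A" "set (path_edges p) \<subseteq> A" "p \<noteq> []"
  shows "(\<Sum>e\<in>{e \<in> A. fst e = x}. count_list (path_edges p) e) + of_bool (x = last p) =
    (\<Sum>e\<in>{e \<in> A. snd e = x}. count_list (path_edges p) e) + of_bool (x = hd p)"
proof -
  have "count_list (butlast p) x + of_bool (x = last p) = count_list (butlast p @ [last p]) x"
    by simp
  also have "butlast p @ [last p] = hd p # tl p" using assms(3) by simp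
  also have "count_list (hd p # tl p) x = count_list (tl p) x + of_bool (x = hd p)" by simp
  finally show ?thesis
    unfolding sum_count_list_map[OF assms(1,2)] map_fst_path_edges map_snd_path_edges .
qed

text \<open>Superposition of unit flows along the paths. Distinct indices may carry the same path,
  which is how parallel units are expressed.\<close>

lemma paths_flow:
  assumes G: "pair_fin_digraph G" and I: "finite I" and "s \<noteq> t"
    and p: "\<And>k. k \<in> I \<Longrightarrow> p k \<noteq> [] \<and> hd (p k) = s \<and> last (p k) = t \<and> set (path_edges (p k)) \<subseteq> parcs G"
    and cap: "\<And>e. e \<in> parcs G \<Longrightarrow> (\<Sum>k\<in>I. count_list (path_edges (p k)) e) \<le> w e"
  shows "\<exists>f. is_flow (with_proj G) w s t f \<and> flow_value (with_proj G) s f = card I"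
proof -
  interpret pair_fin_digraph G by (rule G)
  let ?f = "\<lambda>e. \<Sum>k\<in>I. count_list (path_edges (p k)) e"
  let ?out = "\<lambda>x. \<Sum>e\<in>{e \<in> parcs G. fst e = x}. ?f e"
  let ?in = "\<lambda>x. \<Sum>e\<in>{e \<in> parcs G. snd e = x}. ?f e"
  have arcs: "in_arcs (with_proj G) x = {e \<in> parcs G. snd e = x}"
    "out_arcs (with_proj G) x = {e \<in> parcs G. fst e = x}" for x
    by (auto simp: in_arcs_def out_arcs_def)
  have net: "?out x + card I * of_bool (x = t) = ?in x + card I * of_bool (x = s)" for x
  proof -
    have swap: "(\<Sum>e\<in>E. ?f e) = (\<Sum>k\<in>I. \<Sum>e\<in>E. count_list (path_edges (p k)) e)" for E
      by (rule sum.swap)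
    have "?out x + card I * of_bool (x = t) =
      (\<Sum>k\<in>I. (\<Sum>e\<in>{e \<in> parcs G. fst e = x}. count_list (path_edges (p k)) e) + of_bool (x = t))"
      unfolding swap by (simp add: sum.distrib)
    also have "\<dots> = (\<Sum>k\<in>I. (\<Sum>e\<in>{e \<in> parcs G. snd e = x}. count_list (path_edges (p k)) e)
        + of_bool (x = s))"
    proof (rule sum.cong)
      fix k assume k: "k \<in> I"
      have "set (path_edges (p k)) \<subseteq> parcs G" "p k \<noteq> []" using p[OF k] by blast+
      from path_net[OF pair_finite_arcs this, of x]
      show "(\<Sum>e\<in>{e \<in> parcs G. fst e = x}. count_list (path_edges (p k)) e) + of_bool (x = t) =
        (\<Sum>e\<in>{e \<in> parcs G. snd e = x}. count_list (path_edges (p k)) e) + of_bool (x = s)"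
        using p[OF k] by (simp only:)
    qed simp
    also have "\<dots> = ?in x + card I * of_bool (x = s)"
      unfolding swap by (simp add: sum.distrib)
    finally show ?thesis .
  qed
  have "is_flow (with_proj G) w s t (\<lambda>e. real (?f e))"
    unfolding is_flow_def arcs
  proof (intro conjI ballI)
    fix e assume "e \<in> arcs (with_proj G)"
    then show "real (?f e) \<le> real (w e)" using cap by (simp del: of_nat_sum)
  next
    fix x assume "x \<in> verts (with_proj G) - {s, t}"
    then have "?in x = ?out x" using net[of x] by simp
    then have "real (?in x) = real (?out x)" by (simp only:)
    then show "(\<Sum>e\<in>{e \<in> parcs G. snd e = x}. real (?f e)) = (\<Sum>e\<in>{e \<in> parcs G. fst e = x}. real (?f e))"
      by (simp only: of_nat_sum)
  qed (simp add: sum_nonneg)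
  moreover have "flow_value (with_proj G) s (\<lambda>e. real (?f e)) = card I"
  proof -
    have "?out s = ?in s + card I" using net[of s] assms(3) by simp
    then have "real (?out s) = real (?in s) + card I" by (simp only: of_nat_add)
    then show ?thesis unfolding flow_value_def arcs by (simp only: of_nat_sum)
  qed
  ultimately show ?thesis by blast
qed

text \<open>A flow and a cut of equal value certify each other, so weak duality suffices; the cut
  also shows that the supremum is taken over a bounded set.\<close>

lemma max_flow_eqI:
  assumes G: "pair_fin_digraph G"
    and f: "is_flow (with_proj G) w s t f" "flow_value (with_proj G) s f = v"
    and S: "s \<in> S" "s \<in> pverts G" "t \<notin> S"
      "(\<Sum>e\<in>{e \<in> parcs G. fst e \<in> S \<and> snd e \<notin> S}. real (w e)) \<le> v"
  shows "max_flow (with_proj G) w s t = v"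
  unfolding max_flow_def
proof (rule cSup_eq_maximum)
  show "v \<in> flow_value (with_proj G) s ` {f. is_flow (with_proj G) w s t f}"
    using f by blast
  fix x assume "x \<in> flow_value (with_proj G) s ` {f. is_flow (with_proj G) w s t f}"
  then show "x \<le> v" using flow_value_le_cut[OF G _ S(1-3)] S(4) by force
qed

section \<open>The clause network and its maximum flows\<close>

section \<open>The network\<close>

text \<open>Residues modulo 8 keep eight families of nodes apart for any index range, and both the
  edge capacities and the program can compute with the kind of a node arithmetically.\<close>

definition nd :: "nat \<Rightarrow> nat \<Rightarrow> nat" where
  "nd k i = 8 * i + k"

lemma nd_eq_iff [simp]: "k < 8 \<Longrightarrow> l < 8 \<Longrightarrow> nd k i = nd l j \<longleftrightarrow> k = l \<and> i = j"
  unfolding nd_def by presburger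

lemma nd_mod [simp]: "k < 8 \<Longrightarrow> nd k i mod 8 = k"
  unfolding nd_def by simp

text \<open>
  The nodes \<open>C\<^sub>c, D\<^sub>c, Z\<^sub>c, Y\<^sub>c\<close> (\<open>c < m\<close>), \<open>A\<^sub>i\<close> (\<open>i < p\<close>) and \<open>B\<^sub>b, B'\<^sub>b, G\<^sub>g\<close> (\<open>b, g < q\<close>)
  are \<open>nd 0 c, nd 1 c, nd 2 c, nd 3 c, nd 4 i, nd 5 b, nd 6 b, nd 7 g\<close>. Here \<open>sa i c\<close>, \<open>sb b c\<close>
  and \<open>sg g c\<close> say that a partial assignment satisfies clause \<open>c\<close>. Nothing enters \<open>Z\<^sub>c\<close> and
  nothing leaves \<open>Y\<^sub>c\<close>: they only keep the number of edges independent of the formula.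
\<close>

locale network =
  fixes m p q T :: nat and sa sb sg :: "nat \<Rightarrow> nat \<Rightarrow> bool"
begin

definition edge_A where "edge_A i c = (nd 4 i, nd (if sa i c then 1 else 0) c)"
definition edge_G where "edge_G g c = (nd (if sg g c then 2 else 1) c, nd 7 g)"
definition edge_in where "edge_in b c = (nd (if sb b c then 2 else 0) c, nd 5 b)"
definition edge_out where "edge_out b c = (nd 6 b, nd (if sb b c then 3 else 1) c)"
definition edge_B where "edge_B b = (nd 5 b, nd 6 b)"

lemmas edge_defs = edge_A_def edge_G_def edge_in_def edge_out_def edge_B_def

text \<open>A flat enumeration of the pairs, with \<open>l\<close> standing for
  \<open>(l div m, l mod m)\<close>: the program writes each block of edges by a single loop in this
  order.\<close>

definition pairs :: "nat \<Rightarrow> (nat \<Rightarrow> nat \<Rightarrow> nat \<times> nat) \<Rightarrow> (nat \<times> nat) list" where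
  "pairs k f = map (\<lambda>l. f (l div m) (l mod m)) [0..<k * m]"

definition edges :: "(nat \<times> nat) list" where
  "edges = pairs p edge_A @ pairs q edge_G @ pairs q edge_in @ pairs q edge_out @ map edge_B [0..<q]"

text \<open>Depends on the residues of the endpoints only: \<open>T\<close> inside a middle node, 1
  at its entrances and exits, and \<open>q\<close>, the number of middle nodes, elsewhere.\<close>

definition cap :: "nat \<times> nat \<Rightarrow> nat" where
  "cap e = (if fst e mod 8 = 5 then T else if fst e mod 8 = 6 \<or> snd e mod 8 = 5 then 1 else q)"

lemma cap_simps [simp]:
  "cap (edge_A i c) = q" "cap (edge_G g c) = q" "cap (edge_in b c) = 1" "cap (edge_out b c) = 1"
  "cap (edge_B b) = T"
  by (auto simp: cap_def edge_defs)

lemma edge_inj: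
  "edge_A i c = edge_A i' c' \<longleftrightarrow> i = i' \<and> c = c'" "edge_G i c = edge_G i' c' \<longleftrightarrow> i = i' \<and> c = c'"
  "edge_in i c = edge_in i' c' \<longleftrightarrow> i = i' \<and> c = c'" "edge_out i c = edge_out i' c' \<longleftrightarrow> i = i' \<and> c = c'"
  "edge_B i = edge_B i' \<longleftrightarrow> i = i'"
  by (auto simp: edge_defs split: if_splits)

lemma edge_neq:
  "edge_A i c \<noteq> edge_G i' c'" "edge_A i c \<noteq> edge_in i' c'" "edge_A i c \<noteq> edge_out i' c'"
  "edge_A i c \<noteq> edge_B i'" "edge_G i c \<noteq> edge_in i' c'" "edge_G i c \<noteq> edge_out i' c'"
  "edge_G i c \<noteq> edge_B i'" "edge_in i c \<noteq> edge_out i' c'" "edge_in i c \<noteq> edge_B i'"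
  "edge_out i c \<noteq> edge_B i'"
  by (auto simp: edge_defs split: if_splits)

lemmas edge_simps = edge_inj edge_neq edge_neq[symmetric]

lemma length_edges: "length edges = (p + 3 * q) * m + q"
  by (simp add: edges_def pairs_def algebra_simps)

lemma set_pairs: "set (pairs k f) = (\<lambda>(i, c). f i c) ` ({..<k} \<times> {..<m})"
proof (intro equalityI subsetI)
  fix e assume "e \<in> set (pairs k f)"
  then obtain l where l: "l < k * m" "e = f (l div m) (l mod m)" by (auto simp: pairs_def)
  then have "0 < m" by (cases "m = 0") auto
  then have "l div m < k" "l mod m < m" using l by (auto simp: less_mult_imp_div_less)
  then show "e \<in> (\<lambda>(i, c). f i c) ` ({..<k} \<times> {..<m})" using l by auto
next
  fix e assume "e \<in> (\<lambda>(i, c). f i c) ` ({..<k} \<times> {..<m})"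
  then obtain i c where ic: "i < k" "c < m" "e = f i c" by auto
  then have "i * m + c < k * m"
    by (metis add.commute add_less_cancel_left less_le_trans mult_Suc mult_le_mono1 Suc_leI)
  moreover have "(i * m + c) div m = i" "(i * m + c) mod m = c" using ic by auto
  ultimately show "e \<in> set (pairs k f)" using ic unfolding pairs_def
    by (force intro!: image_eqI[of _ _ "i * m + c"])
qed

lemma distinct_pairs:
  assumes "\<And>i c i' c'. f i c = f i' c' \<Longrightarrow> i = i' \<and> c = c'"
  shows "distinct (pairs k f)"
  unfolding pairs_def distinct_map
proof (intro conjI inj_onI)
  fix x y assume "f (x div m) (x mod m) = f (y div m) (y mod m)"
  then have "x div m = y div m \<and> x mod m = y mod m" using assms by blast
  then show "x = y" by (metis div_mult_mod_eq)
qed simp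

lemma set_edges: "set edges =
    (\<lambda>(i, c). edge_A i c) ` ({..<p} \<times> {..<m}) \<union> (\<lambda>(g, c). edge_G g c) ` ({..<q} \<times> {..<m}) \<union>
    (\<lambda>(b, c). edge_in b c) ` ({..<q} \<times> {..<m}) \<union> (\<lambda>(b, c). edge_out b c) ` ({..<q} \<times> {..<m}) \<union>
    edge_B ` {..<q}"
  by (auto simp: edges_def set_pairs)

lemma distinct_edges: "distinct edges"
proof -
  have "distinct (pairs p edge_A)" "distinct (pairs q edge_G)" "distinct (pairs q edge_in)"
    "distinct (pairs q edge_out)"
    by (rule distinct_pairs; simp add: edge_inj)+
  moreover have "distinct (map edge_B [0..<q])"
    by (auto simp: distinct_map inj_on_def edge_inj)
  ultimately show ?thesis unfolding edges_def distinct_append set_append set_pairs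
    by (auto simp: edge_simps)
qed

definition net :: "nat \<Rightarrow> nat pair_pre_digraph" where
  "net n = \<lparr>pverts = {..<n}, parcs = set edges\<rparr>"

lemma nd_less: "i < j \<Longrightarrow> k < 8 \<Longrightarrow> 8 * j \<le> n \<Longrightarrow> nd k i < n"
  unfolding nd_def by linarith

lemma pair_digraph_net:
  assumes "8 * m \<le> n" "8 * p \<le> n" "8 * q \<le> n"
  shows "pair_digraph (net n)"
proof
  fix e assume "e \<in> parcs (net n)"
  then show "fst e \<in> pverts (net n)" "snd e \<in> pverts (net n)" "fst e \<noteq> snd e"
    using assms by (auto simp: net_def set_edges edge_defs nd_less split: if_splits)
qed (auto simp: net_def)

definition unsat :: "nat \<Rightarrow> nat \<Rightarrow> nat \<Rightarrow> nat set" where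
  "unsat i b g = {c. c < m \<and> \<not> sa i c \<and> \<not> sb b c \<and> \<not> sg g c}"

definition direct :: "nat \<Rightarrow> nat \<Rightarrow> nat set" where
  "direct i g = {c. c < m \<and> sa i c \<and> \<not> sg g c}"

text \<open>Source side of a minimum cut. \<open>D\<^sub>c\<close> is inside if \<alpha> satisfies
  \<open>c\<close>, where its edge to the sink, if any, is cut at the price \<open>q\<close>, or if
  \<gamma> satisfies \<open>c\<close>, where there is no such edge. \<open>B'\<^sub>b\<close> is
  inside iff cutting its exits to the clauses that all three fail costs at most the \<open>T\<close>
  of its entrance. The dead ends (\<open>Y\<^sub>c\<close> and the other sinks) are inside and the
  \<open>Z\<^sub>c\<close>, which nothing enters, are outside, so that they cost nothing.\<close>

definition side :: "nat \<Rightarrow> nat \<Rightarrow> nat set" where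
  "side i g = {nd 4 i} \<union> {nd 7 h |h. h \<noteq> g} \<union> range (nd 0) \<union> {nd 1 c |c. sa i c \<or> sg g c} \<union>
     range (nd 3) \<union> range (nd 5) \<union> {nd 6 b |b. card (unsat i b g) \<le> T}"

lemma cut_capacity:
  assumes "i < p" "g < q"
  shows "(\<Sum>e\<in>{e \<in> set edges. fst e \<in> side i g \<and> snd e \<notin> side i g}. cap e) \<le>
    q * card (direct i g) + (\<Sum>b<q. min T (card (unsat i b g)))"
proof -
  let ?big = "{b. b < q \<and> T < card (unsat i b g)}"
  let ?small = "{b. b < q \<and> card (unsat i b g) \<le> T}"
  \<comment> \<open>The edges that can cross: from \<open>D\<^sub>c\<close> to the sink, the middle
    edge of \<beta> where \<open>T\<close> is the cheaper price, and the exits of \<beta>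
    otherwise.\<close>
  let ?X1 = "edge_G g ` direct i g"
  let ?X2 = "edge_B ` ?big"
  let ?X3 = "(\<lambda>(b, c). edge_out b c) ` (SIGMA b:?small. unsat i b g)"
  have fin: "finite (direct i g)" "finite (unsat i b g)" for b
    by (auto simp: direct_def unsat_def)
  have "{e \<in> set edges. fst e \<in> side i g \<and> snd e \<notin> side i g} \<subseteq> ?X1 \<union> (?X2 \<union> ?X3)"
  proof
    fix e assume "e \<in> {e \<in> set edges. fst e \<in> side i g \<and> snd e \<notin> side i g}"
    then have e: "e \<in> set edges" "fst e \<in> side i g" "snd e \<notin> side i g" by auto
    from e(1) consider i' c where "c < m" "e = edge_A i' c" | g' c where "c < m" "e = edge_G g' c"
      | b c where "c < m" "e = edge_in b c" | b c where "b < q" "c < m" "e = edge_out b c"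
      | b where "b < q" "e = edge_B b"
      unfolding set_edges by auto
    then show "e \<in> ?X1 \<union> (?X2 \<union> ?X3)"
    proof cases
      case 1
      with e show ?thesis by (auto simp: side_def edge_A_def split: if_splits)
    next
      case 2
      with e have "g' = g" "c \<in> direct i g"
        by (auto simp: side_def edge_G_def direct_def split: if_splits)
      with 2 show ?thesis by auto
    next
      case 3
      with e show ?thesis by (auto simp: side_def edge_in_def split: if_splits)
    next
      case 4
      with e have "b \<in> ?small" "c \<in> unsat i b g"
        by (auto simp: side_def edge_out_def unsat_def split: if_splits)
      with 4 show ?thesis by force
    next
      case 5
      with e have "b \<in> ?big" by (auto simp: side_def edge_B_def)
      with 5 show ?thesis by auto
    qed
  qed
  then have "(\<Sum>e\<in>{e \<in> set edges. fst e \<in> side i g \<and> snd e \<notin> side i g}. cap e) \<le> sum cap (?X1 \<union> (?X2 \<union> ?X3))"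
    using fin by (intro sum_mono2) auto
  also have "\<dots> \<le> sum cap ?X1 + (sum cap ?X2 + sum cap ?X3)"
  proof -
    have le: "sum cap (E \<union> E') \<le> sum cap E + sum cap E'" if "finite E" "finite E'" for E E'
      using that by (simp add: sum_Un_nat)
    show ?thesis using fin by (intro order_trans[OF le] add_left_mono le) auto
  qed
  also have "sum cap ?X1 = q * card (direct i g)"
    by (subst sum.reindex) (auto simp: inj_on_def edge_inj o_def)
  also have "sum cap ?X2 = (\<Sum>b\<in>?big. min T (card (unsat i b g)))"
    by (subst sum.reindex) (auto simp: inj_on_def edge_inj o_def)
  also have "sum cap ?X3 = (\<Sum>x\<in>(SIGMA b:?small. unsat i b g). 1)"
    by (subst sum.reindex) (auto simp: inj_on_def edge_inj o_def case_prod_unfold)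
  also have "\<dots> = (\<Sum>b\<in>?small. min T (card (unsat i b g)))"
    using fin by (auto intro!: sum.cong)
  also have "(\<Sum>b\<in>?big. min T (card (unsat i b g))) + (\<Sum>b\<in>?small. min T (card (unsat i b g))) =
      (\<Sum>b<q. min T (card (unsat i b g)))"
    by (subst sum.union_disjoint[symmetric]) (auto intro!: sum.cong)
  finally show ?thesis by simp
qed

text \<open>The lower bound uses only paths that enter and leave \<beta> by the same clause; the cut
  \<open>side\<close> shows that changing the clause inside \<beta> gains nothing.\<close>

lemma max_flow_net:
  assumes "i < p" "g < q" "8 * m \<le> n" "8 * p \<le> n" "8 * q \<le> n"
  shows "max_flow (with_proj (net n)) cap (nd 4 i) (nd 7 g) =
    real (q * card (direct i g) + (\<Sum>b<q. min T (card (unsat i b g))))"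
proof -
  interpret pair_digraph "net n" by (rule pair_digraph_net[OF assms(3-5)])
  have fin: "finite (direct i g)" "finite (unsat i b g)" for b
    by (auto simp: direct_def unsat_def)
  \<comment> \<open>\<open>R b\<close> will be the set of clauses whose unit is actually sent
    through \<open>b\<close>: as many as the middle edge of capacity \<open>T\<close>
    admits.\<close>
  have "\<exists>R. R \<subseteq> unsat i b g \<and> card R = min T (card (unsat i b g))" for b
    by (metis obtain_subset_with_card_n min.cobounded2)
  then obtain R where R: "\<And>b. R b \<subseteq> unsat i b g" "\<And>b. card (R b) = min T (card (unsat i b g))"
    by metis
  have finR: "finite (R b)" for b using R fin finite_subset by metis
  \<comment> \<open>For a direct clause, \<open>b\<close> is a mere copy number that yields
    \<open>q\<close> parallel paths; for the others it is the middle node on the path.\<close>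
  define I where "I = direct i g \<times> {..<q} \<union> (\<lambda>(b, c). (c, b)) ` (SIGMA b:{..<q}. R b)"
  define path where "path = (\<lambda>(c, b). if sa i c then [nd 4 i, nd 1 c, nd 7 g]
    else [nd 4 i, nd 0 c, nd 5 b, nd 6 b, nd 1 c, nd 7 g])"
  have I: "c < m \<and> b < q \<and> \<not> sg g c \<and> (\<not> sa i c \<longrightarrow> \<not> sb b c \<and> c \<in> R b)" if "(c, b) \<in> I" for c b
    using that R(1)[of b] unfolding I_def direct_def unsat_def by auto
  have path_edges_eq: "path_edges (path (c, b)) = (if sa i c then [edge_A i c, edge_G g c]
      else [edge_A i c, edge_in b c, edge_B b, edge_out b c, edge_G g c])" if "(c, b) \<in> I" for c b
    using I[OF that] by (simp add: path_def edge_defs)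
  have finI: "finite I" unfolding I_def using fin finR by auto
  have "card I = card (direct i g) * q + (\<Sum>b<q. min T (card (unsat i b g)))"
  proof -
    have "card I = card (direct i g \<times> {..<q}) + card ((\<lambda>(b, c). (c, b)) ` (SIGMA b:{..<q}. R b))"
      unfolding I_def
    proof (rule card_Un_disjoint)
      show "direct i g \<times> {..<q} \<inter> (\<lambda>(b, c). (c, b)) ` (SIGMA b:{..<q}. R b) = {}"
        using R(1) by (force simp: direct_def unsat_def)
    qed (use fin finR in auto)
    also have "card ((\<lambda>(b, c). (c, b)) ` (SIGMA b:{..<q}. R b)) = card (SIGMA b:{..<q}. R b)"
      by (intro card_image) (auto simp: inj_on_def)
    finally show ?thesis using finR R(2) by (simp add: card_cartesian_product)
  qed
  moreover have "\<exists>f. is_flow (with_proj (net n)) cap (nd 4 i) (nd 7 g) f \<and>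
    flow_value (with_proj (net n)) (nd 4 i) f = card I"
  proof (rule paths_flow[where p = path])
    show "pair_fin_digraph (net n)" ..
    show "finite I" by (rule finI)
    fix k assume k: "k \<in> I"
    obtain c b where cb: "k = (c, b)" by force
    have I': "c < m" "b < q" "\<not> sg g c" "\<not> sa i c \<Longrightarrow> \<not> sb b c" using I k cb by auto
    have "edge_A i c \<in> set edges" "edge_G g c \<in> set edges" "edge_in b c \<in> set edges"
      "edge_out b c \<in> set edges" "edge_B b \<in> set edges"
      using I' assms unfolding set_edges by force+
    then show "path k \<noteq> [] \<and> hd (path k) = nd 4 i \<and> last (path k) = nd 7 g \<and>
      set (path_edges (path k)) \<subseteq> parcs (net n)"
      using path_edges_eq[of c b] k by (auto simp: cb path_def net_def)
  next
    fix e assume "e \<in> parcs (net n)"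
    then have e: "e \<in> set edges" by (simp add: net_def)
    \<comment> \<open>Each path uses \<open>e\<close> at most once, and \<open>X\<close> is to
      contain the indices of the paths that do.\<close>
    have le: "(\<Sum>k\<in>I. count_list (path_edges (path k)) e) \<le> card X"
      if "\<And>c b. b < q \<Longrightarrow> count_list [edge_A i c, edge_G g c] e \<le> of_bool ((c, b) \<in> X)"
        and "\<And>c b. b < q \<Longrightarrow> c \<in> R b \<Longrightarrow>
          count_list [edge_A i c, edge_in b c, edge_B b, edge_out b c, edge_G g c] e \<le> of_bool ((c, b) \<in> X)"
        and "finite X" for X
    proof -
      have "(\<Sum>k\<in>I. count_list (path_edges (path k)) e) \<le> (\<Sum>k\<in>I. of_bool (k \<in> X))"
      proof (rule sum_mono)
        fix k assume "k \<in> I"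
        moreover obtain c b where "k = (c, b)" by force
        ultimately show "count_list (path_edges (path k)) e \<le> of_bool (k \<in> X)"
          using I[of c b] that(1,2)[of b c] path_edges_eq[of c b]
          by (cases "sa i c") (simp_all del: count_list.simps)
      qed
      also have "\<dots> = card (I \<inter> X)" using finI by simp
      also have "\<dots> \<le> card X" using that(3) by (intro card_mono) auto
      finally show ?thesis .
    qed
    from e consider i' c' where "e = edge_A i' c'" | g' c' where "e = edge_G g' c'"
      | b' c' where "e = edge_in b' c'" | b' c' where "e = edge_out b' c'"
      | b' where "e = edge_B b'"
      unfolding set_edges by auto
    then show "(\<Sum>k\<in>I. count_list (path_edges (path k)) e) \<le> cap e"
    proof cases
      case 1
      have "(\<Sum>k\<in>I. count_list (path_edges (path k)) e) \<le> card ({c'} \<times> {..<q})"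
        by (intro le) (auto simp: 1 edge_simps)
      then show ?thesis by (simp add: 1)
    next
      case 2
      have "(\<Sum>k\<in>I. count_list (path_edges (path k)) e) \<le> card ({c'} \<times> {..<q})"
        by (intro le) (auto simp: 2 edge_simps)
      then show ?thesis by (simp add: 2)
    next
      case 3
      have "(\<Sum>k\<in>I. count_list (path_edges (path k)) e) \<le> card {(c', b')}"
        by (intro le) (auto simp: 3 edge_simps)
      then show ?thesis by (simp add: 3)
    next
      case 4
      have "(\<Sum>k\<in>I. count_list (path_edges (path k)) e) \<le> card {(c', b')}"
        by (intro le) (auto simp: 4 edge_simps)
      then show ?thesis by (simp add: 4)
    next
      case 5
      have "(\<Sum>k\<in>I. count_list (path_edges (path k)) e) \<le> card (R b' \<times> {b'})"
        using finR by (intro le) (auto simp: 5 edge_simps)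
      then show ?thesis using R(2) by (simp add: 5 card_cartesian_product)
    qed
  qed simp
  ultimately obtain f where f: "is_flow (with_proj (net n)) cap (nd 4 i) (nd 7 g) f"
    "flow_value (with_proj (net n)) (nd 4 i) f =
       real (q * card (direct i g) + (\<Sum>b<q. min T (card (unsat i b g))))"
    by (auto simp: mult.commute)
  show ?thesis
  proof (rule max_flow_eqI[OF _ f, where S = "side i g"])
    show "pair_fin_digraph (net n)" ..
    show "nd 4 i \<in> side i g" by (simp add: side_def)
    show "nd 4 i \<in> pverts (net n)" using assms by (simp add: net_def nd_less)
    show "nd 7 g \<notin> side i g" by (auto simp: side_def)
    show "(\<Sum>e\<in>{e \<in> parcs (net n). fst e \<in> side i g \<and> snd e \<notin> side i g}. real (cap e)) \<le>
      real (q * card (direct i g) + (\<Sum>b<q. min T (card (unsat i b g))))"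
      using cut_capacity[OF assms(1,2)] unfolding of_nat_sum[symmetric] of_nat_le_iff
      by (simp add: net_def)
  qed
qed

end

section \<open>Splitting assignments into three blocks\<close>

section \<open>Partial assignments\<close>

text \<open>
  The variables are split into three blocks of \<open>k\<close> variables. The number \<open>r * 2 ^ k + x\<close> with
  \<open>x < 2 ^ k\<close> stands for the assignment of block \<open>r\<close> given by the binary digits of \<open>x\<close>.
\<close>

definition lit_true :: "nat \<Rightarrow> nat \<Rightarrow> literal \<Rightarrow> bool" where
  "lit_true k y l \<longleftrightarrow> fst l div k = y div 2 ^ k \<and> odd (y mod 2 ^ k div 2 ^ (fst l mod k)) = snd l"

definition bsat :: "nat \<Rightarrow> cnf \<Rightarrow> nat \<Rightarrow> nat \<Rightarrow> bool" where
  "bsat k F y c \<longleftrightarrow> c < length F \<and> (\<exists>l\<in>set (F ! c). lit_true k y l)"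

definition assignment :: "nat \<Rightarrow> nat \<Rightarrow> nat \<Rightarrow> nat \<Rightarrow> nat \<Rightarrow> bool" where
  "assignment k x b g v = odd ((if v div k = 0 then x else if v div k = 1 then b else g) div 2 ^ (v mod k))"

definition num_sat :: "(nat \<Rightarrow> bool) \<Rightarrow> cnf \<Rightarrow> nat" where
  "num_sat \<sigma> F = length (filter (satisfies_clause \<sigma>) F)"

lemma num_sat_card: "num_sat \<sigma> F = card {c. c < length F \<and> satisfies_clause \<sigma> (F ! c)}"
  by (simp add: num_sat_def length_filter_conv_card)

lemma num_sat_le: "num_sat \<sigma> F \<le> length F"
  by (simp add: num_sat_def)

lemma block_div_mod:
  fixes x :: nat
  assumes "x < q"
  shows "x div q = 0" "x mod q = x" "(q + x) div q = 1" "(q + x) mod q = x"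
    "(2 * q + x) div q = 2" "(2 * q + x) mod q = x"
  using assms by (simp_all add: div_add1_eq)

lemma satisfies_clause_assignment:
  assumes F: "is_cnf n F" "n \<le> 3 * k" "c < length F"
    and x: "x < 2 ^ k" "b < 2 ^ k" "g < 2 ^ k"
  shows "satisfies_clause (assignment k x b g) (F ! c) \<longleftrightarrow>
    bsat k F x c \<or> bsat k F (2 ^ k + b) c \<or> bsat k F (2 * 2 ^ k + g) c"
proof -
  have lit: "assignment k x b g (fst l) = snd l \<longleftrightarrow>
      lit_true k x l \<or> lit_true k (2 ^ k + b) l \<or> lit_true k (2 * 2 ^ k + g) l"
    if "l \<in> set (F ! c)" for l
  proof -
    have "fst l < n" using F that unfolding is_cnf_def by (meson nth_mem)
    then have "fst l < 3 * k" using F by simp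
    then have "fst l div k < 3" by (simp add: less_mult_imp_div_less)
    then consider "fst l div k = 0" | "fst l div k = 1" | "fst l div k = 2" by linarith
    then show ?thesis
      by cases (simp_all add: assignment_def lit_true_def block_div_mod[OF x(1)]
          block_div_mod[OF x(2)] block_div_mod[OF x(3)])
  qed
  show ?thesis unfolding satisfies_clause_def bsat_def using lit F(3) by blast
qed

lemma ex_binary: "\<exists>x<(2::nat) ^ k. \<forall>i<k. odd (x div 2 ^ i) = f i"
proof (induction k arbitrary: f)
  case (Suc k)
  obtain x where x: "x < (2::nat) ^ k" "\<forall>i<k. odd (x div 2 ^ i) = f (Suc i)"
    using Suc[of "\<lambda>i. f (Suc i)"] by blast
  let ?y = "2 * x + of_bool (f 0)"
  have "odd (?y div 2 ^ i) = f i" if "i < Suc k" for i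
  proof (cases i)
    case (Suc j)
    have "?y div 2 ^ i = (?y div 2) div 2 ^ j" by (simp add: Suc div_mult2_eq)
    also have "?y div 2 = x" by simp
    finally show ?thesis using x(2) that Suc by simp
  qed simp
  moreover have "?y < 2 ^ Suc k" using x(1) by (cases "f 0") auto
  ultimately show ?case by blast
qed simp

lemma assignment_surj:
  "\<exists>x<2 ^ k. \<exists>b<2 ^ k. \<exists>g<2 ^ k. \<forall>v<3 * k. assignment k x b g v = \<sigma> v"
proof -
  obtain x where x: "x < (2::nat) ^ k" "\<forall>i<k. odd (x div 2 ^ i) = \<sigma> i"
    using ex_binary[of k \<sigma>] by blast
  obtain b where b: "b < (2::nat) ^ k" "\<forall>i<k. odd (b div 2 ^ i) = \<sigma> (k + i)"
    using ex_binary[of k "\<lambda>i. \<sigma> (k + i)"] by blast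
  obtain g where g: "g < (2::nat) ^ k" "\<forall>i<k. odd (g div 2 ^ i) = \<sigma> (2 * k + i)"
    using ex_binary[of k "\<lambda>i. \<sigma> (2 * k + i)"] by blast
  have "assignment k x b g v = \<sigma> v" if "v < 3 * k" for v
  proof -
    have "0 < k" using that by simp
    have m: "v mod k < k" using \<open>0 < k\<close> by simp
    have v: "v = v div k * k + v mod k" by simp
    have "v div k < 3" using that by (simp add: less_mult_imp_div_less)
    then consider "v div k = 0" | "v div k = 1" | "v div k = 2" by linarith
    then show ?thesis
    proof cases
      case 1
      then show ?thesis using x(2) m v by (simp add: assignment_def)
    next
      case 2
      then have "v = k + v mod k" using v by simp
      then show ?thesis using b(2) m 2 by (simp add: assignment_def)
    next
      case 3
      then have "v = 2 * k + v mod k" using v by simp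
      then show ?thesis using g(2) m 3 by (simp add: assignment_def)
    qed
  qed
  with x(1) b(1) g(1) show ?thesis by blast
qed

lemma num_sat_cong:
  assumes "is_cnf n F" "\<And>v. v < n \<Longrightarrow> \<sigma> v = \<tau> v"
  shows "num_sat \<sigma> F = num_sat \<tau> F"
proof -
  have "satisfies_clause \<sigma> c = satisfies_clause \<tau> c" if "c \<in> set F" for c
    using assms that unfolding is_cnf_def satisfies_clause_def by auto
  then show ?thesis unfolding num_sat_def by (metis (no_types, lifting) filter_cong)
qed

lemma max_sat_attained: "\<exists>\<sigma>. max_sat F = num_sat \<sigma> F"
  and num_sat_le_max_sat: "num_sat \<sigma> F \<le> max_sat F"
proof -
  have fin: "finite (range (\<lambda>\<sigma>. num_sat \<sigma> F))"
    by (rule finite_subset[of _ "{..length F}"]) (use num_sat_le in auto)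
  have eq: "max_sat F = Max (range (\<lambda>\<sigma>. num_sat \<sigma> F))" by (simp add: max_sat_def num_sat_def)
  have "max_sat F \<in> range (\<lambda>\<sigma>. num_sat \<sigma> F)" unfolding eq by (rule Max_in[OF fin]) auto
  then show "\<exists>\<sigma>. max_sat F = num_sat \<sigma> F" by blast
  show "num_sat \<sigma> F \<le> max_sat F" unfolding eq by (rule Max_ge[OF fin]) auto
qed

lemma max_sat_le: "max_sat F \<le> length F"
  using max_sat_attained[of F] num_sat_le by auto

lemma satisfiable_iff_max_sat: "satisfiable F \<longleftrightarrow> max_sat F = length F"
proof -
  have all: "num_sat \<sigma> F = length F \<longleftrightarrow> (\<forall>c\<in>set F. satisfies_clause \<sigma> c)" for \<sigma>
    unfolding num_sat_def by (metis filter_True filter_id_conv length_filter_less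
        less_irrefl)
  show ?thesis unfolding satisfiable_def all[symmetric]
    using max_sat_attained[of F] num_sat_le_max_sat[of _ F] max_sat_le[of F] by (metis le_antisym)
qed

text \<open>The form in which a search over block triples ends: the witness \<tau> bounds
  \<open>r\<close> from above, the tests bound it from below. As \<open>n \<le> 3 * k\<close>, the
  triples realise every assignment of the variables.\<close>

lemma max_sat_eqI:
  assumes "is_cnf n F" "n \<le> 3 * k"
    and "r \<le> num_sat \<tau> F"
    and "\<And>x b g. x < 2 ^ k \<Longrightarrow> b < 2 ^ k \<Longrightarrow> g < 2 ^ k \<Longrightarrow> num_sat (assignment k x b g) F \<le> r"
  shows "max_sat F = r"
proof (rule antisym)
  obtain \<sigma> where \<sigma>: "max_sat F = num_sat \<sigma> F" using max_sat_attained by blast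
  obtain x b g where "x < 2 ^ k" "b < 2 ^ k" "g < 2 ^ k" "\<forall>v<3 * k. assignment k x b g v = \<sigma> v"
    using assignment_surj by blast
  then show "max_sat F \<le> r"
    using \<sigma> num_sat_cong[OF assms(1), of \<sigma> "assignment k x b g"] assms(2,4) by force
  show "r \<le> max_sat F" using assms(3) num_sat_le_max_sat by (rule le_trans)
qed

section \<open>Threshold tests by differences of flows\<close>

section \<open>The network of a formula\<close>

text \<open>
  Besides the \<open>M\<close> clauses of the formula there are \<open>M + 16\<close> dummy clauses. Source \<open>j * 2 ^ k + x\<close>
  satisfies all but the first \<open>j\<close> of them, every other partial assignment satisfies none. This
  adds \<open>j\<close> to the number of unsatisfied clauses, so that the fixed threshold \<open>M + 1\<close> tests
  whether at least \<open>j\<close> clauses of the formula are satisfied. With 16 extra clauses there are always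
  enough edges for their number \<open>N\<close> to serve as the number of nodes.
\<close>

locale formula_network =
  fixes n k :: nat and F :: cnf
  assumes cnf: "is_cnf n F" and n_le: "n \<le> 3 * k" and k_ge: "3 \<le> k"
begin

abbreviation M where "M \<equiv> length F"
definition Q :: nat where "Q = 2 ^ k"
definition m1 :: nat where "m1 = 2 * M + 16"

definition src_sat :: "nat \<Rightarrow> nat \<Rightarrow> bool" where
  "src_sat i c \<longleftrightarrow> bsat k F (i mod Q) c \<or> M + i div Q \<le> c"

sublocale network m1 "(M + 2) * Q" Q "M + 1" src_sat "\<lambda>b. bsat k F (Q + b)" "\<lambda>g. bsat k F (2 * Q + g)" .

definition N :: nat where "N = length edges"

lemma Q_ge: "8 \<le> Q"
  using power_increasing[OF k_ge, of "2::nat"] by (simp add: Q_def)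

lemma N_eq: "N = Q * ((M + 5) * m1 + 1)"
  unfolding N_def length_edges by (simp add: algebra_simps)

text \<open>Room for all node numbers and capacities: for the clause nodes, the eight families are
  paid by the factor \<open>Q\<close>, which is at least 8; for the other nodes by the second factor
  of \<open>N_eq\<close>. The largest capacities are \<open>Q\<close> and
  \<open>M + 1\<close>.\<close>

lemma N_ge: "8 * m1 \<le> N" "8 * ((M + 2) * Q) \<le> N" "8 * Q \<le> N" "M + 1 \<le> N"
proof -
  have 1: "(M + 5) * m1 + 1 \<ge> m1" "(M + 5) * m1 + 1 \<ge> 8 * (M + 2)" "(M + 5) * m1 + 1 \<ge> 8"
    by (simp_all add: m1_def algebra_simps)
  show m: "8 * m1 \<le> N" unfolding N_eq using mult_le_mono[OF Q_ge 1(1)] by simp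
  show "8 * ((M + 2) * Q) \<le> N" unfolding N_eq using mult_le_mono2[OF 1(2), of Q] by (simp only: ac_simps)
  show "8 * Q \<le> N" unfolding N_eq using mult_le_mono2[OF 1(3), of Q] by (simp only: ac_simps)
  from m show "M + 1 \<le> N" by (simp add: m1_def)
qed

definition flow :: "nat \<Rightarrow> nat \<Rightarrow> nat" where
  "flow i g = Q * card (direct i g) + (\<Sum>b<Q. min (M + 1) (card (unsat i b g)))"

lemma max_flow_eq_flow:
  assumes "i < (M + 2) * Q" "g < Q"
  shows "max_flow (with_proj (net N)) cap (nd 4 i) (nd 7 g) = real (flow i g)"
  unfolding flow_def by (rule max_flow_net[OF assms N_ge(1-3)])

text \<open>Besides clauses of \<open>F\<close>, exactly the dummies
  \<open>M, ..., M + j - 1\<close> are failed by all three parts; for \<open>j \<le> M + 1\<close>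
  they all exist.\<close>

lemma card_unsat:
  assumes "x < Q" "b < Q" "g < Q" "j \<le> M + 1"
  shows "card (unsat (j * Q + x) b g) + num_sat (assignment k x b g) F = M + j"
proof -
  let ?s = "assignment k x b g"
  have "0 < Q" using Q_ge by simp
  then have dm: "(j * Q + x) mod Q = x" "(j * Q + x) div Q = j" using assms by auto
  have bs: "bsat k F y c \<Longrightarrow> c < M" for y c by (simp add: bsat_def)
  have sc: "satisfies_clause ?s (F ! c) \<longleftrightarrow> bsat k F x c \<or> bsat k F (Q + b) c \<or> bsat k F (2 * Q + g) c"
    if "c < M" for c
    using satisfies_clause_assignment[OF cnf n_le that, of x b g] assms by (simp add: Q_def)
  have "unsat (j * Q + x) b g = {c. c < M \<and> \<not> satisfies_clause ?s (F ! c)} \<union> {M..<M + j}"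
  proof (rule set_eqI)
    fix c
    show "c \<in> unsat (j * Q + x) b g \<longleftrightarrow> c \<in> {c. c < M \<and> \<not> satisfies_clause ?s (F ! c)} \<union> {M..<M + j}"
      using sc[of c] bs[of _ c] assms(4) unfolding unsat_def src_sat_def dm
      by (cases "c < M") (auto simp: m1_def)
  qed
  then have "card (unsat (j * Q + x) b g) = card {c. c < M \<and> \<not> satisfies_clause ?s (F ! c)} + j"
    by (simp add: card_Un_disjoint disjoint_iff)
  moreover have "card {c. c < M \<and> \<not> satisfies_clause ?s (F ! c)} + num_sat ?s F = M"
  proof -
    have "card {c. c < M \<and> \<not> satisfies_clause ?s (F ! c)} + num_sat ?s F =
        card ({c. c < M \<and> \<not> satisfies_clause ?s (F ! c)} \<union> {c. c < M \<and> satisfies_clause ?s (F ! c)})"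
      unfolding num_sat_card by (rule card_Un_disjoint[symmetric]) auto
    also have "{c. c < M \<and> \<not> satisfies_clause ?s (F ! c)} \<union> {c. c < M \<and> satisfies_clause ?s (F ! c)} = {..<M}"
      by auto
    finally show ?thesis by simp
  qed
  ultimately show ?thesis by simp
qed

text \<open>Passing from \<open>j\<close> to \<open>Suc j\<close>, the source stops satisfying the
  dummy \<open>M + j\<close>, which every sink fails. This changes the direct flow by
  \<open>Q\<close>, the summand that \<open>flow_test\<close> compensates.\<close>

lemma card_direct:
  assumes "x < Q" "j \<le> M"
  shows "card (direct (j * Q + x) g) = Suc (card (direct (Suc j * Q + x) g))"
proof -
  have "0 < Q" using Q_ge by simp
  then have dm: "(j * Q + x) mod Q = x" "(j * Q + x) div Q = j"
    "(Suc j * Q + x) mod Q = x" "(Suc j * Q + x) div Q = Suc j" using assms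
    by (auto simp del: mult_Suc)
  have bs: "bsat k F y c \<Longrightarrow> c < M" for y c by (simp add: bsat_def)
  have "direct (j * Q + x) g = insert (M + j) (direct (Suc j * Q + x) g)"
  proof (rule set_eqI)
    fix c
    show "c \<in> direct (j * Q + x) g \<longleftrightarrow> c \<in> insert (M + j) (direct (Suc j * Q + x) g)"
      using bs[of _ c] assms(2) unfolding direct_def src_sat_def dm by (auto simp: m1_def)
  qed
  moreover have "M + j \<notin> direct (Suc j * Q + x) g"
    using bs[of _ "M + j"] unfolding direct_def src_sat_def dm by auto
  moreover have "finite (direct (Suc j * Q + x) g)" by (simp add: direct_def)
  ultimately show ?thesis by simp
qed

text \<open>If \<open>s\<close> clauses of \<open>F\<close> are satisfied, the term for
  \<open>b\<close> is \<open>min (M + 1) (M - s + j)\<close>. It never decreases when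
  \<open>j\<close> grows by one, and it increases iff \<open>M - s + j < M + 1\<close>, that is, iff
  \<open>j \<le> s\<close>. So the sum increases iff some term does.\<close>

lemma flow_test:
  assumes "x < Q" "g < Q" "j \<le> M"
  shows "flow (j * Q + x) g < flow (Suc j * Q + x) g + Q \<longleftrightarrow>
    (\<exists>b<Q. j \<le> num_sat (assignment k x b g) F)"
proof -
  let ?u = "\<lambda>j b. min (M + 1) (card (unsat (j * Q + x) b g))"
  have u: "?u j b \<le> ?u (Suc j) b \<and> (?u j b < ?u (Suc j) b \<longleftrightarrow> j \<le> num_sat (assignment k x b g) F)"
    if "b < Q" for b
    using card_unsat[OF assms(1) that assms(2), of j] card_unsat[OF assms(1) that assms(2), of "Suc j"]
      assms(3) num_sat_le[of "assignment k x b g" F] by (simp del: mult_Suc) linarith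
  have "flow (j * Q + x) g < flow (Suc j * Q + x) g + Q \<longleftrightarrow> (\<Sum>b<Q. ?u j b) < (\<Sum>b<Q. ?u (Suc j) b)"
    unfolding flow_def card_direct[OF assms(1,3)] by simp
  also have "\<dots> \<longleftrightarrow> (\<exists>b<Q. ?u j b < ?u (Suc j) b)"
  proof
    assume *: "(\<Sum>b<Q. ?u j b) < (\<Sum>b<Q. ?u (Suc j) b)"
    show "\<exists>b<Q. ?u j b < ?u (Suc j) b"
    proof (rule ccontr)
      assume "\<not> (\<exists>b<Q. ?u j b < ?u (Suc j) b)"
      then have "?u (Suc j) b \<le> ?u j b" if "b < Q" for b using that by (meson not_less)
      then have "(\<Sum>b<Q. ?u (Suc j) b) \<le> (\<Sum>b<Q. ?u j b)" by (intro sum_mono) simp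
      with * show False by simp
    qed
  next
    assume "\<exists>b<Q. ?u j b < ?u (Suc j) b"
    then show "(\<Sum>b<Q. ?u j b) < (\<Sum>b<Q. ?u (Suc j) b)"
      using u by (intro sum_strict_mono_ex1) auto
  qed
  finally show ?thesis using u by blast
qed

end

section \<open>Straight-line code and the text of the program\<close>

section \<open>The program\<close>

text \<open>A time budget in units of \<open>L\<close> for loop-free code, where a conditional is
  charged for both branches. No \<open>lrun\<close> rule covers \<open>Loop\<close>, so the value 0
  is a placeholder: loops are paid for through \<open>run_For\<close>.\<close>

primrec tcost :: "com \<Rightarrow> nat" where
  "tcost Skip = 1"
| "tcost (Write a i e) = wcost i e"
| "tcost (Seq c1 c2) = tcost c1 + tcost c2"
| "tcost (Cond b c1 c2) = gcost b + tcost c1 + tcost c2"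
| "tcost (Loop b c) = 0"

abbreviation lrun :: "nat \<Rightarrow> com \<Rightarrow> mem \<Rightarrow> (mem \<Rightarrow> bool) \<Rightarrow> bool" where
  "lrun L c M Q \<equiv> run c M (L * tcost c) Q"

lemma lrun_Skip: "1 \<le> L \<Longrightarrow> Q M \<Longrightarrow> lrun L Skip M Q"
  unfolding run_def using exec.Skip by fastforce

lemma lrun_Write:
  "1 \<le> L \<Longrightarrow> fits L i M \<Longrightarrow> fits L e M \<Longrightarrow> Q (M(a := (M a)(val i M := val e M))) \<Longrightarrow>
    lrun L (Write a i e) M Q"
  by (rule run_Write[where L = L]) simp_all

lemma lrun_Write_Seq:
  assumes "1 \<le> L" "fits L i M" "fits L e M" "lrun L c (M(a := (M a)(val i M := val e M))) Q"
  shows "lrun L (Seq (Write a i e) c) M Q"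
  by (rule run_Seq[where ?Q1.0 = "\<lambda>M'. M' = M(a := (M a)(val i M := val e M))" and ?T1.0 = "L * wcost i e"])
    (use assms in \<open>auto intro: run_Write simp: algebra_simps\<close>)

lemma run_Write_Seq:
  assumes "1 \<le> L" "fits L i M" "fits L e M" "run c (M(a := (M a)(val i M := val e M))) T Q"
  shows "run (Seq (Write a i e) c) M (L * wcost i e + T) Q"
  by (rule run_Seq[where ?Q1.0 = "\<lambda>M'. M' = M(a := (M a)(val i M := val e M))" and ?T1.0 = "L * wcost i e"])
    (use assms in \<open>auto intro: run_Write simp: algebra_simps\<close>)

lemma lrun_Cond:
  assumes "1 \<le> L" "fits L b M"
    and "val b M \<noteq> 0 \<Longrightarrow> lrun L c1 M Q" "val b M = 0 \<Longrightarrow> lrun L c2 M Q"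
  shows "lrun L (Cond b c1 c2) M Q"
proof (rule run_Cond[OF assms(1,2), where ?T1.0 = "L * tcost c1 + L * tcost c2"])
  show "val b M \<noteq> 0 \<Longrightarrow> run c1 M (L * tcost c1 + L * tcost c2) Q"
    using assms(3) run_mono by (metis le_add1)
  show "val b M = 0 \<Longrightarrow> run c2 M (L * tcost c1 + L * tcost c2) Q"
    using assms(4) run_mono by (metis le_add2)
qed (simp add: algebra_simps)

definition tab :: "nat list \<Rightarrow> nat \<Rightarrow> nat" where
  "tab xs i = (if i < length xs then xs ! i else 0)"

lemma tab_snoc: "(tab xs)(length xs := v) = tab (xs @ [v])"
  by (auto simp: tab_def fun_eq_iff nth_append)

lemma tab_Nil: "tab [] = (\<lambda>_. 0)"
  by (auto simp: tab_def)

lemma input_mem_eq: "input_mem xs = (\<lambda>a. if a = 0 then tab xs else (\<lambda>_. 0))"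
  by (auto simp: input_mem_def tab_def fun_eq_iff)

text \<open>
  Arrays 2 to 5 and 19 are registers for \<open>k\<close>, \<open>M\<close>, \<open>m1\<close>, \<open>Q\<close> and \<open>N\<close>; arrays 7 to 10 and 16
  are loop counters; 11 and 17 are the positions in the input and in the network; 12, 13, 14 hold
  a power of two, the length of a clause, and a literal. Array 15 is the table of \<open>bsat\<close>; the
  arrays of the max-flow program start at 20.
\<close>

abbreviation eplus (infixl "\<oplus>" 65) where "a \<oplus> b \<equiv> Bin Plus a b"
abbreviation emonus (infixl "\<ominus>" 65) where "a \<ominus> b \<equiv> Bin Monus a b"
abbreviation etimes (infixl "\<otimes>" 70) where "a \<otimes> b \<equiv> Bin Times a b"
abbreviation equot (infixl "\<oslash>" 70) where "a \<oslash> b \<equiv> Bin Quot a b"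
abbreviation erem (infixl "\<odot>" 70) where "a \<odot> b \<equiv> Bin Rem a b"

definition eeq :: "expr \<Rightarrow> expr \<Rightarrow> expr" where
  "eeq a b = Const 1 \<ominus> ((a \<ominus> b) \<oplus> (b \<ominus> a))"

lemma val_eeq [simp]: "val (eeq a b) M = of_bool (val a M = val b M)"
  by (auto simp: eeq_def)

lemma fits_eeq [simp]: "fits L (eeq a b) M \<longleftrightarrow> 1 < (2::nat) ^ L \<and> fits L a M \<and> fits L b M"
  by (auto simp: eeq_def)

definition init_loop :: com where
  "init_loop = For 9 (reg 2) (setr 5 (Const 2 \<otimes> reg 5))"

definition init_end :: com where
  "init_end = Seq (setr 19 (reg 5 \<otimes> ((reg 3 \<oplus> Const 5) \<otimes> reg 4 \<oplus> Const 1))) (setr 11 (Const 2))"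

definition init :: com where
  "init = Seq (setr 3 (Read 0 (Const 1))) (Seq (setr 2 (Read 0 (Const 0) \<oslash> Const 3 \<oplus> Const 3))
     (Seq (setr 4 (Const 2 \<otimes> reg 3 \<oplus> Const 16)) (Seq (setr 5 (Const 1)) (Seq init_loop init_end))))"

definition pow_loop :: com where
  "pow_loop = For 9 (reg 14 \<oslash> Const 2 \<odot> reg 2) (setr 12 (Const 2 \<otimes> reg 12))"

text \<open>The literal code \<open>2 * v + b\<close> is in array 14, the partial assignment in
  array 10, and \<open>2 ^ (v mod k)\<close> in array 12. The first factor compares blocks, the
  second compares the binary digit of \<open>v\<close> with the sign. Entries are only ever set to
  1, so the literals of a clause accumulate as a disjunction.\<close>

definition mark :: com where
  "mark = Cond (eeq (reg 14 \<oslash> Const 2 \<oslash> reg 2) (reg 10 \<oslash> reg 5) \<otimes>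
       eeq (reg 10 \<odot> reg 5 \<oslash> reg 12 \<odot> Const 2) (reg 14 \<odot> Const 2))
     (Write 15 (reg 10 \<otimes> reg 4 \<oplus> reg 7) (Const 1)) Skip"

definition lit_step :: com where
  "lit_step = Seq (setr 14 (Read 0 (reg 11))) (Seq (setr 11 (reg 11 \<oplus> Const 1))
     (Seq (setr 12 (Const 1)) (Seq pow_loop (For 10 (Const 3 \<otimes> reg 5) mark))))"

definition parse :: com where
  "parse = For 7 (reg 3) (Seq (setr 13 (Read 0 (reg 11))) (Seq (setr 11 (reg 11 \<oplus> Const 1))
     (For 8 (reg 13) lit_step)))"

section \<open>Tabulating which partial assignments satisfy which clauses\<close>

section \<open>Reading the formula\<close>

abbreviation lit_code :: "literal \<Rightarrow> nat" where
  "lit_code \<equiv> \<lambda>(i, b). 2 * i + of_bool b"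

text \<open>Index of the length field of clause \<open>c\<close> in the input; the 2 skips the
  header.\<close>

definition clause_pos :: "cnf \<Rightarrow> nat \<Rightarrow> nat" where
  "clause_pos F c = 2 + (\<Sum>d\<leftarrow>take c F. Suc (length d))"

lemma nth_concat_map:
  assumes "c < length F" "i < length (f (F ! c))"
  shows "(\<Sum>d\<leftarrow>take c F. length (f d)) + i < length (concat (map f F)) \<and>
    concat (map f F) ! ((\<Sum>d\<leftarrow>take c F. length (f d)) + i) = f (F ! c) ! i"
  using assms
proof (induction F arbitrary: c)
  case (Cons d F)
  then show ?case by (cases c) (simp_all add: nth_append add.assoc)
qed simp

lemma tab_encode_cnf:
  "tab (encode_cnf n F) 0 = n" "tab (encode_cnf n F) (Suc 0) = length F"
  by (simp_all add: tab_def encode_cnf_def)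

lemma tab_encode_clause:
  assumes "c < length F"
  shows "tab (encode_cnf n F) (clause_pos F c) = length (F ! c)"
    and "l < length (F ! c) \<Longrightarrow> tab (encode_cnf n F) (Suc (clause_pos F c + l)) = lit_code (F ! c ! l)"
proof -
  let ?f = "\<lambda>c. length c # map lit_code c"
  have pos: "clause_pos F c = 2 + (\<Sum>d\<leftarrow>take c F. length (?f d))" by (simp add: clause_pos_def)
  have tab: "tab (encode_cnf n F) (clause_pos F c + i) = ?f (F ! c) ! i" if "i < length (?f (F ! c))" for i
    using nth_concat_map[where f = ?f, OF assms that] by (simp add: tab_def encode_cnf_def pos del: length_Cons)
  show "tab (encode_cnf n F) (clause_pos F c) = length (F ! c)" using tab[of 0] by simp
  show "tab (encode_cnf n F) (Suc (clause_pos F c + l)) = lit_code (F ! c ! l)" if "l < length (F ! c)"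
    using tab[of "Suc l"] that by simp
qed

lemma clause_pos_Suc: "c < length F \<Longrightarrow> clause_pos F (Suc c) = Suc (clause_pos F c + length (F ! c))"
  by (simp add: clause_pos_def take_Suc_conv_app_nth)

text \<open>Distinctness of the literals is what bounds the input length, and hence the parsing
  time, in terms of the numbers of variables and clauses.\<close>

lemma length_clause_le:
  assumes "is_cnf n F" "c \<in> set F"
  shows "length c \<le> 2 * n"
proof -
  have "length c = card (set c)" using assms unfolding is_cnf_def by (metis distinct_card)
  also have "\<dots> \<le> card ({..<n} \<times> (UNIV :: bool set))"
    using assms unfolding is_cnf_def by (intro card_mono) fastforce+
  finally show ?thesis by (simp add: card_cartesian_product mult.commute)
qed

text \<open>This \<open>k\<close> is computable from \<open>n\<close> by one division, satisfies
  \<open>n \<le> 3 * k\<close> and \<open>3 \<le> k\<close>, and makes \<open>2 ^ k\<close> at most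
  8 times 2^(n/3).\<close>

locale formula_machine = formula_network +
  assumes k_eq: "k = n div 3 + 3"
begin

text \<open>Word length for all constants and all cells that are read. These are at most
  \<open>4 * N * Q\<close>, and \<open>(M + 5) * m1 + 1 < 2 ^ (8 + 2 * M)\<close>, which gives the
  exponents. Bounding a polynomial in \<open>M\<close> by a power of 2 is harmless, as
  \<open>L\<close> enters the running time only as a factor.\<close>

definition L :: nat where "L = 2 * k + 2 * M + 11"

lemma L_ge: "1 \<le> L" and L_ge' [simp]: "Suc 0 \<le> L"
  by (simp_all add: L_def)

lemma less_L: "x \<le> 4 * N * Q \<Longrightarrow> x < 2 ^ L"
proof -
  have 1: "a + 1 \<le> 2 ^ a" for a :: nat
    by (simp add: Suc_leI)
  have "(M + 5) * m1 + 1 \<le> (8 * 2 ^ M) * (16 * 2 ^ M) + 2 ^ M * 2 ^ M"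
  proof (rule add_mono)
    show "(M + 5) * m1 \<le> (8 * 2 ^ M) * (16 * 2 ^ M)"
      using 1[of M] unfolding m1_def by (intro mult_le_mono; linarith)
  qed simp
  also have "\<dots> < 256 * (2 ^ M * 2 ^ M)" by simp
  finally have "Q * ((M + 5) * m1 + 1) < Q * (256 * (2 ^ M * 2 ^ M))"
    using Q_ge by (intro mult_strict_left_mono) simp_all
  then have "N * Q < Q * (256 * (2 ^ M * 2 ^ M)) * Q"
    unfolding N_eq using Q_ge by (intro mult_strict_right_mono) simp_all
  then have "4 * N * Q < 4 * (Q * (256 * (2 ^ M * 2 ^ M)) * Q)" by simp
  also have "\<dots> = 1024 * (2 ^ (2 * M) * 2 ^ (2 * k))"
    by (simp add: Q_def mult_2 power_add)
  also have "\<dots> = 2 ^ (10 + 2 * M + 2 * k)" by (simp only: power_add) simp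
  also have "\<dots> < 2 ^ L" unfolding L_def by (intro power_strict_increasing) auto
  finally show "x \<le> 4 * N * Q \<Longrightarrow> x < 2 ^ L" by simp
qed

lemma NQ: "x \<le> N \<Longrightarrow> x < 2 ^ L" "x \<le> Q \<Longrightarrow> x < 2 ^ L"
proof -
  have "N \<le> 4 * N * Q" "Q \<le> 4 * N * Q" using Q_ge N_ge by simp_all
  then show "x \<le> N \<Longrightarrow> x < 2 ^ L" "x \<le> Q \<Longrightarrow> x < 2 ^ L" using less_L le_trans by blast+
qed

lemma n_le_Q: "2 * n + 2 \<le> 8 * Q" "k + 1 \<le> Q"
proof -
  have 1: "k + 1 \<le> Q" unfolding Q_def by (simp add: Suc_leI)
  then show "k + 1 \<le> Q" .
  show "2 * n + 2 \<le> 8 * Q" using 1 n_le by linarith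
qed

lemma const_less [simp]: "0 < (2::nat) ^ L" "Suc 0 < 2 ^ L" "2 < (2::nat) ^ L" "3 < (2::nat) ^ L"
  "4 < (2::nat) ^ L" "5 < (2::nat) ^ L" "6 < (2::nat) ^ L" "7 < (2::nat) ^ L" "8 < (2::nat) ^ L"
  "16 < (2::nat) ^ L"
  using N_ge(1) by (intro NQ(1); simp add: m1_def; fail)+

lemma reg_less [simp]: "Q < 2 ^ L" "k < 2 ^ L" "M < 2 ^ L" "m1 < 2 ^ L" "N < 2 ^ L" "Suc M < 2 ^ L"
  "n < 2 ^ L" "2 * n + 1 < 2 ^ L"
proof -
  show "Q < 2 ^ L" "k < 2 ^ L" using n_le_Q by (intro NQ(2); simp)+
  show "M < 2 ^ L" "m1 < 2 ^ L" "N < 2 ^ L" "Suc M < 2 ^ L" using N_ge by (intro NQ(1); simp)+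
  have "8 * Q \<le> 4 * N * Q" using N_ge(1) m1_def by simp
  then show "n < 2 ^ L" "2 * n + 1 < 2 ^ L" using n_le_Q by (intro less_L; linarith)+
qed

definition inp :: "nat list" where "inp = encode_cnf n F"

definition env :: "mem \<Rightarrow> bool" where
  "env R \<longleftrightarrow> R 0 = tab inp \<and> R 2 0 = k \<and> R 3 0 = M \<and> R 4 0 = m1 \<and> R 5 0 = Q \<and> R 19 0 = N"

text \<open>The constants \<open>K_init\<close>, \<open>K_pow\<close> and so on depend on the
  program text only, not on \<open>n\<close>, \<open>k\<close> or \<open>F\<close>. They therefore
  leave the locale without parameters and can serve as constants of an O-bound that is uniform in
  the formula.\<close>

definition K_init where "K_init = tcost init + tcost init_end + tcost (setr 5 (Const 2 \<otimes> reg 5)) + fcost 9 (reg 2)"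

lemma run_init:
  "run init (input_mem inp) (L * K_init * Q) (\<lambda>R. env R \<and> R 11 0 = 2 \<and>
     (\<forall>a. a \<notin> {0, 2, 3, 4, 5, 9, 11, 19} \<longrightarrow> R a = (\<lambda>_. 0)))"
proof -
  let ?R0 = "input_mem inp"
  let ?fr = "\<lambda>R. R 0 = tab inp \<and> R 2 0 = k \<and> R 3 0 = M \<and> R 4 0 = m1 \<and>
     (\<forall>a. a \<notin> {0, 2, 3, 4, 5, 9, 11, 19} \<longrightarrow> R a = (\<lambda>_. 0))"
  have loop: "run init_loop R ((k + 1) * (L * tcost (setr 5 (Const 2 \<otimes> reg 5)) + L * fcost 9 (reg 2)))
      (\<lambda>R. ?fr R \<and> R 5 0 = Q)" if "?fr R" "R 5 0 = 1" for R
    unfolding init_loop_def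
  proof (rule run_For[where L = L and N = k and I = "\<lambda>h R. ?fr R \<and> R 5 0 = 2 ^ h"])
    fix h :: nat and R :: mem assume "?fr R \<and> R 5 0 = 2 ^ h" "h < k" "R 9 0 = h"
    moreover have "(2::nat) ^ h < 2 ^ L" using \<open>h < k\<close> by (intro power_strict_increasing) (auto simp: L_def)
    ultimately show "lrun L (setr 5 (Const 2 \<otimes> reg 5)) R (\<lambda>R'. R' 9 0 = h \<and>
        ?fr (R'(9 := (R' 9)(0 := Suc h))) \<and> (R'(9 := (R' 9)(0 := Suc h))) 5 0 = 2 ^ Suc h)"
      by (intro lrun_Write L_ge) simp_all
  qed (use that in \<open>simp_all add: L_ge Q_def\<close>)
  have fin: "lrun L init_end R (\<lambda>R. env R \<and> R 11 0 = 2 \<and>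
     (\<forall>a. a \<notin> {0, 2, 3, 4, 5, 9, 11, 19} \<longrightarrow> R a = (\<lambda>_. 0)))" if "?fr R" "R 5 0 = Q" for R
    unfolding init_end_def
    by (intro lrun_Write_Seq lrun_Write L_ge) (use that in \<open>simp_all add: env_def N_eq\<close>)
  have 1: "run (Seq init_loop init_end) R ((k + 1) * (L * tcost (setr 5 (Const 2 \<otimes> reg 5)) + L * fcost 9 (reg 2)) + L * tcost init_end)
      (\<lambda>R. env R \<and> R 11 0 = 2 \<and> (\<forall>a. a \<notin> {0, 2, 3, 4, 5, 9, 11, 19} \<longrightarrow> R a = (\<lambda>_. 0)))"
    if "?fr R" "R 5 0 = 1" for R
  proof (rule run_Seq[OF loop[OF that]])
    fix R' :: mem assume "?fr R' \<and> R' 5 0 = Q"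
    then show "lrun L init_end R' (\<lambda>R. env R \<and> R 11 0 = 2 \<and> (\<forall>a. a \<notin> {0, 2, 3, 4, 5, 9, 11, 19} \<longrightarrow> R a = (\<lambda>_. 0)))"
      by (intro fin) simp_all
  qed simp
  let ?T = "(k + 1) * (L * tcost (setr 5 (Const 2 \<otimes> reg 5)) + L * fcost 9 (reg 2)) + L * tcost init_end"
  show ?thesis
  proof (rule run_mono)
    show "run init ?R0 (L * wcost (Const 0) (Read 0 (Const 1)) +
      (L * wcost (Const 0) (Read 0 (Const 0) \<oslash> Const 3 \<oplus> Const 3) +
      (L * wcost (Const 0) (Const 2 \<otimes> reg 3 \<oplus> Const 16) + (L * wcost (Const 0) (Const 1) + ?T))))
      (\<lambda>R. env R \<and> R 11 0 = 2 \<and> (\<forall>a. a \<notin> {0, 2, 3, 4, 5, 9, 11, 19} \<longrightarrow> R a = (\<lambda>_. 0)))"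
      unfolding init_def
      by (intro run_Write_Seq L_ge 1)
        (simp_all add: input_mem_eq inp_def tab_encode_cnf k_eq[symmetric] m1_def)
    have "(k + 1) * (L * tcost (setr 5 (Const 2 \<otimes> reg 5)) + L * fcost 9 (reg 2)) \<le>
      Q * (L * tcost (setr 5 (Const 2 \<otimes> reg 5)) + L * fcost 9 (reg 2))"
      using n_le_Q by (intro mult_le_mono1)
    moreover have "L * (tcost init + tcost init_end) \<le> Q * (L * (tcost init + tcost init_end))"
      using Q_ge by simp
    ultimately show "L * wcost (Const 0) (Read 0 (Const 1)) +
      (L * wcost (Const 0) (Read 0 (Const 0) \<oslash> Const 3 \<oplus> Const 3) +
      (L * wcost (Const 0) (Const 2 \<otimes> reg 3 \<oplus> Const 16) + (L * wcost (Const 0) (Const 1) + ?T))) \<le> L * K_init * Q"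
      unfolding K_init_def by (simp add: algebra_simps init_def)
  qed
qed

text \<open>Row \<open>y\<close> and column \<open>c\<close> at stride \<open>m1\<close>. With
  \<open>bsat\<close> the columns from \<open>M\<close> on, those of the dummies, are 0, and the
  cells past row \<open>3 * Q\<close> are never written.\<close>

definition tbl :: "(nat \<Rightarrow> nat \<Rightarrow> bool) \<Rightarrow> nat \<Rightarrow> nat" where
  "tbl D i = of_bool (i div m1 < 3 * Q \<and> D (i div m1) (i mod m1))"

lemma tbl_False: "tbl (\<lambda>_ _. False) = (\<lambda>_. 0)"
  by (auto simp: tbl_def)

lemma tbl_at: "c < m1 \<Longrightarrow> tbl D (y * m1 + c) = of_bool (y < 3 * Q \<and> D y c)"
  by (simp add: tbl_def)

lemma tbl_upd:
  assumes "y < 3 * Q" "c < m1"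
  shows "(tbl D)(y * m1 + c := 1) = tbl (\<lambda>y' c'. D y' c' \<or> c' = c \<and> y' = y)"
proof
  fix i
  have "i = y * m1 + c \<longleftrightarrow> i div m1 = y \<and> i mod m1 = c"
    using assms(2) by (metis div_mult_mod_eq div_mult_self3 div_less add.right_neutral add.commute
        mod_less mod_mult_self3 not_less_zero)
  then show "((tbl D)(y * m1 + c := 1)) i = tbl (\<lambda>y' c'. D y' c' \<or> c' = c \<and> y' = y) i"
    using assms(1) by (auto simp: tbl_def)
qed

lemma tbl_less [simp]: "tbl D i < 2 ^ L"
  by (cases "tbl D i = 0") (auto simp: tbl_def)

lemma clause_pos_le: "c \<le> M \<Longrightarrow> clause_pos F c \<le> 2 + c * (2 * n + 1)"
proof (induction c)
  case (Suc c)
  then have "length (F ! c) \<le> 2 * n" using length_clause_le[OF cnf] by simp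
  with Suc show ?case by (simp add: clause_pos_Suc)
qed (simp add: clause_pos_def)

lemma pos_less:
  assumes "c < M" "l \<le> length (F ! c)"
  shows "Suc (clause_pos F c + l) < 2 ^ L"
proof (rule NQ(1))
  have "Suc (clause_pos F c + l) \<le> clause_pos F (Suc c)"
    using assms by (simp add: clause_pos_Suc)
  also have "\<dots> \<le> 2 + Suc c * (2 * n + 1)" using assms by (intro clause_pos_le) simp
  also have "\<dots> \<le> 2 + M * (2 * n + 1)" using assms by (intro add_left_mono mult_le_mono1) simp
  also have "\<dots> \<le> 8 * Q + M * (8 * Q)" using n_le_Q Q_ge by (intro add_mono mult_le_mono2) linarith+
  also have "\<dots> \<le> N" using N_ge(2) by (simp add: algebra_simps)
  finally show "Suc (clause_pos F c + l) \<le> N" .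
qed

definition K_pow where "K_pow = tcost (setr 12 (Const 2 \<otimes> reg 12)) + fcost 9 (reg 14 \<oslash> Const 2 \<odot> reg 2)"

lemma run_pow_loop:
  assumes "env R" "R 14 0 = 2 * v + of_bool b" "v < n" "R 12 0 = 1"
  shows "run pow_loop R (Q * (L * K_pow))
    (\<lambda>R'. (\<forall>a. a \<notin> {9, 12} \<longrightarrow> R' a = R a) \<and> R' 12 0 = 2 ^ (v mod k))"
  unfolding pow_loop_def
proof (rule run_For[where L = L and N = "v mod k" and ?T1.0 = "L * tcost (setr 12 (Const 2 \<otimes> reg 12))"
      and I = "\<lambda>h R'. (\<forall>a. a \<notin> {9, 12} \<longrightarrow> R' a = R a) \<and> R' 12 0 = 2 ^ h"])
  have k: "v mod k < k" using k_ge by simp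
  then show "v mod k < 2 ^ L" using reg_less(2) by linarith
  have v: "2 * v + of_bool b < 2 ^ L" using assms(3) reg_less(8) by (simp add: of_bool_def split: if_splits)
  {
    fix h :: nat and R' :: mem
    assume "(\<forall>a. a \<notin> {9, 12} \<longrightarrow> R' a = R a) \<and> R' 12 0 = 2 ^ h" "h \<le> v mod k" "R' 9 0 = h"
    then show "val (reg 14 \<oslash> Const 2 \<odot> reg 2) R' = v mod k \<and> fits L (reg 14 \<oslash> Const 2 \<odot> reg 2) R'"
      using assms v by (simp add: env_def)
  next
    fix h :: nat and R' :: mem
    assume *: "(\<forall>a. a \<notin> {9, 12} \<longrightarrow> R' a = R a) \<and> R' 12 0 = 2 ^ h" "h < v mod k" "R' 9 0 = h"
    then have "(2::nat) ^ h < 2 ^ L" using k by (intro power_strict_increasing) (auto simp: L_def)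
    with * show "lrun L (setr 12 (Const 2 \<otimes> reg 12)) R' (\<lambda>R''. R'' 9 0 = h \<and>
      (\<forall>a. a \<notin> {9, 12} \<longrightarrow> (R''(9 := (R'' 9)(0 := Suc h))) a = R a) \<and> (R''(9 := (R'' 9)(0 := Suc h))) 12 0 = 2 ^ Suc h)"
      by (intro lrun_Write L_ge) simp_all
  }
  have "(v mod k + 1) * (L * K_pow) \<le> Q * (L * K_pow)"
    using k n_le_Q by (intro mult_le_mono1) simp
  then show "(v mod k + 1) * (L * tcost (setr 12 (Const 2 \<otimes> reg 12)) + L * fcost 9 (reg 14 \<oslash> Const 2 \<odot> reg 2)) \<le> Q * (L * K_pow)"
    by (simp add: K_pow_def algebra_simps)
qed (use assms in simp_all)

definition K_mark where "K_mark = tcost mark + fcost 10 (Const 3 \<otimes> reg 5)"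

lemma run_mark_loop:
  assumes R: "env R" "R 14 0 = lit_code l" "fst l < n" "R 12 0 = 2 ^ (fst l mod k)"
    "R 7 0 = c" "c < M" "R 15 = tbl D"
  shows "run (For 10 (Const 3 \<otimes> reg 5) mark) R (4 * Q * (L * K_mark))
    (\<lambda>R'. (\<forall>a. a \<notin> {10, 15} \<longrightarrow> R' a = R a) \<and> R' 15 = tbl (\<lambda>y c'. D y c' \<or> c' = c \<and> lit_true k y l))"
proof (rule run_For[where L = L and N = "3 * Q" and ?T1.0 = "L * tcost mark"
      and I = "\<lambda>y R'. (\<forall>a. a \<notin> {10, 15} \<longrightarrow> R' a = R a) \<and>
         R' 15 = tbl (\<lambda>y' c'. D y' c' \<or> c' = c \<and> y' < y \<and> lit_true k y' l)"])
  obtain v b where l: "l = (v, b)" by force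
  have k: "v mod k < k" using k_ge by simp
  have v: "2 * v + of_bool b < 2 ^ L" using R(3) reg_less(8) l by (simp add: of_bool_def split: if_splits)
  have pw: "(2::nat) ^ (v mod k) < 2 ^ L" using k by (intro power_strict_increasing) (auto simp: L_def)
  have cm: "c < m1" using R(6) by (simp add: m1_def)
  then have cL: "c < 2 ^ L" using reg_less(4) by linarith
  show N3: "3 * Q < 2 ^ L" by (rule less_L) (use N_ge(1) m1_def in simp)
  show "(\<forall>a. a \<notin> {10, 15} \<longrightarrow> (R(10 := (R 10)(0 := 0))) a = R a) \<and>
    (R(10 := (R 10)(0 := 0))) 15 = tbl (\<lambda>y' c'. D y' c' \<or> c' = c \<and> y' < 0 \<and> lit_true k y' l)"
    using R by simp
  {
    fix y :: nat and R' :: mem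
    assume "(\<forall>a. a \<notin> {10, 15} \<longrightarrow> R' a = R a) \<and>
         R' 15 = tbl (\<lambda>y' c'. D y' c' \<or> c' = c \<and> y' < y \<and> lit_true k y' l)" "y \<le> 3 * Q" "R' 10 0 = y"
    then show "val (Const 3 \<otimes> reg 5) R' = 3 * Q \<and> fits L (Const 3 \<otimes> reg 5) R'"
      using R by (simp add: env_def)
  next
    fix y :: nat and R' :: mem
    assume *: "(\<forall>a. a \<notin> {10, 15} \<longrightarrow> R' a = R a) \<and>
         R' 15 = tbl (\<lambda>y' c'. D y' c' \<or> c' = c \<and> y' < y \<and> lit_true k y' l)" "y < 3 * Q" "R' 10 0 = y"
    then have yL: "y < 2 ^ L" using N3 by linarith
    have Q: "Q = 2 ^ k" by (simp add: Q_def)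
    have lt: "lit_true k y l \<longleftrightarrow> v div k = y div Q \<and> y mod Q div 2 ^ (v mod k) mod 2 = of_bool b"
      by (cases b) (auto simp: lit_true_def l Q odd_iff_mod_2_eq_one even_iff_mod_2_eq_zero)
    show "lrun L mark R' (\<lambda>R''. R'' 10 0 = y \<and> (\<forall>a. a \<notin> {10, 15} \<longrightarrow> (R''(10 := (R'' 10)(0 := Suc y))) a = R a) \<and>
      (R''(10 := (R'' 10)(0 := Suc y))) 15 = tbl (\<lambda>y' c'. D y' c' \<or> c' = c \<and> y' < Suc y \<and> lit_true k y' l))"
      unfolding mark_def
    proof (intro lrun_Cond lrun_Write lrun_Skip L_ge)
      show "fits L (eeq (reg 14 \<oslash> Const 2 \<oslash> reg 2) (reg 10 \<oslash> reg 5) \<otimes>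
       eeq (reg 10 \<odot> reg 5 \<oslash> reg 12 \<odot> Const 2) (reg 14 \<odot> Const 2)) R'"
        using * R v pw yL by (simp add: env_def l)
      show "fits L (reg 10 \<otimes> reg 4 \<oplus> reg 7) R'" "fits L (Const 1) R'"
        using * R yL cL by (simp_all add: env_def l)
    next
      assume "val (eeq (reg 14 \<oslash> Const 2 \<oslash> reg 2) (reg 10 \<oslash> reg 5) \<otimes>
       eeq (reg 10 \<odot> reg 5 \<oslash> reg 12 \<odot> Const 2) (reg 14 \<odot> Const 2)) R' \<noteq> 0"
      then have "lit_true k y l" using * R unfolding lt by (simp add: env_def l split: if_splits)
      then have "tbl (\<lambda>y' c'. D y' c' \<or> c' = c \<and> y' < Suc y \<and> lit_true k y' l) =
        (tbl (\<lambda>y' c'. D y' c' \<or> c' = c \<and> y' < y \<and> lit_true k y' l))(y * m1 + c := 1)"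
        unfolding tbl_upd[OF *(2) cm] by (intro arg_cong[of _ _ tbl] ext) (auto simp: less_Suc_eq)
      then show "(R'(15 := (R' 15)(val (reg 10 \<otimes> reg 4 \<oplus> reg 7) R' := val (Const 1) R'))) 10 0 = y \<and>
        (\<forall>a. a \<notin> {10, 15} \<longrightarrow> ((R'(15 := (R' 15)(val (reg 10 \<otimes> reg 4 \<oplus> reg 7) R' := val (Const 1) R')))
         (10 := ((R'(15 := (R' 15)(val (reg 10 \<otimes> reg 4 \<oplus> reg 7) R' := val (Const 1) R'))) 10)(0 := Suc y))) a = R a) \<and>
        ((R'(15 := (R' 15)(val (reg 10 \<otimes> reg 4 \<oplus> reg 7) R' := val (Const 1) R')))
         (10 := ((R'(15 := (R' 15)(val (reg 10 \<otimes> reg 4 \<oplus> reg 7) R' := val (Const 1) R'))) 10)(0 := Suc y))) 15 =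
          tbl (\<lambda>y' c'. D y' c' \<or> c' = c \<and> y' < Suc y \<and> lit_true k y' l)"
        using * R by (simp add: env_def)
    next
      assume "val (eeq (reg 14 \<oslash> Const 2 \<oslash> reg 2) (reg 10 \<oslash> reg 5) \<otimes>
       eeq (reg 10 \<odot> reg 5 \<oslash> reg 12 \<odot> Const 2) (reg 14 \<odot> Const 2)) R' = 0"
      then have "\<not> lit_true k y l" using * R unfolding lt by (simp add: env_def l split: if_splits)
      then have "(\<lambda>y' c'. D y' c' \<or> c' = c \<and> y' < Suc y \<and> lit_true k y' l) =
        (\<lambda>y' c'. D y' c' \<or> c' = c \<and> y' < y \<and> lit_true k y' l)"
        by (intro ext) (auto simp: less_Suc_eq)
      then show "R' 10 0 = y \<and> (\<forall>a. a \<notin> {10, 15} \<longrightarrow> (R'(10 := (R' 10)(0 := Suc y))) a = R a) \<and>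
      (R'(10 := (R' 10)(0 := Suc y))) 15 = tbl (\<lambda>y' c'. D y' c' \<or> c' = c \<and> y' < Suc y \<and> lit_true k y' l)"
        using * by simp
    qed
  next
    fix R' :: mem
    assume *: "(\<forall>a. a \<notin> {10, 15} \<longrightarrow> R' a = R a) \<and>
         R' 15 = tbl (\<lambda>y' c'. D y' c' \<or> c' = c \<and> y' < 3 * Q \<and> lit_true k y' l)" "R' 10 0 = 3 * Q"
    have "tbl (\<lambda>y' c'. D y' c' \<or> c' = c \<and> y' < 3 * Q \<and> lit_true k y' l) =
      tbl (\<lambda>y' c'. D y' c' \<or> c' = c \<and> lit_true k y' l)"
      by (auto simp: tbl_def fun_eq_iff)
    with * show "(\<forall>a. a \<notin> {10, 15} \<longrightarrow> R' a = R a) \<and> R' 15 = tbl (\<lambda>y c'. D y c' \<or> c' = c \<and> lit_true k y l)"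
      by simp
  }
  have "(3 * Q + 1) * (L * K_mark) \<le> 4 * Q * (L * K_mark)" using Q_ge by (intro mult_le_mono1) simp
  then show "(3 * Q + 1) * (L * tcost mark + L * fcost 10 (Const 3 \<otimes> reg 5)) \<le> 4 * Q * (L * K_mark)"
    by (simp add: K_mark_def algebra_simps)
qed simp

definition K_lit where "K_lit = wcost (Const 0) (Read 0 (reg 11)) + wcost (Const 0) (reg 11 \<oplus> Const 1) +
  wcost (Const 0) (Const 1) + K_pow + 4 * K_mark"

lemma run_lit_step:
  assumes R: "env R" "c < M" "l < length (F ! c)" "R 7 0 = c" "R 11 0 = Suc (clause_pos F c + l)" "R 15 = tbl D"
  shows "run lit_step R (Q * (L * K_lit)) (\<lambda>R'. (\<forall>a. a \<notin> {9, 10, 11, 12, 14, 15} \<longrightarrow> R' a = R a) \<and>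
    R' 11 0 = Suc (clause_pos F c + Suc l) \<and> R' 15 = tbl (\<lambda>y c'. D y c' \<or> c' = c \<and> lit_true k y (F ! c ! l)))"
proof -
  obtain v b where l: "F ! c ! l = (v, b)" by force
  have v: "v < n" using cnf R(2,3) l unfolding is_cnf_def by (metis fst_conv nth_mem)
  have vL: "2 * v + of_bool b < 2 ^ L" using v reg_less(8) by (simp add: of_bool_def split: if_splits)
  have code: "R 0 (Suc (clause_pos F c + l)) = 2 * v + of_bool b"
    using R tab_encode_clause(2)[OF R(2,3)] l by (simp add: env_def inp_def)
  have pos: "Suc (clause_pos F c + l) < 2 ^ L" using pos_less[OF R(2)] R(3) by simp
  define R1 where "R1 = R(14 := (R 14)(0 := 2 * v + of_bool b),
    11 := (R 11)(0 := Suc (clause_pos F c + Suc l)), 12 := (R 12)(0 := 1))"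
  let ?Q = "\<lambda>R'. (\<forall>a. a \<notin> {9, 10, 11, 12, 14, 15} \<longrightarrow> R' a = R a) \<and>
    R' 11 0 = Suc (clause_pos F c + Suc l) \<and> R' 15 = tbl (\<lambda>y c'. D y c' \<or> c' = c \<and> lit_true k y (F ! c ! l))"
  have "run (Seq pow_loop (For 10 (Const 3 \<otimes> reg 5) mark)) R1 (Q * (L * K_pow) + 4 * Q * (L * K_mark)) ?Q"
  proof (rule run_Seq)
    show "run pow_loop R1 (Q * (L * K_pow)) (\<lambda>R'. (\<forall>a. a \<notin> {9, 12} \<longrightarrow> R' a = R1 a) \<and> R' 12 0 = 2 ^ (v mod k))"
      by (rule run_pow_loop[OF _ _ v]) (use R in \<open>simp_all add: env_def R1_def\<close>)
    fix R' :: mem assume R': "(\<forall>a. a \<notin> {9, 12} \<longrightarrow> R' a = R1 a) \<and> R' 12 0 = 2 ^ (v mod k)"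
    show "run (For 10 (Const 3 \<otimes> reg 5) mark) R' (4 * Q * (L * K_mark)) ?Q"
    proof (rule run_mono[OF run_mark_loop[where l = "(v, b)" and c = c and D = D]])
      fix R'' :: mem assume "(\<forall>a. a \<notin> {10, 15} \<longrightarrow> R'' a = R' a) \<and>
        R'' 15 = tbl (\<lambda>y c'. D y c' \<or> c' = c \<and> lit_true k y (v, b))"
      with R' show "?Q R''" by (simp add: R1_def l)
    qed (use R R' v in \<open>simp_all add: env_def R1_def\<close>)
  qed simp
  then have "run lit_step R (L * wcost (Const 0) (Read 0 (reg 11)) + (L * wcost (Const 0) (reg 11 \<oplus> Const 1) +
      (L * wcost (Const 0) (Const 1) + (Q * (L * K_pow) + 4 * Q * (L * K_mark))))) ?Q"
    unfolding lit_step_def R1_def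
    by (intro run_Write_Seq L_ge) (use R pos vL code in \<open>simp_all add: env_def\<close>)
  then show ?thesis
  proof (rule run_mono)
    have "L * x \<le> Q * (L * x)" for x using Q_ge by simp
    from this[of "wcost (Const 0) (Read 0 (reg 11)) + wcost (Const 0) (reg 11 \<oplus> Const 1) + wcost (Const 0) (Const 1)"]
    show "L * wcost (Const 0) (Read 0 (reg 11)) + (L * wcost (Const 0) (reg 11 \<oplus> Const 1) +
      (L * wcost (Const 0) (Const 1) + (Q * (L * K_pow) + 4 * Q * (L * K_mark)))) \<le> Q * (L * K_lit)"
      by (simp add: K_lit_def algebra_simps)
  qed
qed

definition K_clause where "K_clause = wcost (Const 0) (Read 0 (reg 11)) + wcost (Const 0) (reg 11 \<oplus> Const 1) +
  K_lit + fcost 8 (reg 13)"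

lemma run_clause:
  assumes R: "env R" "c < M" "R 7 0 = c" "R 11 0 = clause_pos F c" "R 15 = tbl (\<lambda>y c'. c' < c \<and> bsat k F y c')"
  shows "run (Seq (setr 13 (Read 0 (reg 11))) (Seq (setr 11 (reg 11 \<oplus> Const 1)) (For 8 (reg 13) lit_step))) R
    ((2 * n + 2) * (Q * (L * K_clause))) (\<lambda>R'. (\<forall>a. a \<notin> {8, 9, 10, 11, 12, 13, 14, 15} \<longrightarrow> R' a = R a) \<and>
    R' 11 0 = clause_pos F (Suc c) \<and> R' 15 = tbl (\<lambda>y c'. c' < Suc c \<and> bsat k F y c'))" (is "run _ _ _ ?Q")
proof -
  let ?len = "length (F ! c)"
  have len: "?len \<le> 2 * n" using length_clause_le[OF cnf] R(2) by simp
  then have lenL: "?len < 2 ^ L" using reg_less(8) by linarith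
  have pos: "clause_pos F c < 2 ^ L" "Suc (clause_pos F c) < 2 ^ L" using pos_less[OF R(2), of 0] by simp_all
  have code: "R 0 (clause_pos F c) = ?len"
    using R tab_encode_clause(1)[OF R(2)] by (simp add: env_def inp_def)
  define R1 where "R1 = R(13 := (R 13)(0 := ?len), 11 := (R 11)(0 := Suc (clause_pos F c)))"
  let ?D = "\<lambda>l y c'. c' < c \<and> bsat k F y c' \<or> c' = c \<and> (\<exists>i<l. lit_true k y (F ! c ! i))"
  have "run (For 8 (reg 13) lit_step) R1 ((2 * n + 1) * (Q * (L * K_lit) + L * fcost 8 (reg 13))) ?Q"
  proof (rule run_For[where L = L and N = ?len and ?T1.0 = "Q * (L * K_lit)" and
      I = "\<lambda>l R'. (\<forall>a. a \<notin> {8, 9, 10, 11, 12, 14, 15} \<longrightarrow> R' a = R1 a) \<and>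
        R' 11 0 = Suc (clause_pos F c + l) \<and> R' 15 = tbl (?D l)"])
    show "(?len + 1) * (Q * (L * K_lit) + L * fcost 8 (reg 13)) \<le> (2 * n + 1) * (Q * (L * K_lit) + L * fcost 8 (reg 13))"
      using len by (intro mult_le_mono1) simp
  next
    fix l :: nat and R' :: mem
    assume *: "(\<forall>a. a \<notin> {8, 9, 10, 11, 12, 14, 15} \<longrightarrow> R' a = R1 a) \<and>
        R' 11 0 = Suc (clause_pos F c + l) \<and> R' 15 = tbl (?D l)" "l < ?len" "R' 8 0 = l"
    have eq: "(\<lambda>y c'. ?D l y c' \<or> c' = c \<and> lit_true k y (F ! c ! l)) = ?D (Suc l)"
      by (intro ext) (auto simp: less_Suc_eq)
    have "run lit_step R' (Q * (L * K_lit)) (\<lambda>R''. (\<forall>a. a \<notin> {9, 10, 11, 12, 14, 15} \<longrightarrow> R'' a = R' a) \<and>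
      R'' 11 0 = Suc (clause_pos F c + Suc l) \<and> R'' 15 = tbl (?D (Suc l)))"
      unfolding eq[symmetric]
      by (rule run_lit_step) (use * R in \<open>simp_all add: env_def R1_def\<close>)
    then show "run lit_step R' (Q * (L * K_lit)) (\<lambda>R''. R'' 8 0 = l \<and>
      (\<forall>a. a \<notin> {8, 9, 10, 11, 12, 14, 15} \<longrightarrow> (R''(8 := (R'' 8)(0 := Suc l))) a = R1 a) \<and>
        (R''(8 := (R'' 8)(0 := Suc l))) 11 0 = Suc (clause_pos F c + Suc l) \<and>
        (R''(8 := (R'' 8)(0 := Suc l))) 15 = tbl (?D (Suc l)))"
      by (rule run_mono) (use * in simp_all)
  next
    fix R' :: mem
    assume *: "(\<forall>a. a \<notin> {8, 9, 10, 11, 12, 14, 15} \<longrightarrow> R' a = R1 a) \<and>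
        R' 11 0 = Suc (clause_pos F c + ?len) \<and> R' 15 = tbl (?D ?len)"
    have "(\<exists>i<?len. lit_true k y (F ! c ! i)) \<longleftrightarrow> (\<exists>l\<in>set (F ! c). lit_true k y l)" for y
      by (metis in_set_conv_nth)
    then have "?D ?len = (\<lambda>y c'. c' < Suc c \<and> bsat k F y c')"
      using R(2) by (intro ext) (auto simp: less_Suc_eq bsat_def)
    with * show "?Q R'" by (simp add: R1_def clause_pos_Suc[OF R(2)])
  qed (use R lenL in \<open>simp_all add: R1_def\<close>)
  then have "run (Seq (setr 13 (Read 0 (reg 11))) (Seq (setr 11 (reg 11 \<oplus> Const 1)) (For 8 (reg 13) lit_step))) R
    (L * wcost (Const 0) (Read 0 (reg 11)) + (L * wcost (Const 0) (reg 11 \<oplus> Const 1) +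
      (2 * n + 1) * (Q * (L * K_lit) + L * fcost 8 (reg 13)))) ?Q"
    unfolding R1_def
    by (intro run_Write_Seq L_ge) (use R pos lenL code in \<open>simp_all add: env_def\<close>)
  then show ?thesis
  proof (rule run_mono)
    have LQ: "L * x \<le> Q * (L * x)" for x using Q_ge by simp
    have "(2 * n + 1) * (Q * (L * K_lit) + L * fcost 8 (reg 13)) \<le> (2 * n + 1) * (Q * (L * K_lit) + Q * (L * fcost 8 (reg 13)))"
      using LQ by (intro mult_le_mono2 add_left_mono)
    also have "\<dots> \<le> (2 * n + 1) * (Q * (L * K_clause))"
      by (intro mult_le_mono2) (simp add: K_clause_def algebra_simps)
    finally have 1: "(2 * n + 1) * (Q * (L * K_lit) + L * fcost 8 (reg 13)) \<le> (2 * n + 1) * (Q * (L * K_clause))" .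
    have "L * wcost (Const 0) (Read 0 (reg 11)) + L * wcost (Const 0) (reg 11 \<oplus> Const 1) \<le> L * K_clause"
      by (simp add: K_clause_def algebra_simps)
    also have "\<dots> \<le> Q * (L * K_clause)" by (rule LQ)
    finally have "(L * wcost (Const 0) (Read 0 (reg 11)) + L * wcost (Const 0) (reg 11 \<oplus> Const 1)) +
      (2 * n + 1) * (Q * (L * K_lit) + L * fcost 8 (reg 13)) \<le>
      Q * (L * K_clause) + (2 * n + 1) * (Q * (L * K_clause))"
      using 1 by (rule add_mono)
    also have "\<dots> = (2 * n + 2) * (Q * (L * K_clause))" by simp
    finally show "L * wcost (Const 0) (Read 0 (reg 11)) + (L * wcost (Const 0) (reg 11 \<oplus> Const 1) +
      (2 * n + 1) * (Q * (L * K_lit) + L * fcost 8 (reg 13))) \<le> (2 * n + 2) * (Q * (L * K_clause))"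
      by (simp only: add.assoc)
  qed
qed

definition K_parse where "K_parse = K_clause + fcost 7 (reg 3)"

lemma run_parse:
  assumes R: "env R" "R 11 0 = 2" "R 15 = (\<lambda>_. 0)"
  shows "run parse R ((M + 1) * ((2 * n + 2) * (Q * (L * K_parse))))
    (\<lambda>R'. (\<forall>a. a \<notin> {7, 8, 9, 10, 11, 12, 13, 14, 15} \<longrightarrow> R' a = R a) \<and> R' 15 = tbl (bsat k F))"
  unfolding parse_def
proof (rule run_For[where L = L and N = M and ?T1.0 = "(2 * n + 2) * (Q * (L * K_clause))" and
      I = "\<lambda>c R'. (\<forall>a. a \<notin> {7, 8, 9, 10, 11, 12, 13, 14, 15} \<longrightarrow> R' a = R a) \<and>
        R' 11 0 = clause_pos F c \<and> R' 15 = tbl (\<lambda>y c'. c' < c \<and> bsat k F y c')"])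
  have "1 * (1 * (L * fcost 7 (reg 3))) \<le> (2 * n + 2) * (Q * (L * fcost 7 (reg 3)))"
    using Q_ge by (intro mult_le_mono) simp_all
  then show "(M + 1) * ((2 * n + 2) * (Q * (L * K_clause)) + L * fcost 7 (reg 3)) \<le>
    (M + 1) * ((2 * n + 2) * (Q * (L * K_parse)))"
    unfolding K_parse_def by (intro mult_le_mono2) (simp add: algebra_simps)
next
  fix c :: nat and R' :: mem
  assume *: "(\<forall>a. a \<notin> {7, 8, 9, 10, 11, 12, 13, 14, 15} \<longrightarrow> R' a = R a) \<and>
        R' 11 0 = clause_pos F c \<and> R' 15 = tbl (\<lambda>y c'. c' < c \<and> bsat k F y c')" "c < M" "R' 7 0 = c"
  show "run (Seq (setr 13 (Read 0 (reg 11))) (Seq (setr 11 (reg 11 \<oplus> Const 1)) (For 8 (reg 13) lit_step))) R'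
    ((2 * n + 2) * (Q * (L * K_clause))) (\<lambda>R'. R' 7 0 = c \<and>
     (\<forall>a. a \<notin> {7, 8, 9, 10, 11, 12, 13, 14, 15} \<longrightarrow> (R'(7 := (R' 7)(0 := Suc c))) a = R a) \<and>
        (R'(7 := (R' 7)(0 := Suc c))) 11 0 = clause_pos F (Suc c) \<and>
        (R'(7 := (R' 7)(0 := Suc c))) 15 = tbl (\<lambda>y c'. c' < Suc c \<and> bsat k F y c'))"
    by (rule run_mono[OF run_clause[where c = c]]) (use * R in \<open>simp_all add: env_def\<close>)
next
  fix R' :: mem
  assume *: "(\<forall>a. a \<notin> {7, 8, 9, 10, 11, 12, 13, 14, 15} \<longrightarrow> R' a = R a) \<and>
        R' 11 0 = clause_pos F M \<and> R' 15 = tbl (\<lambda>y c'. c' < M \<and> bsat k F y c')"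
  have "(\<lambda>y c'. c' < M \<and> bsat k F y c') = bsat k F"
    by (intro ext) (auto simp: bsat_def)
  with * show "(\<forall>a. a \<notin> {7, 8, 9, 10, 11, 12, 13, 14, 15} \<longrightarrow> R' a = R a) \<and> R' 15 = tbl (bsat k F)"
    by simp
qed (use R in \<open>simp_all add: env_def clause_pos_def tbl_False\<close>)

end

section \<open>Writing the edge list into memory\<close>

section \<open>Writing the network\<close>

definition emit :: "expr \<Rightarrow> com" where
  "emit e = Seq (Write 20 (reg 17) e) (setr 17 (reg 17 \<oplus> Const 1))"

definition emit3 :: "expr \<Rightarrow> expr \<Rightarrow> expr \<Rightarrow> com" where
  "emit3 e1 e2 e3 = Seq (emit e1) (Seq (emit e2) (emit e3))"

lemma lrun_Seq:
  assumes "lrun L c1 M Q1" "\<And>M'. Q1 M' \<Longrightarrow> lrun L c2 M' Q"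
  shows "lrun L (Seq c1 c2) M Q"
  by (rule run_Seq[OF assms]) (simp_all add: algebra_simps)

lemma run_Seq_add:
  "run c1 M T1 Q1 \<Longrightarrow> (\<And>M'. Q1 M' \<Longrightarrow> run c2 M' T2 Q) \<Longrightarrow> run (Seq c1 c2) M (T1 + T2) Q"
  by (rule run_Seq[where ?Q1.0 = Q1 and ?T1.0 = T1 and ?T2.0 = T2]) simp_all

lemma lrun_emit:
  assumes "1 \<le> L" "R 20 = tab xs" "R 17 0 = length xs" "length xs + 1 < 2 ^ L" "fits L e R"
  shows "lrun L (emit e) R (\<lambda>R'. (\<forall>a. a \<notin> {17, 20} \<longrightarrow> R' a = R a) \<and>
    R' 20 = tab (xs @ [val e R]) \<and> R' 17 0 = length (xs @ [val e R]))"
  unfolding emit_def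
proof (intro lrun_Write_Seq lrun_Write assms(1))
  have "(1::nat) < 2 ^ L" using assms(4) by linarith
  then show "fits L (reg 17) R" "fits L (Const 0) R'"
    "fits L (reg 17 \<oplus> Const 1) (R(20 := (R 20)(val (reg 17) R := val e R)))" for R'
    using assms by simp_all
qed (use assms in \<open>simp_all add: tab_snoc[symmetric]\<close>)

lemma lrun_emit3:
  assumes L: "1 \<le> L" and R: "R 20 = tab xs" "R 17 0 = length xs" "length xs + 3 < 2 ^ L"
    and e: "\<And>R'. \<forall>a. a \<notin> {17, 20} \<longrightarrow> R' a = R a \<Longrightarrow> fits L e1 R' \<and> val e1 R' = v1 \<and>
      fits L e2 R' \<and> val e2 R' = v2 \<and> fits L e3 R' \<and> val e3 R' = v3"
  shows "lrun L (emit3 e1 e2 e3) R (\<lambda>R'. (\<forall>a. a \<notin> {17, 20} \<longrightarrow> R' a = R a) \<and>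
    R' 20 = tab (xs @ [v1, v2, v3]) \<and> R' 17 0 = length (xs @ [v1, v2, v3]))"
  unfolding emit3_def
proof (rule lrun_Seq[OF lrun_emit[OF L R(1,2)]])
  show "length xs + 1 < 2 ^ L" "fits L e1 R" using R e[of R] by simp_all
  fix R1 :: mem
  assume R1: "(\<forall>a. a \<notin> {17, 20} \<longrightarrow> R1 a = R a) \<and> R1 20 = tab (xs @ [val e1 R]) \<and>
    R1 17 0 = length (xs @ [val e1 R])"
  then have 1: "R1 20 = tab (xs @ [v1])" "R1 17 0 = length (xs @ [v1])" using e[of R] by simp_all
  show "lrun L (Seq (emit e2) (emit e3)) R1 (\<lambda>R'. (\<forall>a. a \<notin> {17, 20} \<longrightarrow> R' a = R a) \<and>
    R' 20 = tab (xs @ [v1, v2, v3]) \<and> R' 17 0 = length (xs @ [v1, v2, v3]))"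
  proof (rule lrun_Seq[OF lrun_emit[OF L 1]])
    show "length (xs @ [v1]) + 1 < 2 ^ L" "fits L e2 R1" using R R1 e[of R1] by simp_all
    fix R2 :: mem
    assume R2: "(\<forall>a. a \<notin> {17, 20} \<longrightarrow> R2 a = R1 a) \<and> R2 20 = tab ((xs @ [v1]) @ [val e2 R1]) \<and>
      R2 17 0 = length ((xs @ [v1]) @ [val e2 R1])"
    then have 2: "R2 20 = tab (xs @ [v1, v2])" "R2 17 0 = length (xs @ [v1, v2])"
      using R1 e[of R1] by simp_all
    have e3: "fits L e3 R2" "val e3 R2 = v3" using R1 R2 e[of R2] by simp_all
    show "lrun L (emit e3) R2 (\<lambda>R'. (\<forall>a. a \<notin> {17, 20} \<longrightarrow> R' a = R a) \<and>
      R' 20 = tab (xs @ [v1, v2, v3]) \<and> R' 17 0 = length (xs @ [v1, v2, v3]))"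
      by (rule run_mono[OF lrun_emit[OF L 2]]) (use R R1 R2 e3 in simp_all)
  qed
qed

text \<open>The loop leaves all arrays below 16 alone, so the hypotheses on the expressions can be
  stated for any memory that agrees with \<open>R\<close> there.\<close>

lemma run_emit_loop:
  assumes L: "1 \<le> L" and R: "R 20 = tab xs" "R 17 0 = length xs"
    and less: "length xs + 3 * cnt < 2 ^ L"
    and b: "\<And>R'. \<forall>a<16. R' a = R a \<Longrightarrow> fits L b R' \<and> val b R' = cnt"
    and e: "\<And>l R'. \<forall>a<16. R' a = R a \<Longrightarrow> R' 16 0 = l \<Longrightarrow> l < cnt \<Longrightarrow>
      fits L e1 R' \<and> val e1 R' = f1 l \<and> fits L e2 R' \<and> val e2 R' = f2 l \<and> fits L e3 R' \<and> val e3 R' = f3 l"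
  shows "run (For 16 b (emit3 e1 e2 e3)) R ((cnt + 1) * (L * (tcost (emit3 e1 e2 e3) + fcost 16 b)))
    (\<lambda>R'. (\<forall>a. a \<notin> {16, 17, 20} \<longrightarrow> R' a = R a) \<and>
      R' 20 = tab (xs @ concat (map (\<lambda>l. [f1 l, f2 l, f3 l]) [0..<cnt])) \<and>
      R' 17 0 = length (xs @ concat (map (\<lambda>l. [f1 l, f2 l, f3 l]) [0..<cnt])))"
proof -
  let ?ys = "\<lambda>l. xs @ concat (map (\<lambda>l. [f1 l, f2 l, f3 l]) [0..<l])"
  have len: "length (?ys l) = length xs + 3 * l" for l by (induction l) simp_all
  show ?thesis
  proof (rule run_For[where L = L and N = cnt and ?T1.0 = "L * tcost (emit3 e1 e2 e3)" and
      I = "\<lambda>l R'. (\<forall>a. a \<notin> {16, 17, 20} \<longrightarrow> R' a = R a) \<and> R' 20 = tab (?ys l) \<and> R' 17 0 = length (?ys l)"])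
    show "cnt < 2 ^ L" using less by linarith
  next
    fix l :: nat and R' :: mem
    assume *: "(\<forall>a. a \<notin> {16, 17, 20} \<longrightarrow> R' a = R a) \<and> R' 20 = tab (?ys l) \<and> R' 17 0 = length (?ys l)"
      "l \<le> cnt" "R' 16 0 = l"
    then show "val b R' = cnt \<and> fits L b R'" using b[of R'] by simp
  next
    fix l :: nat and R' :: mem
    assume *: "(\<forall>a. a \<notin> {16, 17, 20} \<longrightarrow> R' a = R a) \<and> R' 20 = tab (?ys l) \<and> R' 17 0 = length (?ys l)"
      "l < cnt" "R' 16 0 = l"
    have "lrun L (emit3 e1 e2 e3) R' (\<lambda>R''. (\<forall>a. a \<notin> {17, 20} \<longrightarrow> R'' a = R' a) \<and>
      R'' 20 = tab (?ys l @ [f1 l, f2 l, f3 l]) \<and> R'' 17 0 = length (?ys l @ [f1 l, f2 l, f3 l]))"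
    proof (rule lrun_emit3[OF L])
      show "R' 20 = tab (?ys l)" "R' 17 0 = length (?ys l)" using * by simp_all
      show "length (?ys l) + 3 < 2 ^ L" unfolding len using less *(2) by simp
      fix R'' :: mem assume "\<forall>a. a \<notin> {17, 20} \<longrightarrow> R'' a = R' a"
      then show "fits L e1 R'' \<and> val e1 R'' = f1 l \<and> fits L e2 R'' \<and> val e2 R'' = f2 l \<and> fits L e3 R'' \<and> val e3 R'' = f3 l"
        using * by (intro e) simp_all
    qed
    then show "lrun L (emit3 e1 e2 e3) R' (\<lambda>R''. R'' 16 0 = l \<and>
      (\<forall>a. a \<notin> {16, 17, 20} \<longrightarrow> (R''(16 := (R'' 16)(0 := Suc l))) a = R a) \<and>
      (R''(16 := (R'' 16)(0 := Suc l))) 20 = tab (?ys (Suc l)) \<and>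
      (R''(16 := (R'' 16)(0 := Suc l))) 17 0 = length (?ys (Suc l)))"
      by (rule run_mono) (use * in simp_all)
  qed (use L R in \<open>simp_all add: algebra_simps\<close>)
qed

abbreviation "sat_at y c \<equiv> Read 15 (y \<otimes> reg 4 \<oplus> c)"

abbreviation "idx_c \<equiv> reg 16 \<odot> reg 4"
abbreviation "idx_i \<equiv> reg 16 \<oslash> reg 4"
text \<open>The second summand is 1 iff \<open>M + j \<le> c\<close>, with \<open>j\<close> the
  number of active dummies of the source. The summands are never both 1, since \<open>bsat\<close>
  requires \<open>c < M\<close>; so the sum is again a truth value.\<close>

abbreviation "src_sat_expr \<equiv> sat_at (idx_i \<odot> reg 5) idx_c \<oplus>
  (Const 1 \<ominus> ((reg 3 \<oplus> idx_i \<oslash> reg 5) \<ominus> idx_c))"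

definition bound_A where "bound_A = (reg 3 \<oplus> Const 2) \<otimes> reg 5 \<otimes> reg 4"
definition bound_C where "bound_C = reg 5 \<otimes> reg 4"

text \<open>Here the numbering of the node kinds pays off: a truth value \<open>s\<close> selects an
  endpoint without branching. \<open>8 * c + s\<close> is \<open>C\<^sub>c\<close> or
  \<open>D\<^sub>c\<close>; \<open>8 * c + 1 + s\<close> is \<open>D\<^sub>c\<close> or
  \<open>Z\<^sub>c\<close>; \<open>8 * c + 2 * s\<close> is \<open>C\<^sub>c\<close> or
  \<open>Z\<^sub>c\<close>; \<open>8 * c + 1 + 2 * s\<close> is \<open>D\<^sub>c\<close> or
  \<open>Y\<^sub>c\<close>.\<close>

definition body_A where
  "body_A = emit3 (Const 8 \<otimes> idx_i \<oplus> Const 4) (Const 8 \<otimes> idx_c \<oplus> src_sat_expr) (reg 5)"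
definition body_G where
  "body_G = emit3 (Const 8 \<otimes> idx_c \<oplus> (Const 1 \<oplus> sat_at (Const 2 \<otimes> reg 5 \<oplus> idx_i) idx_c))
     (Const 8 \<otimes> idx_i \<oplus> Const 7) (reg 5)"
definition body_in where
  "body_in = emit3 (Const 8 \<otimes> idx_c \<oplus> Const 2 \<otimes> sat_at (reg 5 \<oplus> idx_i) idx_c)
     (Const 8 \<otimes> idx_i \<oplus> Const 5) (Const 1)"
definition body_out where
  "body_out = emit3 (Const 8 \<otimes> idx_i \<oplus> Const 6)
     (Const 8 \<otimes> idx_c \<oplus> (Const 1 \<oplus> Const 2 \<otimes> sat_at (reg 5 \<oplus> idx_i) idx_c)) (Const 1)"
definition body_B where
  "body_B = emit3 (Const 8 \<otimes> reg 16 \<oplus> Const 5) (Const 8 \<otimes> reg 16 \<oplus> Const 6) (reg 3 \<oplus> Const 1)"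

text \<open>Array 19 is emitted twice because the network has as many edges as nodes. The order of
  the loops is that of \<open>edges\<close>.\<close>

definition write_net :: com where
  "write_net = Seq (Seq (emit (reg 19)) (emit (reg 19)))
     (Seq (For 16 bound_A body_A) (Seq (For 16 bound_C body_G) (Seq (For 16 bound_C body_in)
       (Seq (For 16 bound_C body_out) (For 16 (reg 5) body_B)))))"

context formula_machine
begin

abbreviation triples :: "(nat \<times> nat) list \<Rightarrow> nat list" where
  "triples es \<equiv> concat (map (\<lambda>e. [fst e, snd e, cap e]) es)"

lemma length_triples: "length (triples es) = 3 * length es"
  by (induction es) simp_all

lemma triples_map: "triples (map f xs) = concat (map (\<lambda>l. [fst (f l), snd (f l), cap (f l)]) xs)"
  by (induction xs) simp_all

definition K_emit where "K_emit = tcost (Seq (emit (reg 19)) (emit (reg 19))) + tcost body_A + fcost 16 bound_A +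
  tcost body_G + fcost 16 bound_C + tcost body_in + tcost body_out + tcost body_B + fcost 16 (reg 5)"

lemma run_emit_edges:
  assumes R: "R 20 = tab xs" "R 17 0 = length xs" "length xs + 3 * cnt \<le> 3 * N + 2"
    and b: "\<And>R'. \<forall>a<16. R' a = R a \<Longrightarrow> fits L b R' \<and> val b R' = cnt"
    and e: "\<And>l R'. \<forall>a<16. R' a = R a \<Longrightarrow> R' 16 0 = l \<Longrightarrow> l < cnt \<Longrightarrow>
      fits L e1 R' \<and> val e1 R' = fst (f l) \<and> fits L e2 R' \<and> val e2 R' = snd (f l) \<and>
      fits L e3 R' \<and> val e3 R' = cap (f l)"
    and K: "tcost (emit3 e1 e2 e3) + fcost 16 b \<le> K_emit" "cnt \<le> N"
  shows "run (For 16 b (emit3 e1 e2 e3)) R ((N + 1) * (L * K_emit))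
    (\<lambda>R'. (\<forall>a. a \<notin> {16, 17, 20} \<longrightarrow> R' a = R a) \<and>
      R' 20 = tab (xs @ triples (map f [0..<cnt])) \<and>
      R' 17 0 = length (xs @ triples (map f [0..<cnt])))"
  unfolding triples_map
proof (rule run_mono[OF run_emit_loop[where L = L and xs = xs and cnt = cnt]])
  have "3 * N + 2 \<le> 4 * N * Q"
  proof -
    have "3 * N + 2 \<le> 4 * N" using N_ge(1) by (simp add: m1_def)
    also have "\<dots> \<le> 4 * N * Q" using Q_ge by simp
    finally show ?thesis .
  qed
  then show "length xs + 3 * cnt < 2 ^ L" using R(3) by (intro less_L) linarith
  show "(cnt + 1) * (L * (tcost (emit3 e1 e2 e3) + fcost 16 b)) \<le> (N + 1) * (L * K_emit)"
    using K by (intro mult_le_mono) simp_all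
qed (use L_ge R b e in \<open>simp_all\<close>)

text \<open>The sizes of the five blocks of edges; they keep the writing position at most
  \<open>3 * N + 2\<close>.\<close>

lemma N_split: "N = (M + 2) * Q * m1 + (Q * m1 + (Q * m1 + (Q * m1 + Q)))"
  unfolding N_eq by (simp add: algebra_simps)

lemma bound_le: "(M + 2) * Q * m1 \<le> N" "Q * m1 \<le> N" "Q \<le> N"
  unfolding N_split by simp_all

definition ready :: "mem \<Rightarrow> bool" where
  "ready R \<longleftrightarrow> env R \<and> R 15 = tbl (bsat k F)"

lemma ready_regs:
  assumes "ready R" "\<forall>a<16. R' a = R a"
  shows "R' 3 0 = M" "R' 4 0 = m1" "R' 5 0 = Q" "R' 15 = tbl (bsat k F)"
  using assms by (simp_all add: ready_def env_def)

lemma bound_A: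
  assumes "ready R" "\<forall>a<16. R' a = R a"
  shows "fits L bound_A R' \<and> val bound_A R' = (M + 2) * Q * m1"
  using ready_regs[OF assms] by (simp add: bound_A_def)

lemma bound_C:
  assumes "ready R" "\<forall>a<16. R' a = R a"
  shows "fits L bound_C R' \<and> val bound_C R' = Q * m1"
  using ready_regs[OF assms] by (simp add: bound_C_def)

lemma m1_pos: "0 < m1"
  by (simp add: m1_def)

lemma tbl_bsat: "y < 3 * Q \<Longrightarrow> tbl (bsat k F) (y * m1 + l mod m1) = of_bool (bsat k F y (l mod m1))"
  using m1_pos by (simp add: tbl_at)

lemma run_A:
  assumes R: "ready R" "R 20 = tab xs" "R 17 0 = length xs" "length xs + 3 * ((M + 2) * Q * m1) \<le> 3 * N + 2"
  shows "run (For 16 bound_A body_A) R ((N + 1) * (L * K_emit))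
    (\<lambda>R'. (\<forall>a. a \<notin> {16, 17, 20} \<longrightarrow> R' a = R a) \<and>
      R' 20 = tab (xs @ triples (pairs ((M + 2) * Q) edge_A)) \<and>
      R' 17 0 = length (xs @ triples (pairs ((M + 2) * Q) edge_A)))"
  unfolding body_A_def pairs_def
proof (rule run_emit_edges[OF R(2-4) bound_A[OF R(1)]])
  fix l :: nat and R' :: mem
  assume *: "\<forall>a<16. R' a = R a" "R' 16 0 = l" "l < (M + 2) * Q * m1"
  note regs = ready_regs[OF R(1) *(1)]
  let ?i = "l div m1" and ?c = "l mod m1"
  have l: "l < 2 ^ L" using *(3) bound_le(1) by (intro NQ(1)) linarith
  have "?i mod Q < Q" using Q_ge by simp
  then have "?i mod Q < 3 * Q" by simp
  from tbl_bsat[OF this] have t: "tbl (bsat k F) (?i mod Q * m1 + ?c) = of_bool (bsat k F (?i mod Q) ?c)" .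
  have "bsat k F (?i mod Q) ?c \<Longrightarrow> ?c < M" by (simp add: bsat_def)
  then have "of_bool (bsat k F (?i mod Q) ?c) + (1 - (M + ?i div Q - ?c)) = (if src_sat ?i ?c then 1 else 0)"
    unfolding src_sat_def by (cases "bsat k F (?i mod Q) ?c"; cases "M + ?i div Q \<le> ?c") simp_all
  with t have s: "val src_sat_expr R' = (if src_sat ?i ?c then 1 else 0)"
    using regs *(2) by simp
  show "fits L (Const 8 \<otimes> idx_i \<oplus> Const 4) R' \<and> val (Const 8 \<otimes> idx_i \<oplus> Const 4) R' = fst (edge_A ?i ?c) \<and>
    fits L (Const 8 \<otimes> idx_c \<oplus> src_sat_expr) R' \<and> val (Const 8 \<otimes> idx_c \<oplus> src_sat_expr) R' = snd (edge_A ?i ?c) \<and>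
    fits L (reg 5) R' \<and> val (reg 5) R' = cap (edge_A ?i ?c)"
  proof (intro conjI)
    show "val (reg 5) R' = cap (edge_A ?i ?c)" unfolding cap_simps using regs by simp
    have "val (Const 8 \<otimes> idx_c \<oplus> src_sat_expr) R' = 8 * ?c + val src_sat_expr R'"
      using regs *(2) by simp
    then show "val (Const 8 \<otimes> idx_c \<oplus> src_sat_expr) R' = snd (edge_A ?i ?c)"
      unfolding s by (simp add: edge_A_def nd_def)
  qed (use regs * l in \<open>simp_all add: edge_A_def nd_def\<close>)
qed (simp_all add: K_emit_def bound_le[simplified] body_A_def)

lemma run_G:
  assumes R: "ready R" "R 20 = tab xs" "R 17 0 = length xs" "length xs + 3 * (Q * m1) \<le> 3 * N + 2"
  shows "run (For 16 bound_C body_G) R ((N + 1) * (L * K_emit))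
    (\<lambda>R'. (\<forall>a. a \<notin> {16, 17, 20} \<longrightarrow> R' a = R a) \<and>
      R' 20 = tab (xs @ triples (pairs Q edge_G)) \<and>
      R' 17 0 = length (xs @ triples (pairs Q edge_G)))"
  unfolding body_G_def pairs_def
proof (rule run_emit_edges[OF R(2-4) bound_C[OF R(1)]])
  fix l :: nat and R' :: mem
  assume *: "\<forall>a<16. R' a = R a" "R' 16 0 = l" "l < Q * m1"
  note regs = ready_regs[OF R(1) *(1)]
  let ?i = "l div m1" and ?c = "l mod m1"
  have l: "l < 2 ^ L" using *(3) bound_le(2) by (intro NQ(1)) linarith
  have "?i < Q" using *(3) by (simp add: less_mult_imp_div_less)
  then have "2 * Q + ?i < 3 * Q" by simp
  from tbl_bsat[OF this] have t: "tbl (bsat k F) ((2 * Q + ?i) * m1 + ?c) = of_bool (bsat k F (2 * Q + ?i) ?c)" .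
  show "fits L (Const 8 \<otimes> idx_c \<oplus> (Const 1 \<oplus> sat_at (Const 2 \<otimes> reg 5 \<oplus> idx_i) idx_c)) R' \<and> val (Const 8 \<otimes> idx_c \<oplus> (Const 1 \<oplus> sat_at (Const 2 \<otimes> reg 5 \<oplus> idx_i) idx_c)) R' = fst (edge_G ?i ?c) \<and>
    fits L (Const 8 \<otimes> idx_i \<oplus> Const 7) R' \<and> val (Const 8 \<otimes> idx_i \<oplus> Const 7) R' = snd (edge_G ?i ?c) \<and>
    fits L (reg 5) R' \<and> val (reg 5) R' = cap (edge_G ?i ?c)"
  proof (intro conjI)
    show "val (reg 5) R' = cap (edge_G ?i ?c)" unfolding cap_simps using regs by simp
    show "val (Const 8 \<otimes> idx_c \<oplus> (Const 1 \<oplus> sat_at (Const 2 \<otimes> reg 5 \<oplus> idx_i) idx_c)) R' = fst (edge_G ?i ?c)" "val (Const 8 \<otimes> idx_i \<oplus> Const 7) R' = snd (edge_G ?i ?c)"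
      using regs *(2) t by (simp_all add: edge_G_def nd_def)
  qed (use regs * l in \<open>simp_all\<close>)
qed (simp_all add: K_emit_def bound_le body_G_def)

lemma run_in:
  assumes R: "ready R" "R 20 = tab xs" "R 17 0 = length xs" "length xs + 3 * (Q * m1) \<le> 3 * N + 2"
  shows "run (For 16 bound_C body_in) R ((N + 1) * (L * K_emit))
    (\<lambda>R'. (\<forall>a. a \<notin> {16, 17, 20} \<longrightarrow> R' a = R a) \<and>
      R' 20 = tab (xs @ triples (pairs Q edge_in)) \<and>
      R' 17 0 = length (xs @ triples (pairs Q edge_in)))"
  unfolding body_in_def pairs_def
proof (rule run_emit_edges[OF R(2-4) bound_C[OF R(1)]])
  fix l :: nat and R' :: mem
  assume *: "\<forall>a<16. R' a = R a" "R' 16 0 = l" "l < Q * m1"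
  note regs = ready_regs[OF R(1) *(1)]
  let ?i = "l div m1" and ?c = "l mod m1"
  have l: "l < 2 ^ L" using *(3) bound_le(2) by (intro NQ(1)) linarith
  have "?i < Q" using *(3) by (simp add: less_mult_imp_div_less)
  then have "Q + ?i < 3 * Q" by simp
  from tbl_bsat[OF this] have t: "tbl (bsat k F) ((Q + ?i) * m1 + ?c) = of_bool (bsat k F (Q + ?i) ?c)" .
  show "fits L (Const 8 \<otimes> idx_c \<oplus> Const 2 \<otimes> sat_at (reg 5 \<oplus> idx_i) idx_c) R' \<and> val (Const 8 \<otimes> idx_c \<oplus> Const 2 \<otimes> sat_at (reg 5 \<oplus> idx_i) idx_c) R' = fst (edge_in ?i ?c) \<and>
    fits L (Const 8 \<otimes> idx_i \<oplus> Const 5) R' \<and> val (Const 8 \<otimes> idx_i \<oplus> Const 5) R' = snd (edge_in ?i ?c) \<and>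
    fits L (Const 1) R' \<and> val (Const 1) R' = cap (edge_in ?i ?c)"
  proof (intro conjI)
    show "val (Const 1) R' = cap (edge_in ?i ?c)" unfolding cap_simps using regs by simp
    show "val (Const 8 \<otimes> idx_c \<oplus> Const 2 \<otimes> sat_at (reg 5 \<oplus> idx_i) idx_c) R' = fst (edge_in ?i ?c)" "val (Const 8 \<otimes> idx_i \<oplus> Const 5) R' = snd (edge_in ?i ?c)"
      using regs *(2) t by (simp_all add: edge_in_def nd_def)
  qed (use regs * l in \<open>simp_all\<close>)
qed (simp_all add: K_emit_def bound_le body_in_def)

lemma run_out:
  assumes R: "ready R" "R 20 = tab xs" "R 17 0 = length xs" "length xs + 3 * (Q * m1) \<le> 3 * N + 2"
  shows "run (For 16 bound_C body_out) R ((N + 1) * (L * K_emit))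
    (\<lambda>R'. (\<forall>a. a \<notin> {16, 17, 20} \<longrightarrow> R' a = R a) \<and>
      R' 20 = tab (xs @ triples (pairs Q edge_out)) \<and>
      R' 17 0 = length (xs @ triples (pairs Q edge_out)))"
  unfolding body_out_def pairs_def
proof (rule run_emit_edges[OF R(2-4) bound_C[OF R(1)]])
  fix l :: nat and R' :: mem
  assume *: "\<forall>a<16. R' a = R a" "R' 16 0 = l" "l < Q * m1"
  note regs = ready_regs[OF R(1) *(1)]
  let ?i = "l div m1" and ?c = "l mod m1"
  have l: "l < 2 ^ L" using *(3) bound_le(2) by (intro NQ(1)) linarith
  have "?i < Q" using *(3) by (simp add: less_mult_imp_div_less)
  then have "Q + ?i < 3 * Q" by simp
  from tbl_bsat[OF this] have t: "tbl (bsat k F) ((Q + ?i) * m1 + ?c) = of_bool (bsat k F (Q + ?i) ?c)" .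
  show "fits L (Const 8 \<otimes> idx_i \<oplus> Const 6) R' \<and> val (Const 8 \<otimes> idx_i \<oplus> Const 6) R' = fst (edge_out ?i ?c) \<and>
    fits L (Const 8 \<otimes> idx_c \<oplus> (Const 1 \<oplus> Const 2 \<otimes> sat_at (reg 5 \<oplus> idx_i) idx_c)) R' \<and> val (Const 8 \<otimes> idx_c \<oplus> (Const 1 \<oplus> Const 2 \<otimes> sat_at (reg 5 \<oplus> idx_i) idx_c)) R' = snd (edge_out ?i ?c) \<and>
    fits L (Const 1) R' \<and> val (Const 1) R' = cap (edge_out ?i ?c)"
  proof (intro conjI)
    show "val (Const 1) R' = cap (edge_out ?i ?c)" unfolding cap_simps using regs by simp
    show "val (Const 8 \<otimes> idx_i \<oplus> Const 6) R' = fst (edge_out ?i ?c)" "val (Const 8 \<otimes> idx_c \<oplus> (Const 1 \<oplus> Const 2 \<otimes> sat_at (reg 5 \<oplus> idx_i) idx_c)) R' = snd (edge_out ?i ?c)"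
      using regs *(2) t by (simp_all add: edge_out_def nd_def)
  qed (use regs * l in \<open>simp_all\<close>)
qed (simp_all add: K_emit_def bound_le body_out_def)

lemma run_B:
  assumes R: "ready R" "R 20 = tab xs" "R 17 0 = length xs" "length xs + 3 * Q \<le> 3 * N + 2"
  shows "run (For 16 (reg 5) body_B) R ((N + 1) * (L * K_emit))
    (\<lambda>R'. (\<forall>a. a \<notin> {16, 17, 20} \<longrightarrow> R' a = R a) \<and>
      R' 20 = tab (xs @ triples (map edge_B [0..<Q])) \<and>
      R' 17 0 = length (xs @ triples (map edge_B [0..<Q])))"
  unfolding body_B_def
proof (rule run_emit_edges[OF R(2-4)])
  fix R' :: mem assume "\<forall>a<16. R' a = R a"
  then show "fits L (reg 5) R' \<and> val (reg 5) R' = Q" using ready_regs[OF R(1)] by simp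
next
  fix l :: nat and R' :: mem
  assume *: "\<forall>a<16. R' a = R a" "R' 16 0 = l" "l < Q"
  have l: "l < 2 ^ L" using *(3) by (intro NQ(2)) simp
  show "fits L (Const 8 \<otimes> reg 16 \<oplus> Const 5) R' \<and> val (Const 8 \<otimes> reg 16 \<oplus> Const 5) R' = fst (edge_B l) \<and>
    fits L (Const 8 \<otimes> reg 16 \<oplus> Const 6) R' \<and> val (Const 8 \<otimes> reg 16 \<oplus> Const 6) R' = snd (edge_B l) \<and>
    fits L (reg 3 \<oplus> Const 1) R' \<and> val (reg 3 \<oplus> Const 1) R' = cap (edge_B l)"
  proof (intro conjI)
    show "val (reg 3 \<oplus> Const 1) R' = cap (edge_B l)" unfolding cap_simps
      using ready_regs[OF R(1) *(1)] by simp
    show "val (Const 8 \<otimes> reg 16 \<oplus> Const 5) R' = fst (edge_B l)" "val (Const 8 \<otimes> reg 16 \<oplus> Const 6) R' = snd (edge_B l)"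
      using *(2) by (simp_all add: edge_B_def nd_def)
  qed (use ready_regs[OF R(1) *(1)] * l in \<open>simp_all\<close>)
qed (simp_all add: K_emit_def bound_le body_B_def)

lemma ready_cong: "ready R \<Longrightarrow> \<forall>a. a \<notin> {16, 17, 20} \<longrightarrow> R' a = R a \<Longrightarrow> ready R'"
  by (simp add: ready_def env_def)

lemma run_write_net:
  assumes R: "ready R" "R 17 0 = 0" "R 20 = (\<lambda>_. 0)"
  shows "run write_net R (6 * ((N + 1) * (L * K_emit)))
    (\<lambda>R'. (\<forall>a. a \<notin> {16, 17, 20} \<longrightarrow> R' a = R a) \<and> R' 20 = tab (encode_network N edges cap))"
proof -
  let ?T = "(N + 1) * (L * K_emit)"
  let ?P = "\<lambda>xs R'. (\<forall>a. a \<notin> {16, 17, 20} \<longrightarrow> R' a = R a) \<and> R' 20 = tab xs \<and> R' 17 0 = length xs"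
  define x1 where "x1 = [N, N] @ triples (pairs ((M + 2) * Q) edge_A)"
  define x2 where "x2 = x1 @ triples (pairs Q edge_G)"
  define x3 where "x3 = x2 @ triples (pairs Q edge_in)"
  define x4 where "x4 = x3 @ triples (pairs Q edge_out)"
  define x5 where "x5 = x4 @ triples (map edge_B [0..<Q])"
  have len: "length x1 = 2 + 3 * ((M + 2) * Q * m1)" "length x2 = length x1 + 3 * (Q * m1)"
    "length x3 = length x2 + 3 * (Q * m1)" "length x4 = length x3 + 3 * (Q * m1)"
    "length x5 = length x4 + 3 * Q"
    unfolding x1_def x2_def x3_def x4_def x5_def length_append length_triples
    by (simp_all add: pairs_def)
  have x5: "x5 = encode_network N edges cap"
  proof -
    have "encode_network N edges cap = [N, N] @ triples edges"
      by (simp only: encode_network_def N_def append.simps)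
    also have "\<dots> = x5"
      unfolding x1_def x2_def x3_def x4_def x5_def
      by (simp only: edges_def map_append concat_append append_assoc)
    finally show ?thesis ..
  qed
  have 0: "run (Seq (emit (reg 19)) (emit (reg 19))) R ?T (?P [N, N])"
  proof (rule run_mono[OF lrun_Seq[OF lrun_emit[where L = L and xs = "[]"]]])
    fix R1 :: mem
    assume R1: "(\<forall>a. a \<notin> {17, 20} \<longrightarrow> R1 a = R a) \<and> R1 20 = tab ([] @ [val (reg 19) R]) \<and>
      R1 17 0 = length ([] @ [val (reg 19) R])"
    show "lrun L (emit (reg 19)) R1 (?P [N, N])"
      by (rule run_mono[OF lrun_emit[where L = L and xs = "[N]"]])
        (use R R1 in \<open>simp_all add: ready_def env_def numeral_2_eq_2[symmetric]\<close>)
    next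
    have "1 * (L * tcost (Seq (emit (reg 19)) (emit (reg 19)))) \<le> ?T"
      by (intro mult_le_mono) (simp_all add: K_emit_def)
    then show "L * tcost (Seq (emit (reg 19)) (emit (reg 19))) \<le> ?T" by simp
  qed (use R in \<open>simp_all add: ready_def env_def tab_Nil\<close>)
  have step: "run c R' ?T (?P ys)" if "?P xs R'"
    and "run c R' ?T (\<lambda>R''. (\<forall>a. a \<notin> {16, 17, 20} \<longrightarrow> R'' a = R' a) \<and> R'' 20 = tab ys \<and> R'' 17 0 = length ys)"
    for c R' xs ys
    by (rule run_mono[OF that(2)]) (use that(1) in simp_all)
  have 1: "run (For 16 bound_A body_A) R' ?T (?P x1)" if "?P [N, N] R'" for R'
    unfolding x1_def by (rule step[OF that run_A]) (use that R(1) in \<open>simp_all add: ready_cong N_split\<close>)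
  have 2: "run (For 16 bound_C body_G) R' ?T (?P x2)" if "?P x1 R'" for R'
    unfolding x2_def by (rule step[OF that run_G]) (use that R(1) len in \<open>simp_all add: ready_cong N_split\<close>)
  have 3: "run (For 16 bound_C body_in) R' ?T (?P x3)" if "?P x2 R'" for R'
    unfolding x3_def by (rule step[OF that run_in]) (use that R(1) len in \<open>simp_all add: ready_cong N_split\<close>)
  have 4: "run (For 16 bound_C body_out) R' ?T (?P x4)" if "?P x3 R'" for R'
    unfolding x4_def by (rule step[OF that run_out]) (use that R(1) len in \<open>simp_all add: ready_cong N_split\<close>)
  have 5: "run (For 16 (reg 5) body_B) R' ?T (?P x5)" if "?P x4 R'" for R'
    unfolding x5_def by (rule step[OF that run_B]) (use that R(1) len in \<open>simp_all add: ready_cong N_split\<close>)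
  have "run write_net R (?T + (?T + (?T + (?T + (?T + ?T))))) (?P x5)"
    unfolding write_net_def
    by (rule run_Seq_add[OF 0], erule run_Seq_add[OF 1], erule run_Seq_add[OF 2],
        erule run_Seq_add[OF 3], erule run_Seq_add[OF 4], erule 5)
  then show ?thesis by (rule run_mono) (simp_all add: x5)
qed

end

section \<open>Extracting the maximum from the table of flows\<close>

section \<open>Reading off the answer\<close>

text \<open>Array 21 is the output array of the max-flow program shifted by 20; the address is row
  \<open>nd 4 i\<close>, column \<open>nd 7 g\<close> of its table.\<close>

abbreviation "flow_expr e \<equiv>
  Read 21 ((Const 8 \<otimes> e \<oplus> Const 4) \<otimes> reg 19 \<oplus> (Const 8 \<otimes> (reg 16 \<odot> reg 5) \<oplus> Const 7))"

text \<open>The counter encodes a triple as \<open>(j * Q + x) * Q + g\<close>. Adding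
  \<open>Q\<close> to the source index \<open>j * Q + x\<close> passes from \<open>j\<close> to
  \<open>j + 1\<close>, so the monus is nonzero iff the inequality of \<open>flow_test\<close>
  holds.\<close>

definition out_step :: com where
  "out_step = Cond ((flow_expr (reg 16 \<oslash> reg 5 \<oplus> reg 5) \<oplus> reg 5) \<ominus> flow_expr (reg 16 \<oslash> reg 5))
     (setr 1 (reg 16 \<oslash> reg 5 \<oslash> reg 5)) Skip"

definition out_bound :: expr where
  "out_bound = (reg 3 \<oplus> Const 1) \<otimes> reg 5 \<otimes> reg 5"

definition out_loop :: com where
  "out_loop = For 16 out_bound out_step"

definition max_sat_prog :: "com \<Rightarrow> com" where
  "max_sat_prog P = Seq init (Seq parse (Seq write_net (Seq (shift_com 20 P) out_loop)))"

context formula_machine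
begin

definition K_out where "K_out = tcost out_step + fcost 16 out_bound"

text \<open>Cells that are read must fit into \<open>L\<close> bits; this covers the values
  delivered by the given program.\<close>

lemma flow_le: "flow i g \<le> N"
proof -
  have "card (direct i g) \<le> card {..<m1}" by (intro card_mono) (auto simp: direct_def)
  then have "Q * card (direct i g) \<le> Q * m1" by simp
  moreover have "(\<Sum>b<Q. min (M + 1) (card (unsat i b g))) \<le> (\<Sum>b<Q. M + 1)"
    by (intro sum_mono) simp
  then have "(\<Sum>b<Q. min (M + 1) (card (unsat i b g))) \<le> Q * (M + 1)" by simp
  ultimately have "flow i g \<le> Q * (m1 + (M + 1))"
    unfolding flow_def add_mult_distrib2 by (rule add_mono)
  also have "\<dots> \<le> N" unfolding N_eq by (intro mult_le_mono2) (simp add: m1_def algebra_simps)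
  finally show ?thesis .
qed

definition passes :: "nat \<Rightarrow> bool" where
  "passes s \<longleftrightarrow> flow (s div Q) (s mod Q) < flow (s div Q + Q) (s mod Q) + Q"

lemma passes_iff:
  assumes "s < (M + 1) * Q * Q"
  shows "passes s \<longleftrightarrow> (\<exists>b<Q. s div Q div Q \<le> num_sat (assignment k (s div Q mod Q) b (s mod Q)) F)"
proof -
  let ?j = "s div Q div Q" and ?x = "s div Q mod Q"
  have "s div Q < (M + 1) * Q" using assms by (simp add: less_mult_imp_div_less)
  then have "?j < M + 1" by (simp add: less_mult_imp_div_less)
  moreover have "?x < Q" "s mod Q < Q" using Q_ge by simp_all
  moreover have "s div Q = ?j * Q + ?x" "s div Q + Q = Suc ?j * Q + ?x" by simp_all
  ultimately show ?thesis unfolding passes_def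
    using flow_test[of ?x "s mod Q" ?j] by (metis Suc_eq_plus1 less_Suc_eq_le)
qed

text \<open>The recorded \<open>j\<close> is the leading digit of the counter, which never
  decreases. So every successful test may overwrite register 1, and the last one leaves the largest
  value.\<close>

lemma run_out_loop:
  assumes R: "env R" "R 1 0 = 0"
    and fl: "\<And>i g. i < (M + 2) * Q \<Longrightarrow> g < Q \<Longrightarrow> R 21 (nd 4 i * N + nd 7 g) = flow i g"
  shows "run out_loop R (2 * (N * Q) * (L * K_out)) (\<lambda>R'. (\<forall>a. a \<notin> {1, 16} \<longrightarrow> R' a = R a) \<and> R' 1 0 = max_sat F)"
  unfolding out_loop_def
proof (rule run_For[where L = L and N = "(M + 1) * Q * Q" and ?T1.0 = "L * tcost out_step" and
    I = "\<lambda>t R'. (\<forall>a. a \<notin> {1, 16} \<longrightarrow> R' a = R a) \<and> (\<exists>\<tau>. R' 1 0 \<le> num_sat \<tau> F) \<and>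
      R' 1 0 \<le> t div Q div Q \<and> (\<forall>s<t. passes s \<longrightarrow> s div Q div Q \<le> R' 1 0)"])
  have "(M + 1) * Q \<le> N" using N_ge(2) by (simp add: algebra_simps)
  then have le: "(M + 1) * Q * Q \<le> N * Q" by (rule mult_le_mono1)
  show bL: "(M + 1) * Q * Q < 2 ^ L" by (rule less_L) (use le in linarith)
  have "1 \<le> N * Q" using Q_ge N_ge(4) by simp
  then have "(M + 1) * Q * Q + 1 \<le> 2 * (N * Q)" using le by linarith
  then have "((M + 1) * Q * Q + 1) * (L * K_out) \<le> 2 * (N * Q) * (L * K_out)" by (rule mult_le_mono1)
  then show "((M + 1) * Q * Q + 1) * (L * tcost out_step + L * fcost 16 out_bound) \<le> 2 * (N * Q) * (L * K_out)"
    by (simp add: K_out_def algebra_simps)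
  fix t :: nat and R' :: mem
  assume *: "(\<forall>a. a \<notin> {1, 16} \<longrightarrow> R' a = R a) \<and> (\<exists>\<tau>. R' 1 0 \<le> num_sat \<tau> F) \<and>
      R' 1 0 \<le> t div Q div Q \<and> (\<forall>s<t. passes s \<longrightarrow> s div Q div Q \<le> R' 1 0)"
    "t < (M + 1) * Q * Q" "R' 16 0 = t"
  have regs: "R' 3 0 = M" "R' 5 0 = Q" "R' 19 0 = N" "R' 21 = R 21" using * R by (simp_all add: env_def)
  have tL: "t < 2 ^ L" using *(2) bL by linarith
  have "t div Q < (M + 1) * Q" using *(2) by (simp add: less_mult_imp_div_less)
  then have "t div Q < (M + 2) * Q" "t div Q + Q < (M + 2) * Q" by simp_all
  moreover have "t mod Q < Q" using Q_ge by simp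
  ultimately have f: "R 21 ((8 * (t div Q) + 4) * N + (8 * (t mod Q) + 7)) = flow (t div Q) (t mod Q)"
    "R 21 ((8 * (t div Q + Q) + 4) * N + (8 * (t mod Q) + 7)) = flow (t div Q + Q) (t mod Q)"
    using fl by (simp_all only: nd_def)
  have fL: "flow i g < 2 ^ L" for i g using flow_le by (intro NQ(1))
  have v: "val (flow_expr (reg 16 \<oslash> reg 5)) R' = flow (t div Q) (t mod Q)"
    "val (flow_expr (reg 16 \<oslash> reg 5 \<oplus> reg 5)) R' = flow (t div Q + Q) (t mod Q)"
    using f regs *(3) by simp_all
  let ?b = "(flow_expr (reg 16 \<oslash> reg 5 \<oplus> reg 5) \<oplus> reg 5) \<ominus> flow_expr (reg 16 \<oslash> reg 5)"
  have vb: "val ?b R' \<noteq> 0 \<longleftrightarrow> passes t"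
  proof -
    have "val ?b R' = flow (t div Q + Q) (t mod Q) + Q - flow (t div Q) (t mod Q)"
      using v regs(2) by simp
    then show ?thesis unfolding passes_def by linarith
  qed
  have mono: "t div Q div Q \<le> Suc t div Q div Q" by (intro div_le_mono) simp
  show "lrun L out_step R' (\<lambda>R''. R'' 16 0 = t \<and>
    (\<forall>a. a \<notin> {1, 16} \<longrightarrow> (R''(16 := (R'' 16)(0 := Suc t))) a = R a) \<and>
    (\<exists>\<tau>. (R''(16 := (R'' 16)(0 := Suc t))) 1 0 \<le> num_sat \<tau> F) \<and>
      (R''(16 := (R'' 16)(0 := Suc t))) 1 0 \<le> Suc t div Q div Q \<and>
      (\<forall>s<Suc t. passes s \<longrightarrow> s div Q div Q \<le> (R''(16 := (R'' 16)(0 := Suc t))) 1 0))"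
    unfolding out_step_def
  proof (intro lrun_Cond lrun_Write lrun_Skip L_ge)
    show "fits L ?b R'" using regs f fL tL *(3) by simp
    show "fits L (Const 0) R'" "fits L (reg 16 \<oslash> reg 5 \<oslash> reg 5) R'" using regs tL *(3) by simp_all
  next
    assume "val ?b R' \<noteq> 0"
    then have "passes t" using vb by blast
    then have 1: "\<exists>\<tau>. t div Q div Q \<le> num_sat \<tau> F" using passes_iff[OF *(2)] by blast
    have 2: "s div Q div Q \<le> t div Q div Q" if "s < Suc t" for s
      using that by (intro div_le_mono) simp
    let ?R = "R'(1 := (R' 1)(val (Const 0) R' := val (reg 16 \<oslash> reg 5 \<oslash> reg 5) R'))"
    have 3: "?R 1 0 = t div Q div Q" using regs *(3) by simp
    show "?R 16 0 = t \<and> (\<forall>a. a \<notin> {1, 16} \<longrightarrow> (?R(16 := (?R 16)(0 := Suc t))) a = R a) \<and>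
      (\<exists>\<tau>. (?R(16 := (?R 16)(0 := Suc t))) 1 0 \<le> num_sat \<tau> F) \<and>
      (?R(16 := (?R 16)(0 := Suc t))) 1 0 \<le> Suc t div Q div Q \<and>
      (\<forall>s<Suc t. passes s \<longrightarrow> s div Q div Q \<le> (?R(16 := (?R 16)(0 := Suc t))) 1 0)"
      using 1 2 3 mono * by simp
  next
    assume "val ?b R' = 0"
    then have "\<not> passes t" using vb by blast
    then show "R' 16 0 = t \<and> (\<forall>a. a \<notin> {1, 16} \<longrightarrow> (R'(16 := (R' 16)(0 := Suc t))) a = R a) \<and>
      (\<exists>\<tau>. (R'(16 := (R' 16)(0 := Suc t))) 1 0 \<le> num_sat \<tau> F) \<and>
      (R'(16 := (R' 16)(0 := Suc t))) 1 0 \<le> Suc t div Q div Q \<and>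
      (\<forall>s<Suc t. passes s \<longrightarrow> s div Q div Q \<le> (R'(16 := (R' 16)(0 := Suc t))) 1 0)"
      using * mono by (auto simp: less_Suc_eq)
  qed
next
  fix t :: nat and R' :: mem
  assume "(\<forall>a. a \<notin> {1, 16} \<longrightarrow> R' a = R a) \<and> (\<exists>\<tau>. R' 1 0 \<le> num_sat \<tau> F) \<and>
      R' 1 0 \<le> t div Q div Q \<and> (\<forall>s<t. passes s \<longrightarrow> s div Q div Q \<le> R' 1 0)"
  then show "val out_bound R' = (M + 1) * Q * Q \<and> fits L out_bound R'"
    using R by (simp add: out_bound_def env_def)
next
  fix R' :: mem
  assume *: "(\<forall>a. a \<notin> {1, 16} \<longrightarrow> R' a = R a) \<and> (\<exists>\<tau>. R' 1 0 \<le> num_sat \<tau> F) \<and>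
      R' 1 0 \<le> (M + 1) * Q * Q div Q div Q \<and> (\<forall>s<(M + 1) * Q * Q. passes s \<longrightarrow> s div Q div Q \<le> R' 1 0)"
  then obtain \<tau> where "R' 1 0 \<le> num_sat \<tau> F" by blast
  then have "max_sat F = R' 1 0"
  proof (rule max_sat_eqI[OF cnf n_le])
    fix x b g :: nat assume "x < 2 ^ k" "b < 2 ^ k" "g < 2 ^ k"
    then have x: "x < Q" "b < Q" "g < Q" by (simp_all add: Q_def)
    let ?j = "num_sat (assignment k x b g) F"
    \<comment> \<open>Its own number of satisfied clauses serves as \<open>j\<close>: the test then
      succeeds with \<open>b\<close> as witness. As this number is at most \<open>M\<close>, the
      loop reaches \<open>?s\<close>.\<close>
    let ?s = "(?j * Q + x) * Q + g"
    have d: "?s div Q = ?j * Q + x" "?s mod Q = g" using x by simp_all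
    have d2: "(?j * Q + x) div Q = ?j" "(?j * Q + x) mod Q = x" using x by simp_all
    have "?s < (?j * Q + x + 1) * Q" using x by simp
    also have "\<dots> \<le> ((?j + 1) * Q) * Q" using x by (intro mult_le_mono1) simp
    also have "\<dots> \<le> (M + 1) * Q * Q" using num_sat_le by (intro mult_le_mono1) simp
    finally have s: "?s < (M + 1) * Q * Q" .
    then have "passes ?s" unfolding passes_iff[OF s] d d2 using x by blast
    with * s have "?s div Q div Q \<le> R' 1 0" by blast
    then show "?j \<le> R' 1 0" unfolding d d2 .
  qed
  with * show "(\<forall>a. a \<notin> {1, 16} \<longrightarrow> R' a = R a) \<and> R' 1 0 = max_sat F" by simp
qed (use R L_ge in simp_all)

lemma cap_range: "e \<in> set edges \<Longrightarrow> cap e \<in> {1..N}"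
  using N_ge(4) bound_le(3) Q_ge unfolding cap_def by simp

lemma run_flow_prog:
  assumes P: "solves_all_pairs_max_flow P 1 T"
    and R: "R 20 = tab (encode_network N edges cap)" "\<forall>a>20. R a = (\<lambda>_. 0)"
  shows "run (shift_com 20 P) R (nat \<lfloor>T N N\<rfloor>) (\<lambda>R'. (\<forall>a<20. R' a = R a) \<and>
    (\<forall>i<(M + 2) * Q. \<forall>g<Q. R' 21 (nd 4 i * N + nd 7 g) = flow i g))"
proof -
  let ?ys = "encode_network N edges cap"
  have pc: "parcs (net N) = set edges" "pverts (net N) = {..<N}"
    by (simp_all only: net_def pair_pre_digraph.simps)
  \<comment> \<open>The instance has \<open>N\<close> nodes and \<open>N\<close> edges, hence the
    density bound 1.\<close>
  have "pair_digraph (net N) \<and> pverts (net N) = {..<N} \<and> card (parcs (net N)) = N \<and>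
      0 < N \<and> N \<le> N \<and> N \<le> 1 * N \<and> (\<forall>e\<in>parcs (net N). cap e \<in> {1..N}) \<and>
      distinct edges \<and> set edges = parcs (net N)"
  proof (intro conjI)
    show "card (parcs (net N)) = N" by (simp only: pc distinct_card[OF distinct_edges] N_def[symmetric])
    show "\<forall>e\<in>parcs (net N). cap e \<in> {1..N}" unfolding pc using cap_range by blast
    show "0 < N" using N_ge(4) by simp
  qed (simp_all only: pc pair_digraph_net[OF N_ge(1-3)] distinct_edges mult_1 order_refl)
  with P have "computes_within P ?ys (T N N) (\<lambda>out. \<forall>u\<in>pverts (net N). \<forall>v\<in>pverts (net N). u \<noteq> v \<longrightarrow>
      real (out (u * N + v)) = max_flow (with_proj (net N)) cap u v)"
    unfolding solves_all_pairs_max_flow_def by blast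
  then obtain t R2 where e: "exec P (input_mem ?ys) t R2" "real t \<le> T N N"
    and out: "\<forall>u\<in>pverts (net N). \<forall>v\<in>pverts (net N). u \<noteq> v \<longrightarrow>
      real (R2 1 (u * N + v)) = max_flow (with_proj (net N)) cap u v"
    unfolding computes_within_def by blast
  \<comment> \<open>Array 20 holds the encoded network and the arrays above it are still zero, so
    seen from array 20 on, this is the initial memory of \<open>P\<close>.\<close>
  have R_eq: "R = join_mem 20 R (input_mem ?ys)"
  proof
    fix a show "R a = join_mem 20 R (input_mem ?ys) a"
      using R by (cases "a < 20"; cases "a = 20") (simp_all add: join_mem_def input_mem_eq)
  qed
  have "exec (shift_com 20 P) R t (join_mem 20 R R2)"
    using exec_shift[OF e(1), of 20 R] R_eq by simp
  moreover have "t \<le> nat \<lfloor>T N N\<rfloor>" using e(2) by (rule le_nat_floor)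
  moreover have "join_mem 20 R R2 21 (nd 4 i * N + nd 7 g) = flow i g" if "i < (M + 2) * Q" "g < Q" for i g
  proof -
    have "nd 4 i < N" using nd_less[OF that(1) _ N_ge(2), of 4] by simp
    moreover have "nd 7 g < N" using nd_less[OF that(2) _ N_ge(3), of 7] by simp
    moreover have "nd 4 i \<noteq> nd 7 g" by simp
    ultimately have "real (R2 1 (nd 4 i * N + nd 7 g)) = max_flow (with_proj (net N)) cap (nd 4 i) (nd 7 g)"
      using out unfolding pc by blast
    then show ?thesis unfolding max_flow_eq_flow[OF that] by (simp add: join_mem_def)
  qed
  ultimately show ?thesis unfolding run_def by (intro exI[of _ t] exI[of _ "join_mem 20 R R2"]) (simp add: join_mem_def)
qed

definition K_total where "K_total = K_init + K_parse + 12 * K_emit + 2 * K_out"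

lemma run_max_sat_prog:
  assumes P: "solves_all_pairs_max_flow P 1 T"
  shows "run (max_sat_prog P) (input_mem inp) ((2 * n + 2) * (N * Q) * (L * K_total) + nat \<lfloor>T N N\<rfloor>)
    (\<lambda>R. R 0 = tab inp \<and> R 1 0 = max_sat F)"
proof -
  let ?T1 = "L * K_init * Q" and ?T2 = "(M + 1) * ((2 * n + 2) * (Q * (L * K_parse)))"
  let ?T3 = "6 * ((N + 1) * (L * K_emit))" and ?T4 = "nat \<lfloor>T N N\<rfloor>" and ?T5 = "2 * (N * Q) * (L * K_out)"
  let ?zero = "\<lambda>R. R 1 0 = 0 \<and> R 17 0 = 0 \<and> (\<forall>a>20. R a = (\<lambda>_. 0))"
  have "run (max_sat_prog P) (input_mem inp) (?T1 + (?T2 + (?T3 + (?T4 + ?T5))))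
    (\<lambda>R. R 0 = tab inp \<and> R 1 0 = max_sat F)"
    unfolding max_sat_prog_def
  proof (rule run_Seq_add[OF run_init], rule run_Seq_add[where ?Q1.0 = "\<lambda>R. ready R \<and> ?zero R \<and> R 20 = (\<lambda>_. 0)"])
    fix R :: mem
    assume R: "env R \<and> R 11 0 = 2 \<and> (\<forall>a. a \<notin> {0, 2, 3, 4, 5, 9, 11, 19} \<longrightarrow> R a = (\<lambda>_. 0))"
    show "run parse R ?T2 (\<lambda>R. ready R \<and> ?zero R \<and> R 20 = (\<lambda>_. 0))"
      by (rule run_mono[OF run_parse]) (use R in \<open>simp_all add: ready_def env_def\<close>)
  next
    fix R :: mem
    assume R: "ready R \<and> ?zero R \<and> R 20 = (\<lambda>_. 0)"
    show "run (Seq write_net (Seq (shift_com 20 P) out_loop)) R (?T3 + (?T4 + ?T5))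
      (\<lambda>R. R 0 = tab inp \<and> R 1 0 = max_sat F)"
    proof (rule run_Seq[where ?Q1.0 = "\<lambda>R. env R \<and> R 1 0 = 0 \<and> (\<forall>a>20. R a = (\<lambda>_. 0)) \<and>
        R 20 = tab (encode_network N edges cap)"])
      show "run write_net R ?T3 (\<lambda>R. env R \<and> R 1 0 = 0 \<and> (\<forall>a>20. R a = (\<lambda>_. 0)) \<and>
        R 20 = tab (encode_network N edges cap))"
        by (rule run_mono[OF run_write_net]) (use R in \<open>simp_all add: ready_def env_def\<close>)
    next
      fix R :: mem
      assume R: "env R \<and> R 1 0 = 0 \<and> (\<forall>a>20. R a = (\<lambda>_. 0)) \<and> R 20 = tab (encode_network N edges cap)"
      then have "run (shift_com 20 P) R ?T4 (\<lambda>R'. (\<forall>a<20. R' a = R a) \<and>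
        (\<forall>i<(M + 2) * Q. \<forall>g<Q. R' 21 (nd 4 i * N + nd 7 g) = flow i g))"
        by (intro run_flow_prog[OF P]) blast+
      then show "run (Seq (shift_com 20 P) out_loop) R (?T4 + ?T5) (\<lambda>R. R 0 = tab inp \<and> R 1 0 = max_sat F)"
      proof (rule run_Seq)
        fix R' :: mem
        assume R': "(\<forall>a<20. R' a = R a) \<and> (\<forall>i<(M + 2) * Q. \<forall>g<Q. R' 21 (nd 4 i * N + nd 7 g) = flow i g)"
        have env': "env R'" "R' 1 0 = 0" using R R' by (simp_all add: env_def)
        show "run out_loop R' ?T5 (\<lambda>R. R 0 = tab inp \<and> R 1 0 = max_sat F)"
        proof (rule run_mono[OF run_out_loop[OF env']])
          show "\<And>i g. i < (M + 2) * Q \<Longrightarrow> g < Q \<Longrightarrow> R' 21 (nd 4 i * N + nd 7 g) = flow i g"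
            using R' by blast
          fix R'' :: mem assume "(\<forall>a. a \<notin> {1, 16} \<longrightarrow> R'' a = R' a) \<and> R'' 1 0 = max_sat F"
          then show "R'' 0 = tab inp \<and> R'' 1 0 = max_sat F" using env' by (simp add: env_def)
        qed simp
      qed simp
    qed simp
  qed
  then show ?thesis
  proof (rule run_mono)
    let ?B = "(2 * n + 2) * (N * Q) * L"
    have N1: "1 \<le> N" using N_ge(4) by simp
    have "N * Q \<le> (2 * n + 2) * (N * Q)" by simp
    then have NQ: "N * Q * L \<le> ?B" by (rule mult_le_mono1)
    have "Q \<le> N * Q" using N1 by simp
    then have "Q * L \<le> N * Q * L" by (rule mult_le_mono1)
    then have "Q * L \<le> ?B" using NQ by (rule le_trans)
    then have "Q * L * K_init \<le> ?B * K_init" by (rule mult_le_mono1)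
    moreover have "(M + 1) * Q \<le> N * Q" using N_ge(4) by (intro mult_le_mono1)
    then have "(2 * n + 2) * ((M + 1) * Q) * L * K_parse \<le> ?B * K_parse"
      by (rule mult_le_mono1[OF mult_le_mono1[OF mult_le_mono2]])
    moreover have "N + 1 \<le> 2 * (N * Q)"
    proof -
      have "N \<le> N * Q" using Q_ge by simp
      then show ?thesis using N1 by linarith
    qed
    then have "6 * ((N + 1) * L) \<le> 6 * (2 * (N * Q) * L)" by (rule mult_le_mono2[OF mult_le_mono1])
    then have "6 * ((N + 1) * L) \<le> 12 * (N * Q * L)" by simp
    then have "6 * ((N + 1) * L) * K_emit \<le> 12 * ?B * K_emit" 
      by (rule mult_le_mono1[OF le_trans[OF _ mult_le_mono2[OF NQ]]])
    moreover have "2 * (N * Q * L) * K_out \<le> 2 * ?B * K_out" by (rule mult_le_mono1[OF mult_le_mono2[OF NQ]])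
    ultimately have "Q * L * K_init + (2 * n + 2) * ((M + 1) * Q) * L * K_parse + 6 * ((N + 1) * L) * K_emit +
      2 * (N * Q * L) * K_out \<le> ?B * K_init + ?B * K_parse + 12 * ?B * K_emit + 2 * ?B * K_out"
      by (intro add_mono)
    then show "?T1 + (?T2 + (?T3 + (?T4 + ?T5))) \<le> (2 * n + 2) * (N * Q) * (L * K_total) + ?T4"
      by (simp add: K_total_def algebra_simps)
  qed
qed

end

section \<open>Exponents and polynomial factors\<close>

section \<open>Running times\<close>

text \<open>From \<open>1 + x \<le> exp x\<close> with \<open>x = c * n\<close>, raised to the power
  \<open>Suc j\<close>; \<open>c\<close> is chosen so that the result is exactly
  \<open>2 powr (d * n)\<close>, and \<open>A\<close> compensates for a small
  \<open>c\<close>.\<close>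

lemma polynomial_le_exponential:
  fixes d :: real
  assumes "d > 0"
  shows "\<exists>C. \<forall>n::nat. (real n + 1) ^ Suc j \<le> C * 2 powr (d * real n)"
proof -
  define c where "c = d * ln 2 / Suc j"
  define A where "A = max 1 (1 / c)"
  have c: "c > 0" using assms by (simp add: c_def)
  have "(real n + 1) ^ Suc j \<le> A ^ Suc j * 2 powr (d * real n)" for n
  proof -
    have "real n \<le> A * (c * real n)"
    proof -
      have "1 \<le> A * c" using c mult_right_mono[of "1 / c" A c] by (simp add: A_def)
      then show ?thesis using mult_right_mono[of 1 "A * c" "real n"] by (simp add: mult.assoc)
    qed
    moreover have "1 \<le> A" by (simp add: A_def)
    ultimately have "real n + 1 \<le> A * (1 + c * real n)" by (simp add: algebra_simps)
    also have "\<dots> \<le> A * exp (c * real n)"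
      using \<open>1 \<le> A\<close> by (intro mult_left_mono) auto
    finally have "(real n + 1) ^ Suc j \<le> (A * exp (c * real n)) ^ Suc j"
      by (intro power_mono) auto
    also have "\<dots> = A ^ Suc j * exp (real (Suc j) * (c * real n))"
      by (simp only: power_mult_distrib exp_of_nat_mult)
    also have "real (Suc j) * (c * real n) = d * real n * ln 2" by (simp add: c_def field_simps)
    also have "exp (d * real n * ln 2) = 2 powr (d * real n)" by (simp add: powr_def)
    finally show ?thesis .
  qed
  then show ?thesis by blast
qed

text \<open>The cube of \<open>q\<close> is at most 512 times 2^n. Replacing \<epsilon> by the
  smaller \<open>e\<close> is allowed because the base is at least 1; it keeps the exponent
  \<open>1 - e\<close> between 0 and 1, so the base may be enlarged and its polynomial part bounded
  by itself. The sign of \<open>K\<close> is arbitrary, hence the absolute value.\<close>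

lemma flow_time_le:
  fixes e K :: real and n q m N :: nat
  assumes e: "0 < e" "e \<le> 1/3" "e \<le> \<epsilon>"
    and q: "real q \<le> 8 * 2 powr (real n / 3)" and N: "1 \<le> N" "real N \<le> 81 * real q * (real m + 1) ^ 2"
  shows "K * (real N ^ 2 * real N) powr (1 - \<epsilon>) \<le>
    \<bar>K\<bar> * 81 ^ 3 * 512 * ((real m + 1) ^ 6 * 2 powr ((1 - e) * real n))"
proof -
  have q3: "real q ^ 3 \<le> 512 * 2 powr real n"
  proof -
    have "real q ^ 3 \<le> (8 * 2 powr (real n / 3)) ^ 3" using q by (intro power_mono) auto
    also have "\<dots> = 512 * (2 powr (real n / 3)) ^ 3" by (simp add: power_mult_distrib)
    also have "(2 powr (real n / 3)) ^ 3 = 2 powr real n" by (simp add: powr_power)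
    finally show ?thesis .
  qed
  have "real N ^ 2 * real N = real N ^ 3" by (simp add: power3_eq_cube power2_eq_square)
  also have "\<dots> \<le> (81 * real q * (real m + 1) ^ 2) ^ 3" using N by (intro power_mono) auto
  also have "\<dots> = 81 ^ 3 * (real m + 1) ^ 6 * real q ^ 3" by (simp add: power_mult_distrib)
  also have "\<dots> \<le> 81 ^ 3 * (real m + 1) ^ 6 * (512 * 2 powr real n)"
    using q3 by (intro mult_left_mono) auto
  finally have X: "real N ^ 2 * real N \<le> (81 ^ 3 * 512 * (real m + 1) ^ 6) * 2 powr real n"
    by (simp add: mult_ac)
  have N1: "1 \<le> real N ^ 2 * real N" using N(1) by (simp add: mult_ge1_I)
  let ?Y = "81 ^ 3 * 512 * (real m + 1) ^ 6"
  have Y1: "1 \<le> ?Y"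
  proof -
    have "1 * 1 \<le> 81 ^ 3 * 512 * (real m + 1) ^ 6" by (intro mult_mono one_le_power) auto
    then show ?thesis by simp
  qed
  have "(real N ^ 2 * real N) powr (1 - \<epsilon>) \<le> (real N ^ 2 * real N) powr (1 - e)"
    using N1 e by (intro powr_mono) auto
  also have "\<dots> \<le> (?Y * 2 powr real n) powr (1 - e)"
    using X N1 e by (intro powr_mono2) auto
  also have "\<dots> = ?Y powr (1 - e) * 2 powr ((1 - e) * real n)"
    using Y1 by (simp add: powr_mult powr_powr mult.commute)
  also have "\<dots> \<le> ?Y powr 1 * 2 powr ((1 - e) * real n)"
    using Y1 e by (intro mult_right_mono powr_mono) auto
  also have "?Y powr 1 = ?Y" using Y1 by (intro powr_one) linarith
  finally have le: "(real N ^ 2 * real N) powr (1 - \<epsilon>) \<le> ?Y * 2 powr ((1 - e) * real n)" .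
  have "K * (real N ^ 2 * real N) powr (1 - \<epsilon>) \<le> \<bar>K\<bar> * (real N ^ 2 * real N) powr (1 - \<epsilon>)"
    by (intro mult_right_mono) auto
  also have "\<dots> \<le> \<bar>K\<bar> * (?Y * 2 powr ((1 - e) * real n))" using le by (intro mult_left_mono) auto
  finally show ?thesis by (simp add: mult_ac)
qed

text \<open>Everything outside the max-flow program is of order \<open>q ^ 2\<close>, that is,
  2^(2n/3) up to polynomial factors. This is where \<open>e \<le> 1/3\<close> comes from.\<close>

lemma own_time_le:
  fixes e :: real and n q m N L :: nat
  assumes e: "e \<le> 1/3"
    and q: "real q \<le> 8 * 2 powr (real n / 3)" and N: "real N \<le> 81 * real q * (real m + 1) ^ 2"
    and L: "real L \<le> 17 * (real n + 1) * (real m + 1)"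
  shows "real ((2 * n + 2) * (N * q) * (L * K)) \<le>
    2 * 81 * 64 * 17 * real K * ((real n + 1) ^ 2 * (real m + 1) ^ 6 * 2 powr ((1 - e) * real n))"
proof -
  have q2: "real q ^ 2 \<le> 64 * 2 powr ((1 - e) * real n)"
  proof -
    have "real q ^ 2 \<le> (8 * 2 powr (real n / 3)) ^ 2" using q by (intro power_mono) auto
    also have "\<dots> = 64 * (2 powr (real n / 3)) ^ 2" by (simp add: power_mult_distrib)
    also have "(2 powr (real n / 3)) ^ 2 = 2 powr (2 / 3 * real n)" by (simp add: powr_power)
    also have "\<dots> \<le> 2 powr ((1 - e) * real n)" using e by (intro powr_mono mult_right_mono) auto
    finally show ?thesis by simp
  qed
  have "real ((2 * n + 2) * (N * q) * (L * K)) = (2 * (real n + 1)) * (real N * real q) * (real L * real K)"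
    by (simp add: algebra_simps)
  also have "\<dots> \<le> (2 * (real n + 1)) * ((81 * real q * (real m + 1) ^ 2) * real q) *
      ((17 * (real n + 1) * (real m + 1)) * real K)"
    using N L by (intro mult_mono mult_left_mono mult_right_mono) auto
  also have "\<dots> = 2 * 81 * 17 * real K * ((real n + 1) ^ 2 * (real m + 1) ^ 3 * real q ^ 2)"
    by (simp add: power2_eq_square power3_eq_cube algebra_simps)
  also have "\<dots> \<le> 2 * 81 * 17 * real K * ((real n + 1) ^ 2 * (real m + 1) ^ 6 * (64 * 2 powr ((1 - e) * real n)))"
    using q2 by (intro mult_left_mono mult_mono power_increasing) auto
  finally show ?thesis by (simp add: mult_ac)
qed

text \<open>The dependence on the number of clauses is kept polynomial and explicit, so that the
  bound serves both conclusions: for linearly many clauses and for k-SAT with arbitrarily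
  many.\<close>

lemma max_sat_prog_time:
  assumes "\<epsilon> > 0"
    and P: "solves_all_pairs_max_flow P 1 (\<lambda>n m. K * (real n ^ 2 * real m) powr (1 - \<epsilon>))"
  shows "\<exists>C\<ge>0. \<forall>n F. is_cnf n F \<longrightarrow> (\<exists>t R. exec (max_sat_prog P) (input_mem (encode_cnf n F)) t R \<and>
    R 0 = tab (encode_cnf n F) \<and> R 1 0 = max_sat F \<and>
    real t \<le> C * ((real n + 1) ^ 2 * (real (length F) + 1) ^ 6 * 2 powr ((1 - min \<epsilon> (1/3)) * real n)))"
proof -
  let ?e = "min \<epsilon> (1/3)"
  let ?K = "formula_machine.K_total"
  let ?C = "2 * 81 * 64 * 17 * real ?K + \<bar>K\<bar> * 81 ^ 3 * 512"
  have "\<exists>t R. exec (max_sat_prog P) (input_mem (encode_cnf n F)) t R \<and>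
    R 0 = tab (encode_cnf n F) \<and> R 1 0 = max_sat F \<and>
    real t \<le> ?C * ((real n + 1) ^ 2 * (real (length F) + 1) ^ 6 * 2 powr ((1 - ?e) * real n))"
    if F: "is_cnf n F" for n F
  proof -
    define k where "k = n div 3 + 3"
    interpret formula_machine n k F
      by unfold_locales (use F in \<open>simp_all add: k_def\<close>)
    let ?T = "K * (real N ^ 2 * real N) powr (1 - \<epsilon>)"
    let ?X = "2 powr ((1 - ?e) * real n)"
    have k: "real k \<le> real n / 3 + 3"
      using of_nat_div_le_of_nat[of n 3, where ?'a = real] by (simp add: k_def)
    have "real Q = 2 powr real k" by (simp add: Q_def powr_realpow)
    also have "\<dots> \<le> 2 powr (real n / 3 + 3)" using k by (intro powr_mono) auto
    also have "\<dots> = 8 * 2 powr (real n / 3)" by (simp add: powr_add)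
    finally have q: "real Q \<le> 8 * 2 powr (real n / 3)" .
    \<comment> \<open>The constant 81 is attained at \<open>M = 0\<close>.\<close>
    have "(M + 5) * m1 + 1 \<le> 81 * (M + 1) ^ 2"
      by (simp add: m1_def power2_eq_square algebra_simps)
    then have "N \<le> Q * (81 * (M + 1) ^ 2)" unfolding N_eq by (rule mult_le_mono2)
    then have "real N \<le> real (Q * (81 * (M + 1) ^ 2))" by (rule of_nat_mono)
    then have N: "real N \<le> 81 * real Q * (real M + 1) ^ 2" by (simp add: mult_ac add.commute)
    have kn: "k \<le> n + 3" by (simp add: k_def)
    have "L \<le> 17 * (n + 1) * (M + 1)" using kn by (simp add: L_def algebra_simps)
    then have "real L \<le> real (17 * (n + 1) * (M + 1))" by (rule of_nat_mono)
    then have L: "real L \<le> 17 * (real n + 1) * (real M + 1)" by (simp add: algebra_simps)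
    obtain t R where t: "exec (max_sat_prog P) (input_mem inp) t R" "R 0 = tab inp" "R 1 0 = max_sat F"
      and le: "t \<le> (2 * n + 2) * (N * Q) * (L * ?K) + nat \<lfloor>?T\<rfloor>"
      using run_max_sat_prog[OF P] unfolding run_def by blast
    have N1: "1 \<le> N" using N_ge(4) by simp
    have T: "?T \<le> \<bar>K\<bar> * 81 ^ 3 * 512 * ((real M + 1) ^ 6 * ?X)"
      using assms(1) by (intro flow_time_le[OF _ _ _ q N1 N]) auto
    have T': "real (nat \<lfloor>?T\<rfloor>) \<le> \<bar>K\<bar> * 81 ^ 3 * 512 * ((real M + 1) ^ 6 * ?X)"
    proof (cases "0 \<le> ?T")
      case True
      then have "real (nat \<lfloor>?T\<rfloor>) \<le> ?T" by simp
      then show ?thesis using T by linarith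
    next
      \<comment> \<open>Possible only for negative \<open>K\<close>; the time bound, a natural
        number, is then truncated to 0.\<close>
      case False
      then have "nat \<lfloor>?T\<rfloor> = 0" by simp
      then show ?thesis by simp
    qed
    have n1: "1 * ((real M + 1) ^ 6 * ?X) \<le> (real n + 1) ^ 2 * ((real M + 1) ^ 6 * ?X)"
      by (intro mult_right_mono one_le_power) auto
    have "real t \<le> real ((2 * n + 2) * (N * Q) * (L * ?K)) + real (nat \<lfloor>?T\<rfloor>)"
      using le by (metis of_nat_add of_nat_mono)
    also have "\<dots> \<le> 2 * 81 * 64 * 17 * real ?K * ((real n + 1) ^ 2 * (real M + 1) ^ 6 * ?X) +
        \<bar>K\<bar> * 81 ^ 3 * 512 * ((real M + 1) ^ 6 * ?X)"
      using T' by (intro add_mono own_time_le[OF _ q N L]) auto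
    also have "\<dots> \<le> 2 * 81 * 64 * 17 * real ?K * ((real n + 1) ^ 2 * (real M + 1) ^ 6 * ?X) +
        \<bar>K\<bar> * 81 ^ 3 * 512 * ((real n + 1) ^ 2 * (real M + 1) ^ 6 * ?X)"
      using n1 by (intro add_left_mono mult_left_mono) (simp_all add: mult_ac)
    also have "\<dots> = ?C * ((real n + 1) ^ 2 * (real M + 1) ^ 6 * ?X)"
      by (simp only: distrib_right)
    finally show ?thesis using t unfolding inp_def by blast
  qed
  moreover have "0 \<le> ?C" by simp
  ultimately show ?thesis by blast
qed

text \<open>The number of clauses is still in cell 1 of the input, which \<open>max_sat_prog\<close>
  preserves; the result is 1 iff the maximum reaches it.\<close>

definition sat_test :: com where
  "sat_test = setr 1 (Const 1 \<ominus> (Read 0 (Const 1) \<ominus> reg 1))"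

lemma run_sat_test:
  assumes "R 0 = tab (encode_cnf n F)" "R 1 0 = max_sat F"
  shows "run sat_test R ((length F + 1) * tcost sat_test) (\<lambda>R'. R' 1 0 = of_bool (satisfiable F))"
proof -
  have M: "length F < 2 ^ (length F + 1)" "max_sat F < 2 ^ (length F + 1)" "(1::nat) < 2 ^ (length F + 1)"
    using less_exp[of "length F + 1"] max_sat_le[of F] by linarith+
  show ?thesis unfolding sat_test_def
    by (rule lrun_Write)
      (use assms M max_sat_le[of F] in \<open>auto simp: tab_encode_cnf satisfiable_iff_max_sat\<close>)
qed

theorem theorem1p2:
  fixes \<epsilon> :: real
  assumes "\<epsilon> > 0"
    and "\<forall>C. \<exists>P K. solves_all_pairs_max_flow P C
           (\<lambda>n m. K * (real n ^ 2 * real m) powr (1 - \<epsilon>))"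
  shows "(\<exists>\<delta>>0. \<forall>C. \<exists>P K. solves_max_cnf_sat P C (\<lambda>n. K * 2 powr ((1 - \<delta>) * real n)))
         \<and> \<not> SETH"
proof -
  obtain P K where "solves_all_pairs_max_flow P 1 (\<lambda>n m. K * (real n ^ 2 * real m) powr (1 - \<epsilon>))"
    using assms(2) by blast
  from max_sat_prog_time[OF assms(1) this] obtain A where A: "0 \<le> A"
    and prog: "\<And>n F. is_cnf n F \<Longrightarrow> \<exists>t R. exec (max_sat_prog P) (input_mem (encode_cnf n F)) t R \<and>
      R 0 = tab (encode_cnf n F) \<and> R 1 0 = max_sat F \<and>
      real t \<le> A * ((real n + 1) ^ 2 * (real (length F) + 1) ^ 6 * 2 powr ((1 - min \<epsilon> (1/3)) * real n))"
    by blast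
  \<comment> \<open>Half of the saving is given up to absorb polynomial factors in \<open>n\<close>.
    It depends on \<epsilon> alone, not on the clause density \<open>C\<close> or on the width
    \<open>k\<close>.\<close>
  define \<delta> where "\<delta> = min \<epsilon> (1/3) / 2"
  have \<delta>: "\<delta> > 0" "\<delta> \<le> 1/6" using assms(1) by (auto simp: \<delta>_def)
  have split: "2 powr (\<delta> * x) * 2 powr ((1 - min \<epsilon> (1/3)) * x) = 2 powr ((1 - \<delta>) * x)" for x :: real
    unfolding powr_add[symmetric] by (simp add: \<delta>_def algebra_simps)
  have "\<exists>P K. solves_max_cnf_sat P C (\<lambda>n. K * 2 powr ((1 - \<delta>) * real n))" for C
  proof -
    \<comment> \<open>The exponent 8 is 2 from the factor in \<open>n\<close> plus 6 from the
      clauses, whose number is linear in \<open>n\<close>.\<close>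
    obtain B where B: "\<And>n::nat. (real n + 1) ^ 8 \<le> B * 2 powr (\<delta> * real n)"
      using polynomial_le_exponential[OF \<delta>(1), of 7] by auto
    have "real t \<le> A * (real C + 1) ^ 6 * B * 2 powr ((1 - \<delta>) * real n)"
      if "length F \<le> C * n" and
        t: "real t \<le> A * ((real n + 1) ^ 2 * (real (length F) + 1) ^ 6 * 2 powr ((1 - min \<epsilon> (1/3)) * real n))"
      for t n and F :: cnf
    proof -
      let ?Y = "2 powr ((1 - min \<epsilon> (1/3)) * real n)"
      have "length F + 1 \<le> (C + 1) * (n + 1)" using that(1) by simp
      then have "real (length F + 1) \<le> real ((C + 1) * (n + 1))" by (rule of_nat_mono)
      then have F: "real (length F) + 1 \<le> (real C + 1) * (real n + 1)" by (simp add: algebra_simps)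
      have "(real n + 1) ^ 2 * (real (length F) + 1) ^ 6 \<le> (real n + 1) ^ 2 * ((real C + 1) * (real n + 1)) ^ 6"
        using F by (intro mult_left_mono power_mono) auto
      also have "\<dots> = (real C + 1) ^ 6 * (real n + 1) ^ 8"
        by (simp add: power_mult_distrib power_add[of _ 2 6, simplified])
      also have "\<dots> \<le> (real C + 1) ^ 6 * (B * 2 powr (\<delta> * real n))"
        using B by (intro mult_left_mono) auto
      finally have "A * ((real n + 1) ^ 2 * (real (length F) + 1) ^ 6 * ?Y) \<le>
        A * ((real C + 1) ^ 6 * (B * 2 powr (\<delta> * real n)) * ?Y)"
        using A by (intro mult_left_mono mult_right_mono) auto
      also have "\<dots> = A * (real C + 1) ^ 6 * B * (2 powr (\<delta> * real n) * ?Y)" by simp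
      finally show ?thesis using t unfolding split by linarith
    qed
    then show ?thesis unfolding solves_max_cnf_sat_def computes_within_def using prog by meson
  qed
  moreover have "\<not> SETH"
  proof -
    obtain B where B: "\<And>n::nat. (real n + 1) ^ 2 \<le> B * 2 powr (\<delta> * real n)"
      using polynomial_le_exponential[OF \<delta>(1), of 1] by (auto simp: numeral_2_eq_2)
    \<comment> \<open>\<open>[:1, 1:]\<close> is the polynomial x + 1; the first summand is for the
      maximisation, the second for the final test. The power of \<open>n\<close> has gone into
      \<open>B\<close> and \<delta>.\<close>
    define p :: "real poly" where "p = smult (A * B) ([:1, 1:] ^ 6) + smult (real (tcost sat_test)) [:1, 1:]"
    \<comment> \<open>Program, \<delta> and polynomial do not depend on \<open>k\<close>, so
      \<delta> refutes the hypothesis for all \<open>k\<close> at once.\<close>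
    have "solves_k_sat k (Seq (max_sat_prog P) sat_test) (\<lambda>n m. 2 powr ((1 - \<delta>) * real n) * poly p (real m))" for k
      unfolding solves_k_sat_def
    proof (intro allI impI)
      fix n F assume "is_cnf n F \<and> (\<forall>c\<in>set F. length c \<le> k)"
      then obtain t R where R: "exec (max_sat_prog P) (input_mem (encode_cnf n F)) t R"
          "R 0 = tab (encode_cnf n F)" "R 1 0 = max_sat F"
        and t: "real t \<le> A * ((real n + 1) ^ 2 * (real (length F) + 1) ^ 6 * 2 powr ((1 - min \<epsilon> (1/3)) * real n))"
        using prog by blast
      obtain t' R' where R': "exec sat_test R t' R'" "t' \<le> (length F + 1) * tcost sat_test"
          "R' 1 0 = of_bool (satisfiable F)"
        using run_sat_test[OF R(2,3)] unfolding run_def by blast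
      let ?m = "real (length F) + 1" and ?X = "2 powr ((1 - \<delta>) * real n)"
      let ?Y = "2 powr ((1 - min \<epsilon> (1/3)) * real n)"
      have "A * ((real n + 1) ^ 2 * ?m ^ 6 * ?Y) \<le> A * ((B * 2 powr (\<delta> * real n)) * ?m ^ 6 * ?Y)"
        using A B by (intro mult_left_mono mult_right_mono) auto
      also have "\<dots> = A * B * ?m ^ 6 * (2 powr (\<delta> * real n) * ?Y)" by simp
      finally have 1: "real t \<le> A * B * ?m ^ 6 * ?X" using t unfolding split by linarith
      have "real t' \<le> real ((length F + 1) * tcost sat_test)" using R'(2) by (rule of_nat_mono)
      also have "\<dots> = real (tcost sat_test) * ?m * 1" by (simp add: algebra_simps)
      also have "\<dots> \<le> real (tcost sat_test) * ?m * ?X"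
        using \<delta> by (intro mult_left_mono ge_one_powr_ge_zero) auto
      finally have "real t + real t' \<le> A * B * ?m ^ 6 * ?X + real (tcost sat_test) * ?m * ?X"
        using 1 by linarith
      also have "\<dots> = ?X * poly p (real (length F))"
        by (simp add: p_def algebra_simps)
      finally show "computes_within (Seq (max_sat_prog P) sat_test) (encode_cnf n F)
        (?X * poly p (real (length F))) (\<lambda>out. out 0 = of_bool (satisfiable F))"
        unfolding computes_within_def using exec.Seq[OF R(1) R'(1)] R'(3)
        by (intro exI[of _ "t + t'"] exI[of _ R']) simp
    qed
    then show ?thesis unfolding SETH_def using \<delta>(1) by blast
  qed
  ultimately show ?thesis using \<delta>(1) by blast
qed

end
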